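(* Let $u:(M^m,g)\to(N,h)$ be a smooth map between Riemannian manifolds, let $X$ be a smooth compactly supported vector field on $M$ with flow $\varphi_t$, and let $u_t=u\circ\varphi_t$. Then $$\frac{d}{dt}E_{\Phi_{(3)}}(u_t)\Big|_{t=0}=-\int_M\Big\langle S_{\Phi_{(3)}},\tfrac12 L_Xg\Big\rangle\,dv_g,$$ where $L_X$ is the Lie derivative in the direction $X$.
   Context: Let $\{e_i\}_{i=1}^m$ be a local orthonormal frame on $(M,g)$. Define $d_{(3)}u(X)=\sum_{j,k=1}^m h(du(X),du(e_j))h(du(e_j),du(e_k))du(e_k)$ and $\|d_{(3)}u\|^2=\sum_{i=1}^m h(d_{(3)}u(e_i),du(e_i))$. The $\Phi_{(3)}$-energy is $E_{\Phi_{(3)}}(u)=\int_M\frac{\|d_{(3)}u\|^2}{6}\,dv_g$. The stress-energy tensor $S_{\Phi_{(3)}}$ of $u$ is the symmetric $2$-tensor on $M$ $$S_{\Phi_{(3)}}(X,Y)=\frac{\|d_{(3)}u\|^2}{6}g(X,Y)-h(d_{(3)}u(X),du(Y)).$$ The inner product of $2$-tensors is $\langle S,T\rangle=\sum_{i,j}S(e_i,e_j)T(e_i,e_j)$. If $M$ is noncompact the derivative of the energy is understood as the derivative of the energy integrated over a compact set containing the support of $X$. Manifolds are without boundary. *)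

theory Defs
  imports "HOL-Analysis.Analysis"
begin

section \<open>Smooth maps between Euclidean spaces\<close>

text \<open>Only meaningful for open \<open>S\<close>. In finite dimension, having continuous iterated directional
  derivatives of all orders up to \<open>k\<close> is the same as being of class \<open>C^k\<close>.\<close>

primrec Ck_on :: "nat \<Rightarrow> 'a::real_normed_vector set \<Rightarrow> ('a \<Rightarrow> 'b::real_normed_vector) \<Rightarrow> bool" where
  "Ck_on 0 S f \<longleftrightarrow> continuous_on S f"
| "Ck_on (Suc k) S f \<longleftrightarrow> (\<forall>x\<in>S. f differentiable (at x)) \<and>
     (\<forall>v. Ck_on k S (\<lambda>x. frechet_derivative f (at x) v))"

definition smooth_on :: "'a::real_normed_vector set \<Rightarrow> ('a \<Rightarrow> 'b::real_normed_vector) \<Rightarrow> bool" where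
  "smooth_on S f \<longleftrightarrow> (\<forall>k. Ck_on k S f)"


section \<open>Manifolds\<close>

text \<open>A manifold without boundary is a topological type \<open>'a\<close> (to be used with the classes
  \<open>second_countable_topology\<close> and \<open>t2_space\<close>) together with a smooth atlas. A chart is a pair of its
  domain and its coordinate map; outside the domain the coordinate map is irrelevant. The atlas need
  not be maximal.\<close>

type_synonym ('a, 'e) chart = "'a set \<times> ('a \<Rightarrow> 'e)"
type_synonym ('a, 'e) atlas = "('a, 'e) chart set"

definition chart_image :: "('a, 'e) chart \<Rightarrow> 'e set" where
  "chart_image c = snd c ` fst c"

definition chart_inv :: "('a, 'e) chart \<Rightarrow> 'e \<Rightarrow> 'a" where
  "chart_inv c = inv_into (fst c) (snd c)"

definition transition :: "('a, 'e) chart \<Rightarrow> ('a, 'e) chart \<Rightarrow> 'e \<Rightarrow> 'e" where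
  "transition c d = snd d \<circ> chart_inv c"

definition smooth_atlas :: "('a::topological_space, 'e::euclidean_space) atlas \<Rightarrow> bool" where
  "smooth_atlas A \<longleftrightarrow>
     (\<Union>c\<in>A. fst c) = UNIV \<and>
     (\<forall>c\<in>A. open (fst c) \<and> open (chart_image c) \<and>
        homeomorphism (fst c) (chart_image c) (snd c) (chart_inv c)) \<and>
     (\<forall>c\<in>A. \<forall>d\<in>A. smooth_on (snd c ` (fst c \<inter> fst d)) (transition c d))"

definition charts_at :: "('a, 'e) atlas \<Rightarrow> 'a \<Rightarrow> ('a, 'e) chart set" where
  "charts_at A p = {c \<in> A. p \<in> fst c}"

definition smooth_map ::
  "('a::topological_space, 'e::euclidean_space) atlas \<Rightarrow>
   ('b::topological_space, 'f::euclidean_space) atlas \<Rightarrow> ('a \<Rightarrow> 'b) \<Rightarrow> bool" where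
  "smooth_map A B u \<longleftrightarrow> continuous_on UNIV u \<and>
     (\<forall>c\<in>A. \<forall>d\<in>B. smooth_on (snd c ` (fst c \<inter> u -` fst d)) (snd d \<circ> u \<circ> chart_inv c))"

text \<open>The product manifold of the real line with \<open>A\<close>.\<close>

definition line_times :: "('a, 'e) atlas \<Rightarrow> (real \<times> 'a, real \<times> 'e) atlas" where
  "line_times A = (\<lambda>c. (UNIV \<times> fst c, \<lambda>(t, p). (t, snd c p))) ` A"


section \<open>Tangent vectors\<close>

text \<open>A tangent vector at \<open>p\<close> is the usual equivalence class of pairs of a chart around \<open>p\<close> and a
  coordinate vector, represented as the function that sends each chart around \<open>p\<close> to the coordinates
  in that chart (and all other charts to zero, so that equality of tangent vectors is equality of
  functions). The vector space operations are pointwise.\<close>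

type_synonym ('a, 'e) tvec = "('a, 'e) chart \<Rightarrow> 'e"

definition tangent_space :: "('a, 'e::euclidean_space) atlas \<Rightarrow> 'a \<Rightarrow> ('a, 'e) tvec set" where
  "tangent_space A p = {v.
     (\<forall>c. c \<notin> charts_at A p \<longrightarrow> v c = 0) \<and>
     (\<forall>c\<in>charts_at A p. \<forall>d\<in>charts_at A p.
        v d = frechet_derivative (transition c d) (at (snd c p)) (v c))}"

text \<open>The tangent vector at \<open>p\<close> with coordinates \<open>a\<close> in the chart \<open>c\<close>.\<close>

definition coord_vec ::
  "('a, 'e::euclidean_space) atlas \<Rightarrow> ('a, 'e) chart \<Rightarrow> 'a \<Rightarrow> 'e \<Rightarrow> ('a, 'e) tvec" where
  "coord_vec A c p a = (\<lambda>d. if d \<in> charts_at A p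
     then frechet_derivative (transition c d) (at (snd c p)) a else 0)"

text \<open>The differential \<open>du\<close> at \<open>p\<close>; it does not depend on the chart \<open>c\<close> chosen around \<open>p\<close>.\<close>

definition differential ::
  "('a, 'e::euclidean_space) atlas \<Rightarrow> ('b, 'f::euclidean_space) atlas \<Rightarrow> ('a \<Rightarrow> 'b) \<Rightarrow> 'a \<Rightarrow>
   ('a, 'e) tvec \<Rightarrow> ('b, 'f) tvec" where
  "differential A B u p v = (\<lambda>d. if d \<in> charts_at B (u p)
     then (let c = (SOME c. c \<in> charts_at A p)
           in frechet_derivative (snd d \<circ> u \<circ> chart_inv c) (at (snd c p)) (v c))
     else 0)"


section \<open>Vector fields and flows\<close>

definition smooth_vector_field ::
  "('a, 'e::euclidean_space) atlas \<Rightarrow> ('a \<Rightarrow> ('a, 'e) tvec) \<Rightarrow> bool" where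
  "smooth_vector_field A X \<longleftrightarrow> (\<forall>p. X p \<in> tangent_space A p) \<and>
     (\<forall>c\<in>A. smooth_on (chart_image c) (\<lambda>x. X (chart_inv c x) c))"

definition vf_support ::
  "('a::topological_space \<Rightarrow> ('a, 'e::euclidean_space) tvec) \<Rightarrow> 'a set" where
  "vf_support X = closure {p. X p \<noteq> (\<lambda>_. 0)}"

text \<open>The global flow of a complete vector field: the smooth map \<open>(t, p) \<mapsto> \<phi> t p\<close> whose curves
  \<open>t \<mapsto> \<phi> t p\<close> are the integral curves of \<open>X\<close> starting at \<open>p\<close>.\<close>

definition is_flow ::
  "('a::topological_space, 'e::euclidean_space) atlas \<Rightarrow> ('a \<Rightarrow> ('a, 'e) tvec) \<Rightarrow>
   (real \<Rightarrow> 'a \<Rightarrow> 'a) \<Rightarrow> bool" where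
  "is_flow A X \<phi> \<longleftrightarrow>
     smooth_map (line_times A) A (\<lambda>(t, p). \<phi> t p) \<and>
     (\<forall>p. \<phi> 0 p = p) \<and>
     (\<forall>p t. \<forall>c\<in>charts_at A (\<phi> t p).
        ((\<lambda>s. snd c (\<phi> s p)) has_vector_derivative X (\<phi> t p) c) (at t))"


section \<open>Covariant 2-tensors and Riemannian metrics\<close>

type_synonym ('a, 'e) tensor2 = "'a \<Rightarrow> ('a, 'e) tvec \<Rightarrow> ('a, 'e) tvec \<Rightarrow> real"

definition riemannian_metric ::
  "('a, 'e::euclidean_space) atlas \<Rightarrow> ('a, 'e) tensor2 \<Rightarrow> bool" where
  "riemannian_metric A g \<longleftrightarrow>
     (\<forall>p. \<forall>v\<in>tangent_space A p. \<forall>w\<in>tangent_space A p. g p v w = g p w v) \<and>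
     (\<forall>p. \<forall>v\<in>tangent_space A p. \<forall>w\<in>tangent_space A p. \<forall>z\<in>tangent_space A p. \<forall>a.
        g p (\<lambda>c. a *\<^sub>R v c + w c) z = a * g p v z + g p w z) \<and>
     (\<forall>p. \<forall>v\<in>tangent_space A p. v \<noteq> (\<lambda>_. 0) \<longrightarrow> g p v v > 0) \<and>
     (\<forall>c\<in>A. \<forall>a b. smooth_on (chart_image c)
        (\<lambda>x. g (chart_inv c x) (coord_vec A c (chart_inv c x) a) (coord_vec A c (chart_inv c x) b)))"

text \<open>The Lie derivative of a covariant 2-tensor along a complete vector field \<open>X\<close>: the derivative at
  \<open>t = 0\<close> of the pullback of \<open>T\<close> by the time-\<open>t\<close> map of the flow of \<open>X\<close>.\<close>

definition lie_derivative ::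
  "('a::topological_space, 'e::euclidean_space) atlas \<Rightarrow> ('a \<Rightarrow> ('a, 'e) tvec) \<Rightarrow>
   ('a, 'e) tensor2 \<Rightarrow> ('a, 'e) tensor2" where
  "lie_derivative A X T p v w =
     (let \<phi> = (SOME \<phi>. is_flow A X \<phi>) in
      deriv (\<lambda>t. T (\<phi> t p) (differential A A (\<phi> t) p v) (differential A A (\<phi> t) p w)) 0)"

text \<open>An orthonormal basis of the tangent space at \<open>p\<close>. The quantities defined with it below do not
  depend on the choice, so it need not be chosen smoothly in \<open>p\<close>.\<close>

definition frame ::
  "('a, real^'m) atlas \<Rightarrow> ('a, real^'m) tensor2 \<Rightarrow> 'a \<Rightarrow> 'm::finite \<Rightarrow> ('a, real^'m) tvec" where
  "frame A g p = (SOME e. (\<forall>i. e i \<in> tangent_space A p) \<and>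
     (\<forall>i j. g p (e i) (e j) = (if i = j then 1 else 0)))"

definition tensor_inner ::
  "('a, real^'m) atlas \<Rightarrow> ('a, real^'m::finite) tensor2 \<Rightarrow>
   ('a, real^'m) tensor2 \<Rightarrow> ('a, real^'m) tensor2 \<Rightarrow> 'a \<Rightarrow> real" where
  "tensor_inner A g S T p = (let e = frame A g p in
     \<Sum>i\<in>UNIV. \<Sum>j\<in>UNIV. S p (e i) (e j) * T p (e i) (e j))"

text \<open>The Riemannian volume measure: the unique Borel measure that in every chart has density
  \<open>sqrt (det (g_ij))\<close> with respect to Lebesgue measure.\<close>

definition gram_matrix ::
  "('a, real^'m) atlas \<Rightarrow> ('a, real^'m::finite) tensor2 \<Rightarrow> ('a, real^'m) chart \<Rightarrow> real^'m \<Rightarrow> real^'m^'m" where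
  "gram_matrix A g c x = (\<chi> i j. g (chart_inv c x)
     (coord_vec A c (chart_inv c x) (axis i 1)) (coord_vec A c (chart_inv c x) (axis j 1)))"

definition riemannian_volume ::
  "('a::topological_space, real^'m) atlas \<Rightarrow> ('a, real^'m::finite) tensor2 \<Rightarrow> 'a measure" where
  "riemannian_volume A g = (THE \<mu>. sets \<mu> = sets borel \<and>
     (\<forall>c\<in>A. \<forall>S\<in>sets borel. S \<subseteq> fst c \<longrightarrow>
        emeasure \<mu> S = (\<integral>\<^sup>+x\<in>snd c ` S. ennreal (sqrt (det (gram_matrix A g c x))) \<partial>lborel)))"


section \<open>The \<open>\<Phi>_(3)\<close>-energy and its stress-energy tensor\<close>

text \<open>The arguments are the atlas and metric of the domain, then those of the target, then the map.\<close>

definition d3 ::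
  "('a, real^'m) atlas \<Rightarrow> ('a, real^'m::finite) tensor2 \<Rightarrow>
   ('b, real^'n) atlas \<Rightarrow> ('b, real^'n::finite) tensor2 \<Rightarrow> ('a \<Rightarrow> 'b) \<Rightarrow>
   'a \<Rightarrow> ('a, real^'m) tvec \<Rightarrow> ('b, real^'n) tvec" where
  "d3 A g B h u p v =
     (let e = frame A g p; du = differential A B u p in
      (\<lambda>c. \<Sum>j\<in>UNIV. \<Sum>k\<in>UNIV.
         (h (u p) (du v) (du (e j)) * h (u p) (du (e j)) (du (e k))) *\<^sub>R du (e k) c))"

definition d3_norm2 ::
  "('a, real^'m) atlas \<Rightarrow> ('a, real^'m::finite) tensor2 \<Rightarrow>
   ('b, real^'n) atlas \<Rightarrow> ('b, real^'n::finite) tensor2 \<Rightarrow> ('a \<Rightarrow> 'b) \<Rightarrow> 'a \<Rightarrow> real" where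
  "d3_norm2 A g B h u p =
     (let e = frame A g p in
      \<Sum>i\<in>UNIV. h (u p) (d3 A g B h u p (e i)) (differential A B u p (e i)))"

text \<open>The energy over a subset \<open>K\<close> of the domain; \<open>K = UNIV\<close> gives the energy of \<open>u\<close>.\<close>

definition Phi3_energy_on ::
  "('a::topological_space, real^'m) atlas \<Rightarrow> ('a, real^'m::finite) tensor2 \<Rightarrow>
   ('b, real^'n) atlas \<Rightarrow> ('b, real^'n::finite) tensor2 \<Rightarrow> 'a set \<Rightarrow> ('a \<Rightarrow> 'b) \<Rightarrow> real" where
  "Phi3_energy_on A g B h K u =
     (LINT p:K|riemannian_volume A g. d3_norm2 A g B h u p / 6)"

definition stress_energy ::
  "('a, real^'m) atlas \<Rightarrow> ('a, real^'m::finite) tensor2 \<Rightarrow>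
   ('b, real^'n) atlas \<Rightarrow> ('b, real^'n::finite) tensor2 \<Rightarrow> ('a \<Rightarrow> 'b) \<Rightarrow> ('a, real^'m) tensor2" where
  "stress_energy A g B h u p v w =
     d3_norm2 A g B h u p / 6 * g p v w
     - h (u p) (d3 A g B h u p v) (differential A B u p w)"

end

theory Submission
  imports Defs
begin

text \<open>
  The energy density \<open>\<parallel>d\<^sub>(\<^sub>3\<^sub>) u\<parallel>\<^sup>2 / 6\<close> depends on \<open>u\<close> only through the pulled back metric \<open>T = u\<^sup>*h\<close>: it is
  \<open>f = tr (R\<^sup>3) / 6\<close>, where \<open>R = G\<^sup>-\<^sup>1 T\<close> and \<open>G\<close> is the metric of the domain. Replacing \<open>u\<close> by \<open>u \<circ> \<phi>\<^sub>t\<close>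
  replaces \<open>T\<close> by its pullback under the flow and leaves \<open>G\<close> alone, so the density changes at the rate
  \<open>tr (R\<^sup>2 G\<^sup>-\<^sup>1 L\<^sub>X T) / 2\<close>. The derivative of the function \<open>f\<close> along \<open>X\<close>, on the other hand, sees both \<open>T\<close> and \<open>G\<close>:
  \<open>X f = tr (R\<^sup>2 G\<^sup>-\<^sup>1 L\<^sub>X T) / 2 - tr (R\<^sup>3 G\<^sup>-\<^sup>1 L\<^sub>X G) / 2\<close>. Since the divergence of \<open>X\<close> is \<open>tr (G\<^sup>-\<^sup>1 L\<^sub>X G) / 2\<close>, the rate
  equals \<open>div (f X) - \<langle>S, L\<^sub>X G / 2\<rangle>\<close>, with \<open>S\<close> the stress-energy tensor (\<open>density_rate_plus_stress_term\<close>). The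
  integral of \<open>div (f X)\<close> vanishes because \<open>X\<close> has compact support (\<open>integral_weighted_divergence\<close>), and this is the theorem.

  The flow enters as a smooth map with \<open>\<phi>\<^sub>0 = id\<close> whose velocity is \<open>X\<close>. Exchanging partial derivatives gives the
  linearised flow equation (\<open>flow_chart_derivative_time_derivative\<close>), and with it a formula for the Lie derivative in a
  chart that contains only \<open>X\<close> (\<open>lie_derivative_coords\<close>). The same equation bounds the rate uniformly for short times on
  a compact set, which justifies differentiation under the integral.

  The volume measure exists and is unique
  (\<open>riemannian_volume_properties\<close>), because the volumes defined by two charts agree on their overlap by change of variables; an
  integral over a chart domain is then a weighted Lebesgue integral. Jacobi's formula for the derivative of a
  determinant identifies the divergence in a chart with the one on Euclidean space, where the theorem follows from
  translation invariance. Bump functions reduce the global divergence theorem to single charts. Sums over orthonormal frames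
  are turned into traces of coefficient matrices by the identity \<open>E E\<^sup>T = G\<^sup>-\<^sup>1\<close> for the matrix \<open>E\<close> of a frame
  (\<open>frame_matrix_gram\<close>); in this form they are continuously differentiable although the frames are chosen point by point.
\<close>


section \<open>Calculus of continuously differentiable maps\<close>

abbreviation C1_on :: "'a::real_normed_vector set \<Rightarrow> ('a \<Rightarrow> 'b::real_normed_vector) \<Rightarrow> bool" where
  "C1_on \<equiv> Ck_on (Suc 0)"

lemma C1_on_iff:
  "C1_on S f \<longleftrightarrow> (\<forall>x\<in>S. f differentiable (at x)) \<and>
     (\<forall>v. continuous_on S (\<lambda>x. frechet_derivative f (at x) v))"
  by simp

declare Ck_on.simps(2) [simp del]

lemma C1_onI:
  assumes "\<And>x. x \<in> S \<Longrightarrow> (f has_derivative f' x) (at x)" "\<And>v. continuous_on S (\<lambda>x. f' x v)"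
  shows "C1_on S f"
proof -
  have "frechet_derivative f (at x) = f' x" if "x \<in> S" for x
    using frechet_derivative_at assms(1)[OF that] by metis
  then show ?thesis
    unfolding C1_on_iff using assms
    by (auto simp: differentiable_def cong: continuous_on_cong_simp)
qed

lemma C1_on_has_derivative:
  "C1_on S f \<Longrightarrow> x \<in> S \<Longrightarrow> (f has_derivative frechet_derivative f (at x)) (at x)"
  by (simp add: C1_on_iff frechet_derivative_works)

lemma C1_on_imp_continuous_on: "C1_on S f \<Longrightarrow> continuous_on S f"
  by (meson C1_on_has_derivative continuous_at_imp_continuous_on has_derivative_continuous)

text \<open>Expressions in charts are known only on open sets, so every rule is needed in a local form.\<close>

lemma frechet_derivative_cong_open:
  assumes "open U" "x \<in> U" "\<And>y. y \<in> U \<Longrightarrow> f y = g y"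
  shows "frechet_derivative f (at x) = frechet_derivative g (at x)"
  unfolding frechet_derivative_def
  using has_derivative_transform_within_open[OF _ assms(1,2)] assms(3)
  by (metis (no_types, lifting))

lemma differentiable_cong_open:
  assumes "open U" "x \<in> U" "\<And>y. y \<in> U \<Longrightarrow> f y = g y" "f differentiable (at x)"
  shows "g differentiable (at x)"
  using assms has_derivative_transform_within_open unfolding differentiable_def by metis

lemma C1_on_local:
  assumes "\<And>x. x \<in> S \<Longrightarrow> \<exists>U g. open U \<and> x \<in> U \<and> C1_on U g \<and> (\<forall>y\<in>U. f y = g y)"
  shows "C1_on S f"
proof -
  have *: "f differentiable (at x) \<and> isCont (\<lambda>x. frechet_derivative f (at x) v) x" if x: "x \<in> S" for x v
  proof -
    obtain U g where U: "open U" "x \<in> U" "C1_on U g" "\<forall>y\<in>U. f y = g y"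
      using assms[OF x] by metis
    have 1: "f differentiable (at x)"
      using differentiable_cong_open[OF U(1,2), of g f] U(2-4) unfolding C1_on_iff by auto
    have "continuous_on U (\<lambda>x. frechet_derivative g (at x) v)"
      using U(3) unfolding C1_on_iff by auto
    then have "continuous_on U (\<lambda>x. frechet_derivative f (at x) v)"
      by (rule continuous_on_eq) (metis U(1,4) frechet_derivative_cong_open)
    then show ?thesis using 1 U(1,2) continuous_on_eq_continuous_at by blast
  qed
  then show ?thesis
    unfolding C1_on_iff by (meson continuous_at_imp_continuous_on)
qed

lemma C1_on_cong: "open S \<Longrightarrow> C1_on S g \<Longrightarrow> (\<And>x. x \<in> S \<Longrightarrow> f x = g x) \<Longrightarrow> C1_on S f"
  by (rule C1_on_local) blast

lemma smooth_on_imp_C1_on: "smooth_on S f \<Longrightarrow> C1_on S f"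
  unfolding smooth_on_def by blast

lemma smooth_on_imp_C1_on_derivative: "smooth_on S f \<Longrightarrow> C1_on S (\<lambda>x. frechet_derivative f (at x) v)"
  using Ck_on.simps(2)[of "Suc 0" S f] unfolding smooth_on_def by blast

lemma C1_on_bounded_linear:
  assumes "bounded_linear F" "C1_on S f" shows "C1_on S (\<lambda>x. F (f x))"
proof (rule C1_onI)
  show "((\<lambda>x. F (f x)) has_derivative (\<lambda>v. F (frechet_derivative f (at x) v))) (at x)" if "x \<in> S" for x
    by (rule bounded_linear.has_derivative[OF assms(1) C1_on_has_derivative[OF assms(2) that]])
  show "continuous_on S (\<lambda>x. F (frechet_derivative f (at x) v))" for v
    using assms by (intro bounded_linear.continuous_on[OF assms(1)]) (auto simp: C1_on_iff)
qed

lemma C1_on_bounded_bilinear: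
  assumes "bounded_bilinear F" "C1_on S f" "C1_on S g" shows "C1_on S (\<lambda>x. F (f x) (g x))"
proof (rule C1_onI)
  show "((\<lambda>x. F (f x) (g x)) has_derivative (\<lambda>v. F (f x) (frechet_derivative g (at x) v)
       + F (frechet_derivative f (at x) v) (g x))) (at x)" if "x \<in> S" for x
    by (rule bounded_bilinear.FDERIV[OF assms(1)]) (use assms that C1_on_has_derivative in auto)
  show "continuous_on S (\<lambda>x. F (f x) (frechet_derivative g (at x) v)
       + F (frechet_derivative f (at x) v) (g x))" for v
    using assms C1_on_imp_continuous_on[OF assms(2)] C1_on_imp_continuous_on[OF assms(3)]
    by (intro continuous_on_add bounded_bilinear.continuous_on[OF assms(1)]) (auto simp: C1_on_iff)
qed

lemma C1_on_const: "C1_on S (\<lambda>x. a)"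
  by (rule C1_onI[where f' = "\<lambda>x v. 0"]) auto

lemma C1_on_id: "C1_on S (\<lambda>x. x)"
  by (rule C1_onI[where f' = "\<lambda>x v. v"]) auto

lemma C1_on_add: 
  assumes "C1_on S f" "C1_on S g" shows "C1_on S (\<lambda>x. f x + g x)"
proof (rule C1_onI)
  show "((\<lambda>x. f x + g x) has_derivative (\<lambda>v. frechet_derivative f (at x) v
       + frechet_derivative g (at x) v)) (at x)" if "x \<in> S" for x
    by (intro has_derivative_add C1_on_has_derivative[OF _ that] assms)
qed (use assms in \<open>auto simp: C1_on_iff intro: continuous_on_add\<close>)

lemmas C1_on_mult = C1_on_bounded_bilinear[OF bounded_bilinear_mult]
lemmas C1_on_scaleR = C1_on_bounded_bilinear[OF bounded_bilinear_scaleR]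
lemmas C1_on_inner = C1_on_bounded_bilinear[OF bounded_bilinear_inner]

lemma C1_on_minus: "C1_on S f \<Longrightarrow> C1_on S (\<lambda>x. - f x)"
  by (rule C1_on_bounded_linear[OF bounded_linear_minus[OF bounded_linear_ident]])

lemma C1_on_diff: "C1_on S f \<Longrightarrow> C1_on S g \<Longrightarrow> C1_on S (\<lambda>x. f x - g x)"
  using C1_on_add[OF _ C1_on_minus, of S f g] by simp

lemma C1_on_sum: "(\<And>i. i \<in> I \<Longrightarrow> C1_on S (f i)) \<Longrightarrow> C1_on S (\<lambda>x. \<Sum>i\<in>I. f i x)"
  by (induction I rule: infinite_finite_induct) (auto intro: C1_on_const C1_on_add)

lemma C1_on_prod: 
  fixes f :: "'i \<Rightarrow> 'a::real_normed_vector \<Rightarrow> real"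
  shows "(\<And>i. i \<in> I \<Longrightarrow> C1_on S (f i)) \<Longrightarrow> C1_on S (\<lambda>x. \<Prod>i\<in>I. f i x)"
  by (induction I rule: infinite_finite_induct) (auto intro: C1_on_const C1_on_mult)

lemma C1_on_componentwise:
  fixes f :: "'a::real_normed_vector \<Rightarrow> 'b::euclidean_space"
  assumes "\<And>b. b \<in> Basis \<Longrightarrow> C1_on S (\<lambda>x. f x \<bullet> b)"
  shows "C1_on S f"
proof -
  have "C1_on S (\<lambda>x. \<Sum>b\<in>Basis. (f x \<bullet> b) *\<^sub>R b)"
    by (intro C1_on_sum C1_on_scaleR assms C1_on_const)
  then show ?thesis by (simp only: euclidean_representation)
qed

lemma C1_on_vec:
  fixes f :: "'a::real_normed_vector \<Rightarrow> 'b::euclidean_space ^ 'n"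
  assumes "\<And>i. C1_on S (\<lambda>x. f x $ i)"
  shows "C1_on S f"
proof (rule C1_on_componentwise)
  fix b :: "'b^'n" assume "b \<in> Basis"
  then obtain i u where b: "b = axis i u" by (auto simp: Basis_vec_def)
  show "C1_on S (\<lambda>x. f x \<bullet> b)"
    unfolding b inner_axis by (intro C1_on_inner assms C1_on_const)
qed

lemma C1_on_nth: "C1_on S f \<Longrightarrow> C1_on S (\<lambda>x. f x $ i)"
  by (rule C1_on_bounded_linear[OF bounded_linear_vec_nth])

text \<open>In finite dimension, continuity of each directional derivative gives joint continuity in the
  base point and the direction.\<close>

lemma continuous_on_frechet_derivative:
  fixes f :: "'a::euclidean_space \<Rightarrow> 'b::real_normed_vector"
  assumes f: "C1_on T f" and a: "continuous_on S a" "a ` S \<subseteq> T" and b: "continuous_on S b"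
  shows "continuous_on S (\<lambda>x. frechet_derivative f (at (a x)) (b x))"
proof -
  have eq: "frechet_derivative f (at (a x)) (b x)
      = (\<Sum>e\<in>Basis. (b x \<bullet> e) *\<^sub>R frechet_derivative f (at (a x)) e)" if "x \<in> S" for x
  proof -
    have "linear (frechet_derivative f (at (a x)))"
      using f a(2) that by (intro linear_frechet_derivative) (auto simp: C1_on_iff)
    then have "(\<Sum>e\<in>Basis. (b x \<bullet> e) *\<^sub>R frechet_derivative f (at (a x)) e)
      = frechet_derivative f (at (a x)) (\<Sum>e\<in>Basis. (b x \<bullet> e) *\<^sub>R e)"
      by (simp add: linear_sum linear_scale)
    then show ?thesis by (simp add: euclidean_representation)
  qed
  have "continuous_on S (\<lambda>x. \<Sum>e\<in>Basis. (b x \<bullet> e) *\<^sub>R frechet_derivative f (at (a x)) e)"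
  proof (intro continuous_on_sum continuous_on_scaleR continuous_on_inner b continuous_on_const)
    fix e :: 'a
    show "continuous_on S (\<lambda>x. frechet_derivative f (at (a x)) e)"
      using f a by (intro continuous_on_compose2[of T "\<lambda>y. frechet_derivative f (at y) e" S a])
        (auto simp: C1_on_iff)
  qed
  then show ?thesis by (rule continuous_on_eq) (simp add: eq)
qed

lemma C1_on_compose:
  fixes f :: "'b::euclidean_space \<Rightarrow> 'c::real_normed_vector"
  assumes f: "C1_on T f" and g: "C1_on S g" and "g ` S \<subseteq> T"
  shows "C1_on S (\<lambda>x. f (g x))"
proof (rule C1_onI)
  show "((\<lambda>x. f (g x)) has_derivative 
      (\<lambda>v. frechet_derivative f (at (g x)) (frechet_derivative g (at x) v))) (at x)" if "x \<in> S" for x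
    by (rule has_derivative_compose[OF C1_on_has_derivative[OF g that] C1_on_has_derivative[OF f]])
      (use that assms in auto)
  show "continuous_on S (\<lambda>x. frechet_derivative f (at (g x)) (frechet_derivative g (at x) v))" for v
    using g by (intro continuous_on_frechet_derivative[OF f] C1_on_imp_continuous_on[OF g] assms(3))
      (simp add: C1_on_iff)
qed

lemma C1_on_real_deriv:
  fixes f :: "real \<Rightarrow> real"
  assumes "\<And>x. x \<in> S \<Longrightarrow> (f has_real_derivative f' x) (at x)" "continuous_on S f'"
  shows "C1_on S f"
  by (rule C1_onI[where f' = "\<lambda>x v. f' x * v"])
    (use assms in \<open>auto simp: has_field_derivative_def intro!: continuous_intros\<close>)

lemma C1_on_inverse: "C1_on S f \<Longrightarrow> (\<And>x. x \<in> S \<Longrightarrow> f x \<noteq> 0) \<Longrightarrow> C1_on S (\<lambda>x. inverse (f x :: real))"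
  by (rule C1_on_compose[where T = "-{0}"], rule C1_on_real_deriv[where f' = "\<lambda>x. - inverse (x^2)"])
    (auto intro!: derivative_eq_intros continuous_intros simp: field_simps power2_eq_square)

lemma C1_on_sqrt: "C1_on S f \<Longrightarrow> (\<And>x. x \<in> S \<Longrightarrow> f x > 0) \<Longrightarrow> C1_on S (\<lambda>x. sqrt (f x))"
  by (rule C1_on_compose[where T = "{0<..}"], rule C1_on_real_deriv[where f' = "\<lambda>x. inverse (sqrt x) / 2"])
    (auto intro!: derivative_eq_intros continuous_intros)

text \<open>The square of the positive part: a continuously differentiable function that vanishes exactly
  on a half line.\<close>

definition sqpos :: "real \<Rightarrow> real" where "sqpos s = (max 0 s)^2"

lemma sqpos_pos_iff: "sqpos s > 0 \<longleftrightarrow> s > 0" and sqpos_nonneg: "sqpos s \<ge> 0" 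
  and sqpos_eq_0: "s \<le> 0 \<Longrightarrow> sqpos s = 0"
  by (auto simp: sqpos_def max_def)

lemma has_real_derivative_sqpos: "(sqpos has_real_derivative 2 * max 0 x) (at x)"
proof -
  consider "x > 0" | "x < 0" | "x = 0" by linarith
  then show ?thesis
  proof cases
    case 1
    have "((\<lambda>x::real. x^2) has_real_derivative 2 * x) (at x)"
      by (auto intro!: derivative_eq_intros)
    then have "(sqpos has_real_derivative 2 * x) (at x)"
      by (rule has_field_derivative_transform_within[where d = x]) (use 1 in \<open>auto simp: sqpos_def dist_real_def max_def\<close>)
    then show ?thesis using 1 by simp
  next
    case 2
    have "((\<lambda>x::real. 0) has_real_derivative 0) (at x)" by simp
    then have "(sqpos has_real_derivative 0) (at x)"
      by (rule has_field_derivative_transform_within[where d = "-x"]) (use 2 in \<open>auto simp: sqpos_def dist_real_def max_def\<close>)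
    then show ?thesis using 2 by simp
  next
    case 3
    have "((\<lambda>h. (sqpos (0 + h) - sqpos 0) / h) \<longlongrightarrow> 0) (at 0)"
    proof (rule Lim_null_comparison)
      show "\<forall>\<^sub>F h in at 0. norm ((sqpos (0 + h) - sqpos 0) / h) \<le> \<bar>h\<bar>"
        by (rule always_eventually) (auto simp: sqpos_def max_def power2_eq_square abs_mult)
      show "((\<lambda>h::real. \<bar>h\<bar>) \<longlongrightarrow> 0) (at 0)" by (rule tendsto_eq_intros)+ auto
    qed
    then show ?thesis using 3 by (simp add: DERIV_def)
  qed
qed

lemma C1_on_sqpos: "C1_on S f \<Longrightarrow> C1_on S (\<lambda>x. sqpos (f x))"
  by (rule C1_on_compose[where T = UNIV], rule C1_on_real_deriv[OF has_real_derivative_sqpos])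
    (auto intro!: continuous_intros)


section \<open>Calculus of matrices\<close>

lemma bounded_bilinear_matrix_matrix_mult:
  "bounded_bilinear (matrix_matrix_mult :: real^'m^'n \<Rightarrow> real^'p^'m \<Rightarrow> real^'p^'n)"
  unfolding bilinear_conv_bounded_bilinear[symmetric] bilinear_def
  by (auto intro!: linearI simp: vec_eq_iff matrix_matrix_mult_def sum.distrib algebra_simps sum_distrib_left)

lemma bounded_linear_trace: "bounded_linear (trace :: real^'m^'m \<Rightarrow> real)"
  unfolding linear_conv_bounded_linear[symmetric]
  by (rule linearI) (auto simp: trace_def sum.distrib sum_distrib_left)

lemma bounded_linear_transpose: "bounded_linear (transpose :: real^'m^'n \<Rightarrow> real^'n^'m)"
  unfolding linear_conv_bounded_linear[symmetric]
  by (rule linearI) (auto simp: transpose_def vec_eq_iff)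

lemmas C1_on_matrix_mult = C1_on_bounded_bilinear[OF bounded_bilinear_matrix_matrix_mult]
lemmas C1_on_trace = C1_on_bounded_linear[OF bounded_linear_trace]
lemmas continuous_on_matrix_mult =
  bounded_bilinear.continuous_on[OF bounded_bilinear_matrix_matrix_mult]
lemmas continuous_on_trace = bounded_linear.continuous_on[OF bounded_linear_trace]
lemmas continuous_on_transpose = bounded_linear.continuous_on[OF bounded_linear_transpose]

lemma C1_on_det:
  fixes f :: "'a::real_normed_vector \<Rightarrow> real^'m^'m"
  assumes "C1_on S f" shows "C1_on S (\<lambda>x. det (f x))"
  unfolding det_def by (intro C1_on_sum C1_on_mult C1_on_prod C1_on_const C1_on_nth assms)

text \<open>To first order at the identity only the identity permutation contributes to the determinant: any
  other permutation moves at least two indices, so its product keeps a vanishing factor.\<close>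

lemma has_derivative_det_mat_1:
  "(det has_derivative trace) (at (mat 1 :: real^'m^'m))"
proof -
  let ?I = "mat 1 :: real^'m^'m"
  have "(det has_derivative (\<lambda>H. \<Sum>p\<in>{p. p permutes UNIV}. of_int (sign p) * 
      (\<Sum>i\<in>UNIV. H $ i $ p i * (\<Prod>j\<in>UNIV - {i}. ?I $ j $ p j)))) (at ?I)"
    unfolding det_def
    by (rule has_derivative_sum has_derivative_mult_right has_derivative_prod)+
      (auto intro!: bounded_linear_imp_has_derivative 
        bounded_linear_compose[OF bounded_linear_vec_nth bounded_linear_vec_nth])
  moreover have "(\<Sum>p\<in>{p. p permutes UNIV}. of_int (sign p) * 
      (\<Sum>i\<in>UNIV. H $ i $ p i * (\<Prod>j\<in>UNIV - {i}. ?I $ j $ p j))) = trace H" for H :: "real^'m^'m"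
  proof -
    have z0: "(\<Prod>j\<in>UNIV - {i}. ?I $ j $ p j) = 0" if p: "p permutes UNIV" "p \<noteq> id" for p and i :: 'm
    proof -
      have "\<exists>j. j \<noteq> i \<and> p j \<noteq> j"
      proof (rule ccontr)
        assume a: "\<not> ?thesis"
        have "p i = i" 
        proof (rule ccontr)
          assume "p i \<noteq> i"
          then have "p (p i) = p i" using a by blast
          then show False using \<open>p i \<noteq> i\<close> permutes_inj[OF p(1)] by (auto dest: injD)
        qed
        then show False using a p(2) by (metis ext id_apply)
      qed
      then obtain j where "j \<in> UNIV - {i}" "?I $ j $ p j = 0" by (auto simp: mat_def)
      then show ?thesis by (metis finite prod_zero)
    qed
    have z: "(\<Sum>i\<in>UNIV. H $ i $ p i * (\<Prod>j\<in>UNIV - {i}. ?I $ j $ p j)) = 0" 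
      if "p permutes UNIV" "p \<noteq> id" for p using z0[OF that] by (simp only: mult_zero_right sum.neutral_const)
    have "(\<Sum>p\<in>{p. p permutes UNIV}. of_int (sign p) * 
      (\<Sum>i\<in>UNIV. H $ i $ p i * (\<Prod>j\<in>UNIV - {i}. ?I $ j $ p j))) 
      = (\<Sum>p\<in>{id}. of_int (sign p) * 
      (\<Sum>i\<in>UNIV. H $ i $ p i * (\<Prod>j\<in>UNIV - {i}. ?I $ j $ p j)))"
      by (intro sum.mono_neutral_right finite_permutations) (use z in \<open>auto simp: permutes_id simp del: sum.neutral\<close>)
    also have "\<dots> = trace H" by (simp add: trace_def mat_def)
    finally show ?thesis .
  qed
  ultimately show ?thesis by simp
qed

lemma matrix_inv_right: "invertible (A::real^'m^'m) \<Longrightarrow> A ** matrix_inv A = mat 1"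
  and matrix_inv_left: "invertible (A::real^'m^'m) \<Longrightarrow> matrix_inv A ** A = mat 1"
  unfolding invertible_def matrix_inv_def by (metis (mono_tags, lifting) someI_ex)+

lemma matrix_inv_unique: 
  fixes A B :: "real^'m^'m"
  assumes "A ** B = mat 1" shows "matrix_inv A = B"
proof -
  have "invertible A" using assms matrix_left_right_inverse unfolding invertible_def by blast
  then have "matrix_inv A = matrix_inv A ** (A ** B)" by (simp add: assms)
  also have "\<dots> = B" by (simp add: matrix_mul_assoc matrix_inv_left[OF \<open>invertible A\<close>])
  finally show ?thesis .
qed

text \<open>Jacobi's formula, reduced to the identity matrix by multiplicativity of the determinant.\<close>

lemma has_derivative_det:
  fixes A :: "real^'m^'m"
  assumes "invertible A"
  shows "(det has_derivative (\<lambda>H. det A * trace (matrix_inv A ** H))) (at A)"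
proof -
  have lin: "bounded_linear (\<lambda>B. matrix_inv A ** B)"
    by (rule bounded_bilinear.bounded_linear_right[OF bounded_bilinear_matrix_matrix_mult])
  have "((\<lambda>B. det (matrix_inv A ** B)) has_derivative (\<lambda>H. trace (matrix_inv A ** H))) (at A)"
    by (rule has_derivative_compose[OF bounded_linear_imp_has_derivative[OF lin]])
      (simp add: matrix_inv_left[OF assms] has_derivative_det_mat_1)
  then have "((\<lambda>B. det A * det (matrix_inv A ** B)) has_derivative 
      (\<lambda>H. det A * trace (matrix_inv A ** H))) (at A)"
    by (rule has_derivative_mult_right)
  moreover have "det A * det (matrix_inv A ** B) = det B" for B
    by (simp add: det_mul[symmetric] matrix_mul_assoc matrix_inv_right[OF assms])
  ultimately show ?thesis by simp
qed

text \<open>By Cramer's rule each entry of the inverse is a quotient of determinants.\<close>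

lemma continuous_on_matrix_inv:
  fixes f :: "'a::real_normed_vector \<Rightarrow> real^'m^'m"
  assumes "continuous_on S f" "\<And>x. x \<in> S \<Longrightarrow> invertible (f x)"
  shows "continuous_on S (\<lambda>x. matrix_inv (f x))"
proof -
  have eq: "matrix_inv A = (\<chi> k i. det (\<chi> a b. if b = k then axis i 1 $ a else A $ a $ b) / det A)"
    if "invertible A" for A :: "real^'m^'m"
  proof -
    have "A *v (matrix_inv A *v axis i 1) = axis i 1" for i
      by (simp add: matrix_vector_mul_assoc matrix_inv_right[OF that])
    then have "matrix_inv A *v axis i 1 
        = (\<chi> k. det (\<chi> a b. if b = k then axis i 1 $ a else A $ a $ b) / det A)" for i
      using cramer[of A "matrix_inv A *v axis i 1" "axis i 1"] that 
      by (simp add: invertible_det_nz)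
    moreover have "matrix_inv A $ k $ i = (matrix_inv A *v axis i 1) $ k" for k i
      by (simp add: matrix_vector_mul_component inner_axis)
    ultimately show ?thesis by (simp add: vec_eq_iff)
  qed
  have "continuous_on S (\<lambda>x. \<chi> k i. det (\<chi> a b. if b = k then axis i 1 $ a else f x $ a $ b) / det (f x))"
  proof (intro continuous_on_vec_lambda continuous_on_divide)
    fix k i :: 'm
    have "continuous_on S (\<lambda>x. if b = k then axis i 1 $ a else f x $ a $ b)" for a b
      by (cases "b = k") (auto intro!: continuous_intros assms(1))
    then show "continuous_on S (\<lambda>x. det (\<chi> a b. if b = k then axis i 1 $ a else f x $ a $ b))"
      unfolding det_def by (auto intro!: continuous_intros)
    show "continuous_on S (\<lambda>x. det (f x))"
      unfolding det_def by (intro continuous_intros assms(1))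
  qed (use assms(2) in \<open>auto simp: invertible_det_nz\<close>)
  then show ?thesis by (rule continuous_on_eq) (simp add: eq assms)
qed

lemma open_invertible: "open {A :: real^'m^'m. invertible A}"
proof -
  have "continuous_on UNIV (det :: real^'m^'m \<Rightarrow> real)"
    by (rule C1_on_imp_continuous_on[OF C1_on_det[OF C1_on_id]])
  then have "open (det -` (-{0}) :: (real^'m^'m) set)"
    by (rule open_vimage[rotated]) auto
  then show ?thesis by (simp add: vimage_def invertible_det_nz)
qed

text \<open>The identity \<open>B\<^sup>-\<^sup>1 - A\<^sup>-\<^sup>1 = - B\<^sup>-\<^sup>1 (B - A) A\<^sup>-\<^sup>1\<close> leaves an error that is the difference of two inverses times \<open>B - A\<close>,
  so continuity of the inverse already gives the derivative.\<close>

lemma has_derivative_matrix_inv: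
  fixes A :: "real^'m^'m"
  assumes "invertible A"
  shows "(matrix_inv has_derivative (\<lambda>H. - (matrix_inv A ** H ** matrix_inv A))) (at A)"
proof -
  interpret bounded_bilinear "matrix_matrix_mult :: real^'m^'m \<Rightarrow> real^'m^'m \<Rightarrow> real^'m^'m"
    by (rule bounded_bilinear_matrix_matrix_mult)
  let ?U = "{A :: real^'m^'m. invertible A}"
  have inv: "isCont matrix_inv A"
  proof -
    have "continuous_on ?U matrix_inv"
      by (rule continuous_on_matrix_inv) auto
    then show ?thesis
      using assms open_invertible continuous_on_eq_continuous_at by blast
  qed
  obtain K where K: "\<And>(a :: real^'m^'m) (b :: real^'m^'m). norm (a ** b) \<le> norm a * norm b * K" "K > 0"
    using pos_bounded by blast
  have bl: "bounded_linear (\<lambda>H. - (matrix_inv A ** H ** matrix_inv A))"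
    by (intro bounded_linear_minus bounded_linear_compose[OF bounded_linear_left bounded_linear_right])
  have lim: "((\<lambda>B. norm (matrix_inv B - matrix_inv A) * K * norm (matrix_inv A) * K) \<longlongrightarrow> 0) (at A)"
  proof -
    have "((\<lambda>B. norm (matrix_inv B - matrix_inv A)) \<longlongrightarrow> 0) (at A)"
      by (rule tendsto_norm_zero[OF LIM_zero[OF inv[unfolded isCont_def]]])
    then show ?thesis by (intro tendsto_mult_left_zero)
  qed
  have bound: "norm (matrix_inv B - matrix_inv A - - (matrix_inv A ** (B - A) ** matrix_inv A)) / norm (B - A)
      \<le> norm (matrix_inv B - matrix_inv A) * K * norm (matrix_inv A) * K" 
    if "B \<in> ?U" "B \<noteq> A" for B
  proof -
    have "invertible B" using that by simp
    have "matrix_inv B ** (B - A) ** matrix_inv A 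
        = (matrix_inv B ** B) ** matrix_inv A - matrix_inv B ** (A ** matrix_inv A)"
      by (simp only: diff_left diff_right matrix_mul_assoc)
    then have 1: "matrix_inv B ** (B - A) ** matrix_inv A = matrix_inv A - matrix_inv B"
      by (simp add: matrix_inv_left[OF \<open>invertible B\<close>] matrix_inv_right[OF assms])
    have 2: "matrix_inv B - matrix_inv A - - (matrix_inv A ** (B - A) ** matrix_inv A)
        = - ((matrix_inv B - matrix_inv A) ** (B - A) ** matrix_inv A)"
      unfolding diff_left 1 by simp
    have "norm (\<dots>) \<le> (norm (matrix_inv B - matrix_inv A) * norm (B - A) * K) * norm (matrix_inv A) * K"
      unfolding norm_minus_cancel
      by (rule order_trans[OF K(1)]) (intro mult_right_mono K(1); use K(2) in simp)
    then show ?thesis unfolding 2 using that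
      by (simp add: divide_simps ac_simps)
  qed
  have "eventually (\<lambda>B. B \<in> ?U \<and> B \<noteq> A) (at A)"
    using open_invertible assms by (intro eventually_conj eventually_at_in_open') (auto simp: eventually_at_filter)
  then have "((\<lambda>B. norm (matrix_inv B - matrix_inv A - - (matrix_inv A ** (B - A) ** matrix_inv A)) 
      / norm (B - A)) \<longlongrightarrow> 0) (at A)"
    by (intro Lim_null_comparison[OF _ lim], elim eventually_mono) (use bound in auto)
  then show ?thesis using bl by (simp add: has_derivative_iff_norm)
qed

lemma C1_on_matrix_inv:
  fixes f :: "'a::real_normed_vector \<Rightarrow> real^'m^'m"
  assumes "C1_on S f" "\<And>x. x \<in> S \<Longrightarrow> invertible (f x)"
  shows "C1_on S (\<lambda>x. matrix_inv (f x))"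
proof (rule C1_on_compose[OF _ assms(1), of "{A. invertible A}"])
  have cont: "continuous_on {A :: real^'m^'m. invertible A} matrix_inv"
    by (rule continuous_on_matrix_inv) auto
  show "C1_on {A :: real^'m^'m. invertible A} matrix_inv"
    by (rule C1_onI[OF has_derivative_matrix_inv], simp)
      (intro continuous_on_minus continuous_on_matrix_mult cont continuous_on_const)
qed (use assms(2) in auto)


section \<open>Interchanging partial derivatives\<close>

text \<open>With \<open>f\<close> recovered as the integral of its derivative in \<open>t\<close>, the derivative in \<open>s\<close> passes under that
  integral, and the fundamental theorem of calculus then differentiates \<open>\<partial>f/\<partial>s\<close> in \<open>t\<close>. For a flow this is the
  linearised flow equation.\<close>

lemma has_vector_derivative_parameter_derivative:
  fixes f :: "real \<Rightarrow> real \<Rightarrow> 'b::euclidean_space"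
  assumes ft: "\<And>t s. t \<in> {a..b} \<Longrightarrow> s \<in> {-r<..<r} \<Longrightarrow> ((\<lambda>t. f t s) has_vector_derivative g t s) (at t)"
    and fs: "\<And>t. t \<in> {a..b} \<Longrightarrow> (f t has_vector_derivative p t) (at 0)"
    and gs: "\<And>t s. t \<in> {a..b} \<Longrightarrow> s \<in> {-r<..<r} \<Longrightarrow> (g t has_vector_derivative h t s) (at s)"
    and g: "\<And>s. s \<in> {-r<..<r} \<Longrightarrow> continuous_on {a..b} (\<lambda>t. g t s)"
    and h: "continuous_on ({-r<..<r} \<times> {a..b}) (\<lambda>(s, t). h t s)"
    and "r > 0" "t \<in> {a<..<b}"
  shows "(p has_vector_derivative h t 0) (at t)"
proof -
  let ?U = "{-r<..<r}"
  have U0: "0 \<in> ?U" and ab: "a \<le> b" using assms by auto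
  have eq: "f \<tau> s = f a s + integral {a..\<tau>} (\<lambda>t. g t s)" if "\<tau> \<in> {a..b}" "s \<in> ?U" for \<tau> s
  proof -
    have "((\<lambda>t. g t s) has_integral (f \<tau> s - f a s)) {a..\<tau>}"
    proof (rule fundamental_theorem_of_calculus)
      show "a \<le> \<tau>" using that by simp
      show "((\<lambda>t. f t s) has_vector_derivative g t s) (at t within {a..\<tau>})" if "t \<in> {a..\<tau>}" for t
        by (rule has_vector_derivative_at_within[OF ft]) (use that \<open>\<tau> \<in> {a..b}\<close> \<open>s \<in> ?U\<close> in auto)
    qed
    then show ?thesis by (simp add: integral_unique)
  qed
  have p: "p \<tau> = p a + integral {a..\<tau>} (\<lambda>t. h t 0)" if \<tau>: "\<tau> \<in> {a..b}" for \<tau>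
  proof -
    have "((\<lambda>s. integral (cbox a \<tau>) (\<lambda>t. g t s)) has_vector_derivative 
        integral (cbox a \<tau>) (\<lambda>t. h t 0)) (at 0 within ?U)"
    proof (rule leibniz_rule_vector_derivative[where fx = "\<lambda>s t. h t s"])
      show "(\<lambda>t. g t s) integrable_on cbox a \<tau>" if "s \<in> ?U" for s
        unfolding cbox_interval
        by (rule integrable_continuous_interval, rule continuous_on_subset[OF g[OF that]]) (use \<tau> in auto)
      show "continuous_on (?U \<times> cbox a \<tau>) (\<lambda>(s, t). h t s)"
        by (rule continuous_on_subset[OF h]) (use \<tau> in auto)
      show "((\<lambda>s. g t s) has_vector_derivative h t s) (at s within ?U)" 
        if "s \<in> ?U" "t \<in> cbox a \<tau>" for s t
        by (rule has_vector_derivative_at_within[OF gs]) (use that \<tau> in auto)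
    qed (use U0 in auto)
    then have "((\<lambda>s. f a s + integral {a..\<tau>} (\<lambda>t. g t s)) has_vector_derivative 
        p a + integral {a..\<tau>} (\<lambda>t. h t 0)) (at 0 within ?U)"
      unfolding cbox_interval
      by (intro has_vector_derivative_add has_vector_derivative_at_within[OF fs]) (use ab in auto)
    then have "((\<lambda>s. f a s + integral {a..\<tau>} (\<lambda>t. g t s)) has_vector_derivative 
        p a + integral {a..\<tau>} (\<lambda>t. h t 0)) (at 0)"
      by (simp only: at_within_open[OF U0 open_greaterThanLessThan])
    then have "(f \<tau> has_vector_derivative p a + integral {a..\<tau>} (\<lambda>t. h t 0)) (at 0)"
      by (rule has_vector_derivative_transform_within_open[of _ _ _ ?U]) 
         (use U0 eq[OF \<tau>] in auto)
    then show ?thesis by (rule vector_derivative_unique_at[OF fs[OF \<tau>]])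
  qed
  have "continuous_on {a..b} (\<lambda>t. h t 0)"
  proof -
    have "continuous_on {a..b} (\<lambda>t. (\<lambda>(s, t). h t s) (0, t))"
      by (rule continuous_on_compose2[OF h]) (use U0 in \<open>auto intro!: continuous_intros\<close>)
    then show ?thesis by simp
  qed
  then have "((\<lambda>\<tau>. integral {a..\<tau>} (\<lambda>t. h t 0)) has_vector_derivative h t 0) (at t within {a..b})"
    by (rule integral_has_vector_derivative) (use assms in auto)
  then have "((\<lambda>\<tau>. integral {a..\<tau>} (\<lambda>t. h t 0)) has_vector_derivative h t 0) (at t)"
    using at_within_Icc_at[of a t b] assms(7) by simp
  then have "((\<lambda>\<tau>. p a + integral {a..\<tau>} (\<lambda>t. h t 0)) has_vector_derivative 0 + h t 0) (at t)"
    by (intro has_vector_derivative_add has_vector_derivative_const)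
  then have "((\<lambda>\<tau>. p a + integral {a..\<tau>} (\<lambda>t. h t 0)) has_vector_derivative h t 0) (at t)"
    by simp
  then show ?thesis
    by (rule has_vector_derivative_transform_within_open[of _ _ _ "{a<..<b}"])
      (use assms(7) p[symmetric] in auto)
qed


section \<open>The divergence theorem for compactly supported fields on Euclidean space\<close>

text \<open>The integral of a difference quotient of \<open>w\<close> vanishes by translation invariance, and the
  difference quotients converge dominatedly.\<close>

lemma integral_frechet_derivative_compact_support:
  fixes w :: "'a::euclidean_space \<Rightarrow> real"
  assumes w: "C1_on UNIV w" and K: "compact K" "\<And>x. x \<notin> K \<Longrightarrow> w x = 0"
  shows "integrable lborel (\<lambda>x. frechet_derivative w (at x) v)"
    and "(\<integral>x. frechet_derivative w (at x) v \<partial>lborel) = 0"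
proof -
  define D where "D = (\<lambda>x. frechet_derivative w (at x) v)"
  have contw: "continuous_on UNIV w" by (rule C1_on_imp_continuous_on[OF w])
  have contD: "continuous_on UNIV D" using w by (simp add: C1_on_iff D_def)
  have der: "((\<lambda>t. w (x + t *\<^sub>R v)) has_real_derivative D (x + t *\<^sub>R v)) (at t)" for x t
  proof -
    have "((\<lambda>t. x + t *\<^sub>R v) has_derivative (\<lambda>h. h *\<^sub>R v)) (at t)"
      by (auto intro!: derivative_eq_intros)
    from has_derivative_compose[OF this C1_on_has_derivative[OF w UNIV_I]]
    have "((\<lambda>t. w (x + t *\<^sub>R v)) has_derivative 
        (\<lambda>h. frechet_derivative w (at (x + t *\<^sub>R v)) (h *\<^sub>R v))) (at t)" .
    moreover have "linear (frechet_derivative w (at (x + t *\<^sub>R v)))"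
      using w by (auto intro: linear_frechet_derivative simp: C1_on_iff)
    ultimately show ?thesis
      by (simp add: has_field_derivative_def D_def linear_scale mult.commute[of _ "frechet_derivative w _ v"])
  qed
  have D0: "D x = 0" if "x \<notin> K" for x
  proof -
    have "frechet_derivative w (at x) = frechet_derivative (\<lambda>x. 0) (at x)"
      by (rule frechet_derivative_cong_open[of "-K"]) (use K that compact_imp_closed in auto)
    then show ?thesis by (simp add: D_def)
  qed
  obtain C where C: "C \<ge> 0" "\<And>x. \<bar>D x\<bar> \<le> C"
  proof -
    have "bounded (D ` K)"
      by (intro compact_imp_bounded compact_continuous_image continuous_on_subset[OF contD] K(1)) auto
    then obtain C where C: "\<And>x. x \<in> K \<Longrightarrow> \<bar>D x\<bar> \<le> C" unfolding bounded_iff by auto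
    have "\<bar>D x\<bar> \<le> max 0 C" for x using C[of x] D0[of x] by (cases "x \<in> K") auto
    then show ?thesis using that[of "max 0 C"] by auto
  qed
  obtain R where R: "\<And>x. x \<in> K \<Longrightarrow> norm x \<le> R"
    using compact_imp_bounded[OF K(1)] unfolding bounded_iff by blast
  have int: "integrable lborel f" if "continuous_on UNIV f" "\<And>x. x \<notin> K \<Longrightarrow> f x = 0" for f :: "'a \<Rightarrow> real"
  proof -
    have "integrable lborel (\<lambda>x. indicator K x *\<^sub>R f x)"
      by (rule borel_integrable_compact[OF K(1) continuous_on_subset[OF that(1)]]) auto
    moreover have "(\<lambda>x. indicator K x *\<^sub>R f x) = f" by (rule ext) (auto simp: indicator_def that(2))
    ultimately show ?thesis by simp
  qed
  show intD: "integrable lborel (\<lambda>x. frechet_derivative w (at x) v)"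
    using int[OF contD D0] by (simp add: D_def)
  have intw: "integrable lborel w" by (rule int[OF contw K(2)])
  \<comment> \<open>The steps are at most as long as \<open>v\<close>, so all these quotients are supported in one ball.\<close>
  define q where "q = (\<lambda>n x. (w (x + inverse (real (Suc n)) *\<^sub>R v) - w x) * real (Suc n))"
  have "(\<lambda>n. \<integral>x. q n x \<partial>lborel) \<longlonglongrightarrow> (\<integral>x. D x \<partial>lborel)"
  proof (rule integral_dominated_convergence[where w = "\<lambda>x. indicator (cball 0 (R + norm v)) x *\<^sub>R C"])
    show "D \<in> borel_measurable lborel" using borel_measurable_continuous_onI[OF contD] by simp
    have [measurable]: "w \<in> borel_measurable borel" by (rule borel_measurable_continuous_onI[OF contw])
    show "q n \<in> borel_measurable lborel" for n
      unfolding q_def by measurable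
    show "integrable lborel (\<lambda>x::'a. indicator (cball 0 (R + norm v)) x *\<^sub>R C)"
      by (rule borel_integrable_compact) auto
    show "AE x in lborel. (\<lambda>n. q n x) \<longlonglongrightarrow> D x"
    proof (rule AE_I2)
      fix x :: 'a
      have "((\<lambda>h. (w (x + h *\<^sub>R v) - w x) / h) \<longlongrightarrow> D x) (at 0)"
        using der[of x 0] by (simp add: DERIV_def)
      moreover have "filterlim (\<lambda>n. inverse (real (Suc n))) (at 0) sequentially"
        unfolding filterlim_at using LIMSEQ_inverse_real_of_nat by (simp del: of_nat_Suc)
      ultimately have "(\<lambda>n. (w (x + inverse (real (Suc n)) *\<^sub>R v) - w x) / inverse (real (Suc n))) \<longlonglongrightarrow> D x"
        by (rule filterlim_compose)
      then show "(\<lambda>n. q n x) \<longlonglongrightarrow> D x" by (simp add: q_def divide_inverse)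
    qed
    show "AE x in lborel. norm (q n x) \<le> indicator (cball 0 (R + norm v)) x *\<^sub>R C" for n
    proof (rule AE_I2)
      fix x :: 'a
      let ?h = "inverse (real (Suc n))"
      have h: "0 < ?h" "?h \<le> 1" by (auto simp: field_simps)
      show "norm (q n x) \<le> indicator (cball 0 (R + norm v)) x *\<^sub>R C"
      proof (cases "x \<in> cball 0 (R + norm v)")
        case True
        have "norm (w (x + ?h *\<^sub>R v) - w (x + 0 *\<^sub>R v)) \<le> C * norm (?h - 0)"
          by (rule field_differentiable_bound[where S = UNIV and f' = "\<lambda>t. D (x + t *\<^sub>R v)"])
            (use der C in auto)
        then have "\<bar>w (x + ?h *\<^sub>R v) - w x\<bar> * real (Suc n) \<le> (C * ?h) * real (Suc n)"
          using h by (intro mult_right_mono) auto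
        also have "\<dots> = C" using h by simp
        finally show ?thesis using True by (simp add: q_def abs_mult)
      next
        case False
        then have *: "R + norm v < norm x" by simp
        have "norm (?h *\<^sub>R v) \<le> norm v" using h by (simp add: mult_left_le_one_le)
        moreover have "norm x \<le> norm (x + ?h *\<^sub>R v) + norm (?h *\<^sub>R v)"
          using norm_triangle_ineq4[of "x + ?h *\<^sub>R v" "?h *\<^sub>R v"] by simp
        ultimately have "R < norm (x + ?h *\<^sub>R v)" using * by linarith
        then have "x + ?h *\<^sub>R v \<notin> K" using R[of "x + ?h *\<^sub>R v"] by linarith
        moreover have "x \<notin> K" using R[of x] * norm_ge_zero[of v] by linarith
        ultimately show ?thesis using False K(2) by (simp add: q_def)
      qed
    qed
  qed
  moreover have "(\<integral>x. q n x \<partial>lborel) = 0" for n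
  proof -
    let ?c = "inverse (real (Suc n)) *\<^sub>R v"
    have d: "distr lborel borel ((+) ?c) = lborel" by (rule lborel_distr_plus)
    have "integrable (distr lborel borel ((+) ?c)) w" using intw by (simp only: d)
    then have i: "integrable lborel (\<lambda>x. w (x + ?c))"
      by (subst (asm) integrable_distr_eq) (use intw in \<open>auto simp: add.commute\<close>)
    have "(\<integral>x. w x \<partial>lborel) = (\<integral>x. w x \<partial>(distr lborel borel ((+) ?c)))" by (simp only: d)
    also have "\<dots> = (\<integral>x. w (x + ?c) \<partial>lborel)"
      by (subst integral_distr) (use intw in \<open>auto simp: add.commute\<close>)
    finally show ?thesis using i intw by (simp add: q_def)
  qed
  ultimately have "(\<lambda>n. 0) \<longlonglongrightarrow> (\<integral>x. D x \<partial>lborel)" by simp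
  then show "(\<integral>x. frechet_derivative w (at x) v \<partial>lborel) = 0"
    unfolding D_def using LIMSEQ_unique tendsto_const by blast
qed

lemma integral_divergence_compact_support:
  fixes V :: "'a::euclidean_space \<Rightarrow> 'a"
  assumes V: "C1_on UNIV V" and K: "compact K" "\<And>x. x \<notin> K \<Longrightarrow> V x = 0"
  shows "(\<integral>x. (\<Sum>b\<in>Basis. frechet_derivative V (at x) b \<bullet> b) \<partial>lborel) = 0"
proof -
  have eq: "frechet_derivative V (at x) b \<bullet> b = frechet_derivative (\<lambda>x. V x \<bullet> b) (at x) b" for x b
  proof -
    have "((\<lambda>x. V x \<bullet> b) has_derivative (\<lambda>v. frechet_derivative V (at x) v \<bullet> b)) (at x)"
      using has_derivative_inner_left[OF C1_on_has_derivative[OF V UNIV_I]] by blast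
    then show ?thesis using frechet_derivative_at by metis
  qed
  have C1: "C1_on UNIV (\<lambda>x. V x \<bullet> b)" for b
    by (intro C1_on_inner V C1_on_const)
  show ?thesis
    unfolding eq
    by (subst Bochner_Integration.integral_sum)
      (use integral_frechet_derivative_compact_support[OF C1 K(1)] K(2) in auto)
qed


section \<open>Charts and differentials\<close>

lemma atlas_ex_chart: "smooth_atlas A \<Longrightarrow> \<exists>c. c \<in> charts_at A p"
  unfolding smooth_atlas_def charts_at_def by blast

lemma charts_atD: "c \<in> charts_at A p \<Longrightarrow> c \<in> A" "c \<in> charts_at A p \<Longrightarrow> p \<in> fst c"
  by (auto simp: charts_at_def)

lemma atlas_open: 
  assumes "smooth_atlas A" "c \<in> A"
  shows open_chart_domain: "open (fst c)" and open_chart_image: "open (chart_image c)"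
    and chart_homeomorphism: "homeomorphism (fst c) (chart_image c) (snd c) (chart_inv c)"
  using assms unfolding smooth_atlas_def by blast+

lemma chart_inv_in: 
  assumes "smooth_atlas A" "c \<in> A" "x \<in> chart_image c"
  shows "chart_inv c x \<in> fst c" "snd c (chart_inv c x) = x"
  using chart_homeomorphism[OF assms(1,2)] assms(3) unfolding homeomorphism_def by auto

lemma chart_in: 
  assumes "smooth_atlas A" "c \<in> A" "p \<in> fst c"
  shows "chart_inv c (snd c p) = p" "snd c p \<in> chart_image c"
  using chart_homeomorphism[OF assms(1,2)] assms(3) unfolding homeomorphism_def chart_image_def by auto

lemma chart_at_in: 
  assumes "smooth_atlas A" "c \<in> charts_at A p"
  shows "chart_inv c (snd c p) = p" "snd c p \<in> chart_image c"
  using chart_in[OF assms(1) charts_atD(1)[OF assms(2)] charts_atD(2)[OF assms(2)]] by auto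

lemma chart_inv_charts_at: 
  assumes "smooth_atlas A" "c \<in> A" "x \<in> chart_image c"
  shows "c \<in> charts_at A (chart_inv c x)"
  using chart_inv_in[OF assms] assms(2) by (simp add: charts_at_def)

lemma chart_image_restrict:
  assumes "smooth_atlas A" "c \<in> A"
  shows "snd c ` (fst c \<inter> W) = chart_image c \<inter> chart_inv c -` W"
  using chart_in[OF assms] chart_inv_in[OF assms] by (force simp: chart_image_def)

lemma open_chart_image_restrict:
  assumes "smooth_atlas A" "c \<in> A" "open W"
  shows "open (chart_image c \<inter> chart_inv c -` W)" "open (snd c ` (fst c \<inter> W))"
proof -
  have "continuous_on (chart_image c) (chart_inv c)"
    using chart_homeomorphism[OF assms(1,2)] by (simp add: homeomorphism_def)
  then show "open (chart_image c \<inter> chart_inv c -` W)"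
    using continuous_on_open_vimage[OF open_chart_image[OF assms(1,2)]] assms(3)
    by (metis Int_commute)
  then show "open (snd c ` (fst c \<inter> W))" by (simp add: chart_image_restrict[OF assms(1,2)])
qed

text \<open>Continuity is part of the definition because a chart expression describes the map only near points that
  it sends into the chart of the target.\<close>

definition mdiff ::
  "('a::topological_space, 'e::euclidean_space) atlas \<Rightarrow>
   ('b::topological_space, 'f::euclidean_space) atlas \<Rightarrow> ('a \<Rightarrow> 'b) \<Rightarrow> bool" where
  "mdiff A B u \<longleftrightarrow> continuous_on UNIV u \<and>
     (\<forall>p. \<forall>c\<in>charts_at A p. \<forall>d\<in>charts_at B (u p). 
        (snd d \<circ> u \<circ> chart_inv c) differentiable (at (snd c p)))"

lemma smooth_on_imp_differentiable: "smooth_on S f \<Longrightarrow> x \<in> S \<Longrightarrow> f differentiable (at x)"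
  using smooth_on_imp_C1_on[of S f] by (simp add: C1_on_iff)

lemma smooth_map_imp_mdiff: 
  assumes "smooth_map A B u" shows "mdiff A B u"
  unfolding mdiff_def
proof (intro conjI allI ballI)
  fix p c d assume "c \<in> charts_at A p" "d \<in> charts_at B (u p)"
  then show "snd d \<circ> u \<circ> chart_inv c differentiable at (snd c p)"
    using assms unfolding smooth_map_def charts_at_def
    by (intro smooth_on_imp_differentiable[of "snd c ` (fst c \<inter> u -` fst d)"]) auto
qed (use assms in \<open>simp add: smooth_map_def\<close>)

lemma mdiff_id: 
  assumes "smooth_atlas A" shows "mdiff A A id"
  unfolding mdiff_def
proof (intro conjI allI ballI)
  fix p c d assume "c \<in> charts_at A p" "d \<in> charts_at A (id p)"
  then show "snd d \<circ> id \<circ> chart_inv c differentiable at (snd c p)"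
    using assms unfolding smooth_atlas_def charts_at_def
    by (intro smooth_on_imp_differentiable[of "snd c ` (fst c \<inter> fst d)"]) (auto simp: transition_def)
qed (simp add: id_def)

text \<open>With the identity as one of the two maps this is also the rule for changing charts, since a transition map
  is the identity written in two charts.\<close>

lemma chart_rep_chain:
  assumes A: "smooth_atlas A" and B: "smooth_atlas B" 
    and u: "mdiff A B u" and w: "mdiff B C w"
    and c: "c \<in> charts_at A p" and d: "d \<in> charts_at B (u p)" and e: "e \<in> charts_at C (w (u p))"
  shows "((snd e \<circ> (w \<circ> u) \<circ> chart_inv c) has_derivative 
    (\<lambda>v. frechet_derivative (snd e \<circ> w \<circ> chart_inv d) (at (snd d (u p)))
       (frechet_derivative (snd d \<circ> u \<circ> chart_inv c) (at (snd c p)) v))) (at (snd c p))"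
proof (rule has_derivative_transform_within_open)
  have cA: "c \<in> A" and dB: "d \<in> B" using c d by (auto simp: charts_at_def)
  note cp = chart_at_in[OF A c]
  have "((snd d \<circ> u \<circ> chart_inv c) has_derivative 
      frechet_derivative (snd d \<circ> u \<circ> chart_inv c) (at (snd c p))) (at (snd c p))"
    using u c d by (simp add: mdiff_def frechet_derivative_works)
  moreover have "((snd e \<circ> w \<circ> chart_inv d) has_derivative 
      frechet_derivative (snd e \<circ> w \<circ> chart_inv d) (at (snd d (u p)))) 
      (at ((snd d \<circ> u \<circ> chart_inv c) (snd c p)))"
    using w d e cp by (simp add: mdiff_def frechet_derivative_works)
  ultimately show "((\<lambda>x. (snd e \<circ> w \<circ> chart_inv d) ((snd d \<circ> u \<circ> chart_inv c) x)) has_derivative 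
    (\<lambda>v. frechet_derivative (snd e \<circ> w \<circ> chart_inv d) (at (snd d (u p)))
       (frechet_derivative (snd d \<circ> u \<circ> chart_inv c) (at (snd c p)) v))) (at (snd c p))"
    by (rule has_derivative_compose)
  have "open (u -` fst d)"
    using u open_chart_domain[OF B dB] by (auto simp: mdiff_def intro: open_vimage)
  then show "open (chart_image c \<inter> chart_inv c -` (u -` fst d))"
    by (rule open_chart_image_restrict(1)[OF A cA])
  show "snd c p \<in> chart_image c \<inter> chart_inv c -` (u -` fst d)"
    using cp d by (auto simp: charts_at_def)
  show "(snd e \<circ> w \<circ> chart_inv d) ((snd d \<circ> u \<circ> chart_inv c) x) = (snd e \<circ> (w \<circ> u) \<circ> chart_inv c) x"
    if "x \<in> chart_image c \<inter> chart_inv c -` (u -` fst d)" for x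
    using that chart_in(1)[OF B dB] by auto
qed

lemmas frechet_chart_rep_chain = frechet_derivative_at[OF chart_rep_chain, symmetric]

lemma mdiff_compose:
  assumes "smooth_atlas A" "smooth_atlas B" "mdiff A B u" "mdiff B C w"
  shows "mdiff A C (w \<circ> u)"
  unfolding mdiff_def
proof (intro conjI allI ballI)
  show "continuous_on UNIV (w \<circ> u)" 
    using assms(3,4) unfolding mdiff_def by (meson continuous_on_compose continuous_on_subset subset_UNIV)
  fix p c e assume c: "c \<in> charts_at A p" and e: "e \<in> charts_at C ((w \<circ> u) p)"
  obtain d where "d \<in> charts_at B (u p)" using atlas_ex_chart[OF assms(2)] by blast
  then show "(snd e \<circ> (w \<circ> u) \<circ> chart_inv c) differentiable at (snd c p)"
    using chart_rep_chain[OF assms c, of d e] e unfolding differentiable_def by (metis comp_apply)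
qed

lemma tangent_spaceD:
  assumes "v \<in> tangent_space A p"
  shows "c \<notin> charts_at A p \<Longrightarrow> v c = 0"
    and "c \<in> charts_at A p \<Longrightarrow> d \<in> charts_at A p \<Longrightarrow>
      v d = frechet_derivative (transition c d) (at (snd c p)) (v c)"
  using assms unfolding tangent_space_def by blast+

lemma tangent_spaceI:
  assumes "\<And>c. c \<notin> charts_at A p \<Longrightarrow> v c = 0"
    and "\<And>c d. c \<in> charts_at A p \<Longrightarrow> d \<in> charts_at A p \<Longrightarrow>
      v d = frechet_derivative (transition c d) (at (snd c p)) (v c)"
  shows "v \<in> tangent_space A p"
  using assms unfolding tangent_space_def by blast

text \<open>The chart chosen in the definition of the differential is immaterial: passing to another one inserts the
  derivative of a transition map, which the tangent vector absorbs.\<close>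

lemma differential_apply:
  assumes "smooth_atlas A" "smooth_atlas B" "mdiff A B u" "v \<in> tangent_space A p"
    "c \<in> charts_at A p" "d \<in> charts_at B (u p)"
  shows "differential A B u p v d = frechet_derivative (snd d \<circ> u \<circ> chart_inv c) (at (snd c p)) (v c)"
proof -
  define c0 where "c0 = (SOME c. c \<in> charts_at A p)"
  have c0: "c0 \<in> charts_at A p" unfolding c0_def using atlas_ex_chart[OF assms(1)] by (rule someI_ex)
  have v: "v c0 = frechet_derivative (snd c0 \<circ> id \<circ> chart_inv c) (at (snd c p)) (v c)"
    using tangent_spaceD(2)[OF assms(4,5) c0] by (simp add: transition_def)
  have "differential A B u p v d = frechet_derivative (snd d \<circ> u \<circ> chart_inv c0) (at (snd c0 p)) (v c0)"
    using assms(6) by (simp add: differential_def c0_def Let_def)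
  also have "\<dots> = frechet_derivative (snd d \<circ> (u \<circ> id) \<circ> chart_inv c) (at (snd c p)) (v c)"
    unfolding v using frechet_chart_rep_chain[OF assms(1,1) mdiff_id[OF assms(1)] assms(3,5), of c0 d] c0 assms(6)
    by simp
  finally show ?thesis by simp
qed

lemma differential_in_tangent_space:
  assumes "smooth_atlas A" "smooth_atlas B" "mdiff A B u" "v \<in> tangent_space A p"
  shows "differential A B u p v \<in> tangent_space B (u p)"
proof -
  obtain c where c: "c \<in> charts_at A p" using atlas_ex_chart[OF assms(1)] by blast
  have "differential A B u p v e = frechet_derivative (transition d e) (at (snd d (u p))) (differential A B u p v d)"
    if d: "d \<in> charts_at B (u p)" and e: "e \<in> charts_at B (u p)" for d e
    using frechet_chart_rep_chain[OF assms(1,2,3) mdiff_id[OF assms(2)] c d, of e] e 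
    by (simp add: differential_apply[OF assms c] d e transition_def)
  then show ?thesis by (rule tangent_spaceI[rotated]) (simp_all add: differential_def)
qed

lemma differential_compose:
  assumes "smooth_atlas A" "smooth_atlas B" "smooth_atlas C" "mdiff A B u" "mdiff B C w" 
    "v \<in> tangent_space A p"
  shows "differential A C (w \<circ> u) p v = differential B C w (u p) (differential A B u p v)"
proof
  fix e
  obtain c d where c: "c \<in> charts_at A p" and d: "d \<in> charts_at B (u p)" 
    using atlas_ex_chart assms(1,2) by metis
  show "differential A C (w \<circ> u) p v e = differential B C w (u p) (differential A B u p v) e"
  proof (cases "e \<in> charts_at C (w (u p))")
    case True
    show ?thesis
      using frechet_chart_rep_chain[OF assms(1,2,4,5) c d True] True
      by (simp add: differential_apply[OF assms(1,3) mdiff_compose[OF assms(1,2,4,5)] assms(6) c]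
          differential_apply[OF assms(2,3,5) differential_in_tangent_space[OF assms(1,2,4,6)] d]
          differential_apply[OF assms(1,2,4,6) c d])
  qed (simp add: differential_def)
qed

lemma coord_vec_in_tangent_space:
  assumes "smooth_atlas A" "c \<in> charts_at A p"
  shows "coord_vec A c p a \<in> tangent_space A p"
proof (rule tangent_spaceI)
  fix d e assume d: "d \<in> charts_at A p" and e: "e \<in> charts_at A p"
  show "coord_vec A c p a e = frechet_derivative (transition d e) (at (snd d p)) (coord_vec A c p a d)"
    using frechet_chart_rep_chain[OF assms(1,1) mdiff_id[OF assms(1)] mdiff_id[OF assms(1)] assms(2), of d e] d e
    by (simp add: coord_vec_def transition_def)
qed (simp add: coord_vec_def)

lemma coord_vec_self:
  assumes "smooth_atlas A" "c \<in> charts_at A p"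
  shows "coord_vec A c p a c = a"
proof -
  have "frechet_derivative (transition c c) (at (snd c p)) = frechet_derivative (\<lambda>x. x) (at (snd c p))"
    by (rule frechet_derivative_cong_open[of "chart_image c"])
       (use assms charts_atD(1)[OF assms(2)] in 
         \<open>auto simp: open_chart_image transition_def chart_at_in chart_inv_in\<close>)
  then show ?thesis using assms by (simp add: coord_vec_def)
qed

lemma coord_vec_of_tangent:
  assumes "v \<in> tangent_space A p" "c \<in> charts_at A p"
  shows "coord_vec A c p (v c) = v"
proof
  show "coord_vec A c p (v c) d = v d" for d
    using tangent_spaceD(1)[OF assms(1), of d] tangent_spaceD(2)[OF assms, of d, symmetric] 
    by (simp add: coord_vec_def)
qed

lemma transition_differentiable:
  assumes "smooth_atlas A" "c \<in> charts_at A p" "d \<in> charts_at A p"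
  shows "transition c d differentiable (at (snd c p))"
  using mdiff_id[OF assms(1)] assms by (simp add: mdiff_def transition_def)

lemma coord_vec_combination:
  assumes "smooth_atlas A" "c \<in> charts_at A p"
  shows "coord_vec A c p (a *\<^sub>R x + y) = (\<lambda>d. a *\<^sub>R coord_vec A c p x d + coord_vec A c p y d)"
proof
  fix d show "coord_vec A c p (a *\<^sub>R x + y) d = a *\<^sub>R coord_vec A c p x d + coord_vec A c p y d"
    using linear_frechet_derivative[OF transition_differentiable[OF assms, of d]]
    by (simp add: coord_vec_def linear_add linear_scale)
qed

text \<open>Tangent vectors correspond linearly to coordinate vectors in one chart, hence form a vector space.\<close>

lemma tangent_combination:
  assumes A: "smooth_atlas A" and "v \<in> tangent_space A p" "w \<in> tangent_space A p"
  shows "(\<lambda>c. a *\<^sub>R v c + w c) \<in> tangent_space A p"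
proof -
  obtain c where c: "c \<in> charts_at A p" using atlas_ex_chart[OF A] by blast
  have "(\<lambda>d. a *\<^sub>R v d + w d) = coord_vec A c p (a *\<^sub>R v c + w c)"
    by (simp add: coord_vec_combination[OF A c] coord_vec_of_tangent[OF assms(2) c] 
        coord_vec_of_tangent[OF assms(3) c])
  then show ?thesis using coord_vec_in_tangent_space[OF A c] by simp
qed

lemma tangent_zero:
  assumes A: "smooth_atlas A"
  shows "(\<lambda>c. 0) \<in> tangent_space A p"
proof -
  obtain c where c: "c \<in> charts_at A p" using atlas_ex_chart[OF A] by blast
  have "coord_vec A c p 0 = (\<lambda>c. 0)"
    using coord_vec_combination[OF A c, of "-1" 0 0] by (simp add: fun_eq_iff) 
  then show ?thesis using coord_vec_in_tangent_space[OF A c, of 0] by simp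
qed

lemma tangent_sum:
  assumes A: "smooth_atlas A" and "finite I" "\<And>i. i \<in> I \<Longrightarrow> v i \<in> tangent_space A p"
  shows "(\<lambda>c. \<Sum>i\<in>I. a i *\<^sub>R v i c) \<in> tangent_space A p"
  using assms(2,3) by (induction I rule: finite_induct) 
    (auto simp: tangent_zero[OF A] intro: tangent_combination[OF A])


section \<open>Bilinear forms on tangent spaces\<close>

definition bilinear_tensor :: "('a, 'e::euclidean_space) atlas \<Rightarrow> ('a, 'e) tensor2 \<Rightarrow> bool" where
  "bilinear_tensor A T \<longleftrightarrow> 
     (\<forall>p. \<forall>v\<in>tangent_space A p. \<forall>w\<in>tangent_space A p. \<forall>z\<in>tangent_space A p. \<forall>a.
        T p (\<lambda>c. a *\<^sub>R v c + w c) z = a * T p v z + T p w z \<and>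
        T p z (\<lambda>c. a *\<^sub>R v c + w c) = a * T p z v + T p z w)"

lemma bilinear_tensorD:
  assumes "bilinear_tensor A T" "v \<in> tangent_space A p" "w \<in> tangent_space A p" "z \<in> tangent_space A p"
  shows "T p (\<lambda>c. a *\<^sub>R v c + w c) z = a * T p v z + T p w z"
    and "T p z (\<lambda>c. a *\<^sub>R v c + w c) = a * T p z v + T p z w"
  using assms unfolding bilinear_tensor_def by blast+

definition symmetric_tensor :: "('a, 'e::euclidean_space) atlas \<Rightarrow> ('a, 'e) tensor2 \<Rightarrow> bool" where
  "symmetric_tensor A T \<longleftrightarrow> 
     (\<forall>p. \<forall>v\<in>tangent_space A p. \<forall>w\<in>tangent_space A p. T p v w = T p w v)"

lemma riemannian_metric_symmetric: "riemannian_metric A g \<Longrightarrow> symmetric_tensor A g"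
  unfolding riemannian_metric_def symmetric_tensor_def by blast

lemma riemannian_metric_bilinear: 
  assumes A: "smooth_atlas A" and g: "riemannian_metric A g" shows "bilinear_tensor A g"
  unfolding bilinear_tensor_def
proof (intro allI ballI)
  fix p v w z and a :: real
  assume *: "v \<in> tangent_space A p" "w \<in> tangent_space A p" "z \<in> tangent_space A p"
  have 1: "g p (\<lambda>c. a *\<^sub>R v c + w c) z = a * g p v z + g p w z"
    using g * unfolding riemannian_metric_def by blast
  have sym: "g p x y = g p y x" if "x \<in> tangent_space A p" "y \<in> tangent_space A p" for x y
    using riemannian_metric_symmetric[OF g] that unfolding symmetric_tensor_def by blast
  show "g p (\<lambda>c. a *\<^sub>R v c + w c) z = a * g p v z + g p w z \<and>
        g p z (\<lambda>c. a *\<^sub>R v c + w c) = a * g p z v + g p z w"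
    using 1 sym[OF *(3) tangent_combination[OF A *(1,2)]] sym[OF *(3,1)] sym[OF *(3,2)] by simp
qed

lemma bilinear_tensor_zero_left: 
  assumes A: "smooth_atlas A" and "bilinear_tensor A T" "z \<in> tangent_space A p" 
  shows "T p (\<lambda>c. 0) z = 0"
proof -
  have "T p (\<lambda>c. 1 *\<^sub>R 0 + 0) z = 1 * T p (\<lambda>c. 0) z + T p (\<lambda>c. 0) z"
    by (rule bilinear_tensorD[OF assms(2) tangent_zero[OF A] tangent_zero[OF A] assms(3)])
  then show ?thesis by simp
qed

lemma bilinear_tensor_sum_left:
  assumes A: "smooth_atlas A" and T: "bilinear_tensor A T" "z \<in> tangent_space A p" 
    and "finite I" "\<And>i. i \<in> I \<Longrightarrow> v i \<in> tangent_space A p"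
  shows "T p (\<lambda>c. \<Sum>i\<in>I. a i *\<^sub>R v i c) z = (\<Sum>i\<in>I. a i * T p (v i) z)"
  using assms(4,5)
proof (induction I rule: finite_induct)
  case (insert i I)
  have "T p (\<lambda>c. a i *\<^sub>R v i c + (\<Sum>i\<in>I. a i *\<^sub>R v i c)) z 
      = a i * T p (v i) z + T p (\<lambda>c. \<Sum>i\<in>I. a i *\<^sub>R v i c) z"
    by (rule bilinear_tensorD(1)[OF T(1) _ _ T(2)], rule insert.prems, simp)
      (rule tangent_sum[OF A \<open>finite I\<close>], simp add: insert.prems)
  then show ?case using insert by simp
qed (simp add: bilinear_tensor_zero_left[OF assms(1,2,3)])

lemma gram_matrix_nth:
  assumes A: "smooth_atlas A" and c: "c \<in> charts_at A p"
  shows "gram_matrix A T c (snd c p) $ i $ j = T p (coord_vec A c p (axis i 1)) (coord_vec A c p (axis j 1))"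
  by (simp add: gram_matrix_def chart_at_in[OF A c])

lemma linear_expand_axis:
  fixes f :: "real^'m \<Rightarrow> real" assumes "linear f"
  shows "f x = (\<Sum>i\<in>UNIV. x $ i * f (axis i 1))"
proof -
  have "f x = f (\<Sum>i\<in>UNIV. x $ i *\<^sub>R axis i 1)" by (simp add: basis_expansion flip: scalar_mult_eq_scaleR)
  also have "\<dots> = (\<Sum>i\<in>UNIV. x $ i * f (axis i 1))" by (simp add: linear_sum[OF assms] linear_scale[OF assms])
  finally show ?thesis .
qed

lemma bilinear_tensor_gram:
  assumes A: "smooth_atlas A" and T: "bilinear_tensor A T" and c: "c \<in> charts_at A p"
    and v: "v \<in> tangent_space A p" and w: "w \<in> tangent_space A p"
  shows "T p v w = v c \<bullet> (gram_matrix A T c (snd c p) *v w c)"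
proof -
  let ?k = "coord_vec A c p"
  have k: "?k x \<in> tangent_space A p" for x by (rule coord_vec_in_tangent_space[OF A c])
  have l: "linear (\<lambda>x. T p (?k x) z)" and r: "linear (\<lambda>x. T p z (?k x))" if "z \<in> tangent_space A p" for z
  proof -
    have "T p (?k (a *\<^sub>R x + y)) z = a * T p (?k x) z + T p (?k y) z"
         "T p z (?k (a *\<^sub>R x + y)) = a * T p z (?k x) + T p z (?k y)" for a x y
      unfolding coord_vec_combination[OF A c] 
      by (rule bilinear_tensorD[OF T k k that])+
    from this[of 1] this[of _ _ 0] this[of "-1" 0 0]
    show "linear (\<lambda>x. T p (?k x) z)" "linear (\<lambda>x. T p z (?k x))" by (auto intro!: linearI)
  qed
  have "T p v w = T p (?k (v c)) (?k (w c))" 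
    by (simp add: coord_vec_of_tangent v w c)
  also have "\<dots> = (\<Sum>i\<in>UNIV. v c $ i * T p (?k (axis i 1)) (?k (w c)))" 
    by (rule linear_expand_axis[OF l[OF k]])
  also have "\<dots> = (\<Sum>i\<in>UNIV. v c $ i * (\<Sum>j\<in>UNIV. w c $ j * T p (?k (axis i 1)) (?k (axis j 1))))"
    by (subst linear_expand_axis[OF r[OF k]]) simp
  also have "\<dots> = v c \<bullet> (gram_matrix A T c (snd c p) *v w c)"
    by (simp add: inner_vec_def matrix_vector_mult_def gram_matrix_nth[OF A c] mult.commute)
  finally show ?thesis .
qed

lemma gram_matrix_symmetric:
  assumes A: "smooth_atlas A" and "symmetric_tensor A T" "c \<in> A" "x \<in> chart_image c"
  shows "transpose (gram_matrix A T c x) = gram_matrix A T c x"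
proof -
  let ?p = "chart_inv c x"
  have "T ?p (coord_vec A c ?p a) (coord_vec A c ?p b) = T ?p (coord_vec A c ?p b) (coord_vec A c ?p a)" for a b
    using assms(2) coord_vec_in_tangent_space[OF A chart_inv_charts_at[OF A assms(3,4)]]
    unfolding symmetric_tensor_def by blast
  then show ?thesis
    unfolding gram_matrix_def transpose_def vec_eq_iff by simp
qed


section \<open>Orthonormal frames\<close>

text \<open>Gram--Schmidt, one index at a time: fewer vectors than the dimension leave a vector outside their span.\<close>

lemma exists_orthonormal_family:
  fixes b :: "real^'m \<Rightarrow> real^'m \<Rightarrow> real"
  assumes bil: "bilinear b" and sym: "\<And>x y. b x y = b y x" and pos: "\<And>x. x \<noteq> 0 \<Longrightarrow> b x x > 0"
  shows "\<exists>e :: 'm \<Rightarrow> real^'m. \<forall>i j. b (e i) (e j) = (if i = j then 1 else 0)"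
proof -
  have l: "linear (\<lambda>x. b x y)" and r: "linear (b x)" for x y using bil by (auto simp: bilinear_def)
  have "\<exists>e :: 'm \<Rightarrow> real^'m. \<forall>i\<in>I. \<forall>j\<in>I. b (e i) (e j) = (if i = j then 1 else 0)" for I :: "'m set"
  proof (induction I rule: finite_induct[OF finite])
    case (2 i I)
    then obtain e :: "'m \<Rightarrow> real^'m" 
      where e: "\<And>i j. i \<in> I \<Longrightarrow> j \<in> I \<Longrightarrow> b (e i) (e j) = (if i = j then 1 else 0)" by blast
    have "dim (e ` I) \<le> card (e ` I)" by (rule dim_le_card') simp
    also have "\<dots> \<le> card I" by (rule card_image_le) simp
    also have "\<dots> < card (insert i I)" using 2 by simp
    also have "\<dots> \<le> CARD('m)" by (rule card_mono) auto
    finally have "span (e ` I) \<noteq> UNIV" 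
      by (metis dim_UNIV dim_span DIM_cart DIM_real mult_1_right less_irrefl)
    then obtain y where y: "y \<notin> span (e ` I)" by blast
    define z where "z = y - (\<Sum>j\<in>I. b y (e j) *\<^sub>R e j)"
    have "(\<Sum>j\<in>I. b y (e j) *\<^sub>R e j) \<in> span (e ` I)"
      by (intro span_sum span_scale span_base) auto
    then have "z \<noteq> 0" using y by (auto simp: z_def)
    then have zz: "b z z > 0" by (rule pos)
    have ze: "b z (e k) = 0" if k: "k \<in> I" for k
    proof -
      have "b z (e k) = b y (e k) - (\<Sum>j\<in>I. b y (e j) * b (e j) (e k))"
        unfolding z_def by (simp add: linear_diff[OF l] linear_sum[OF l] linear_scale[OF l])
      also have "(\<Sum>j\<in>I. b y (e j) * b (e j) (e k)) = (\<Sum>j\<in>I. if j = k then b y (e j) else 0)"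
        by (intro sum.cong) (auto simp: e k)
      finally show ?thesis using k by simp
    qed
    let ?z = "inverse (sqrt (b z z)) *\<^sub>R z"
    have "b ?z ?z = inverse (sqrt (b z z)) * inverse (sqrt (b z z)) * b z z"
      by (simp add: linear_scale[OF l] linear_scale[OF r])
    also have "\<dots> = 1" using zz real_sqrt_mult_self[of "b z z"] by (simp add: field_simps)
    finally have "b ?z ?z = 1" .
    moreover have "b ?z (e k) = 0" "b (e k) ?z = 0" if "k \<in> I" for k
      using ze[OF that] sym[of "e k" ?z] by (simp_all add: linear_scale[OF l])
    ultimately show ?case using e \<open>i \<notin> I\<close>
      by (intro exI[of _ "e(i := ?z)"]) auto
  qed simp
  from this[of UNIV] show ?thesis by simp
qed

lemma frame_orthonormal:
  fixes A :: "('a::topological_space, real^'m) atlas"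
  assumes A: "smooth_atlas A" and g: "riemannian_metric A g"
  shows "frame A g p i \<in> tangent_space A p"
    and "g p (frame A g p i) (frame A g p j) = (if i = j then 1 else 0)"
proof -
  obtain c where c: "c \<in> charts_at A p" using atlas_ex_chart[OF A] by blast
  let ?k = "coord_vec A c p" and ?G = "gram_matrix A g c (snd c p)"
  have k: "?k x \<in> tangent_space A p" for x by (rule coord_vec_in_tangent_space[OF A c])
  have gk: "g p (?k x) (?k y) = x \<bullet> (?G *v y)" for x y
    by (simp add: bilinear_tensor_gram[OF A riemannian_metric_bilinear[OF A g] c k k] coord_vec_self[OF A c])
  have "\<exists>e :: 'm \<Rightarrow> real^'m. \<forall>i j. g p (?k (e i)) (?k (e j)) = (if i = j then 1 else 0)"
  proof (rule exists_orthonormal_family)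
    show "bilinear (\<lambda>x y. g p (?k x) (?k y))"
      unfolding gk bilinear_def
      by (auto intro!: linearI simp: inner_add_left inner_add_right matrix_vector_right_distrib matrix_vector_mult_scaleR)
    show "g p (?k x) (?k y) = g p (?k y) (?k x)" for x y
      using g k unfolding riemannian_metric_def by blast
    fix x :: "real^'m" assume "x \<noteq> 0"
    then have "?k x \<noteq> (\<lambda>_. 0)" using coord_vec_self[OF A c, of x] by auto
    then show "g p (?k x) (?k x) > 0" using g k unfolding riemannian_metric_def by blast
  qed
  then obtain e :: "'m \<Rightarrow> real^'m" 
    where "\<forall>i j. g p (?k (e i)) (?k (e j)) = (if i = j then 1 else 0)" by blast
  then have "\<exists>e :: 'm \<Rightarrow> ('a, real^'m) tvec. (\<forall>i. e i \<in> tangent_space A p) \<and> (\<forall>i j. g p (e i) (e j) = (if i = j then 1 else 0))"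
    using k by (intro exI[of _ "\<lambda>i. ?k (e i)"]) auto
  from someI_ex[OF this]
  have "(\<forall>i. frame A g p i \<in> tangent_space A p) \<and> 
    (\<forall>i j. g p (frame A g p i) (frame A g p j) = (if i = j then 1 else 0))"
    unfolding frame_def .
  then show "frame A g p i \<in> tangent_space A p"
     "g p (frame A g p i) (frame A g p j) = (if i = j then 1 else 0)" by blast+
qed

definition frame_matrix :: 
  "('a, real^'m) atlas \<Rightarrow> ('a, real^'m) tensor2 \<Rightarrow> ('a, real^'m) chart \<Rightarrow> 'a \<Rightarrow> real^'m^'m::finite" where
  "frame_matrix A g c p = (\<chi> a i. frame A g p i c $ a)"

definition tensor_matrix :: 
  "('a, real^'m) atlas \<Rightarrow> ('a, real^'m) tensor2 \<Rightarrow> ('a, real^'m) tensor2 \<Rightarrow> 'a \<Rightarrow> real^'m^'m::finite" where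
  "tensor_matrix A g T p = (\<chi> i j. T p (frame A g p i) (frame A g p j))"

lemma tensor_matrix_coords:
  assumes "\<And>i j. T p (frame A g p i) (frame A g p j) = frame A g p i c \<bullet> (S *v frame A g p j c)"
  shows "tensor_matrix A g T p = transpose (frame_matrix A g c p) ** S ** frame_matrix A g c p"
  unfolding tensor_matrix_def assms
  by (simp add: vec_eq_iff frame_matrix_def matrix_matrix_mult_def matrix_vector_mult_def transpose_def
      inner_vec_def sum_distrib_left sum_distrib_right mult.assoc)
    (intro allI, rule sum.swap)

lemma tensor_matrix_gram:
  assumes "smooth_atlas A" "riemannian_metric A g" "bilinear_tensor A T" "c \<in> charts_at A p"
  shows "tensor_matrix A g T p 
    = transpose (frame_matrix A g c p) ** gram_matrix A T c (snd c p) ** frame_matrix A g c p"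
  by (intro tensor_matrix_coords bilinear_tensor_gram assms frame_orthonormal(1))

text \<open>Orthonormality says \<open>E\<^sup>T G E = 1\<close>, so \<open>E E\<^sup>T\<close> is the inverse Gram matrix. This turns sums over the frame into
  traces in which the frame, an arbitrary choice at each point, no longer occurs.\<close>

lemma frame_matrix_gram:
  fixes A :: "('a::topological_space, real^'m) atlas"
  assumes "smooth_atlas A" "riemannian_metric A g" "c \<in> charts_at A p"
  defines "G \<equiv> gram_matrix A g c (snd c p)" and "E \<equiv> frame_matrix A g c p"
  shows "transpose E ** G ** E = mat 1"
    and "E ** transpose E = matrix_inv G" and "invertible G" and "det G > 0"
proof -
  have "tensor_matrix A g g p = mat 1"
    using frame_orthonormal(2)[OF assms(1,2)] by (simp add: tensor_matrix_def mat_def)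
  then show 1: "transpose E ** G ** E = mat 1"
    using tensor_matrix_gram[OF assms(1,2) riemannian_metric_bilinear[OF assms(1,2)] assms(3)]
    by (simp add: G_def E_def)
  then have "E ** (transpose E ** G) = mat 1" by (simp add: matrix_left_right_inverse)
  then have 2: "(E ** transpose E) ** G = mat 1" by (simp add: matrix_mul_assoc)
  then have 3: "G ** (E ** transpose E) = mat 1" by (simp add: matrix_left_right_inverse)
  show "E ** transpose E = matrix_inv G" using matrix_inv_unique[OF 3] by simp
  show "invertible G" using 2 3 unfolding invertible_def by blast
  have "det E * det G * det E = 1"
    using arg_cong[OF 1, of det] by (simp add: det_mul det_transpose det_I)
  then have *: "det G * (det E)^2 = 1" by (simp add: power2_eq_square ac_simps)
  show "det G > 0"
  proof (rule ccontr)
    assume "\<not> det G > 0"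
    then have "det G * (det E)^2 \<le> 0" by (intro mult_nonpos_nonneg) auto
    then show False using * by simp
  qed
qed

lemma trace_congruence:
  fixes E S :: "real^'m^'m"
  shows "trace (transpose E ** S ** E) = trace ((E ** transpose E) ** S)"
  by (metis matrix_mul_assoc trace_mul_sym)

lemma congruence_mult:
  fixes E S R :: "real^'m^'m"
  shows "(transpose E ** S ** E) ** (transpose E ** R ** E) = transpose E ** (S ** (E ** transpose E) ** R) ** E"
  by (simp add: matrix_mul_assoc)


section \<open>Pullbacks of covariant tensors\<close>

definition pullback ::
  "('a, 'e::euclidean_space) atlas \<Rightarrow> ('b, 'f::euclidean_space) atlas \<Rightarrow> ('a \<Rightarrow> 'b) \<Rightarrow> 
   ('b, 'f) tensor2 \<Rightarrow> ('a, 'e) tensor2" where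
  "pullback A B u h p v w = h (u p) (differential A B u p v) (differential A B u p w)"

lemma differential_combination:
  assumes "smooth_atlas A" "smooth_atlas B" "mdiff A B u" "v \<in> tangent_space A p" "w \<in> tangent_space A p"
  shows "differential A B u p (\<lambda>c. a *\<^sub>R v c + w c) = 
    (\<lambda>d. a *\<^sub>R differential A B u p v d + differential A B u p w d)"
proof
  fix d 
  obtain c where c: "c \<in> charts_at A p" using atlas_ex_chart[OF assms(1)] by blast
  show "differential A B u p (\<lambda>c. a *\<^sub>R v c + w c) d = 
      a *\<^sub>R differential A B u p v d + differential A B u p w d"
  proof (cases "d \<in> charts_at B (u p)")
    case True
    have "linear (frechet_derivative (snd d \<circ> u \<circ> chart_inv c) (at (snd c p)))"
      by (rule linear_frechet_derivative) (use assms(3) c True in \<open>simp add: mdiff_def\<close>)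
    then show ?thesis
      unfolding differential_apply[OF assms(1,2,3,4) c True] differential_apply[OF assms(1,2,3,5) c True]
        differential_apply[OF assms(1,2,3) tangent_combination[OF assms(1,4,5)] c True]
      by (simp add: linear_add linear_scale)
  qed (simp add: differential_def)
qed

lemma pullback_bilinear:
  assumes "smooth_atlas A" "smooth_atlas B" "mdiff A B u" "bilinear_tensor B h"
  shows "bilinear_tensor A (pullback A B u h)"
  unfolding bilinear_tensor_def
proof (intro allI ballI)
  fix p v w z and a :: real
  assume *: "v \<in> tangent_space A p" "w \<in> tangent_space A p" "z \<in> tangent_space A p"
  note d = differential_in_tangent_space[OF assms(1,2,3)]
  show "pullback A B u h p (\<lambda>c. a *\<^sub>R v c + w c) z = a * pullback A B u h p v z + pullback A B u h p w z \<and>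
      pullback A B u h p z (\<lambda>c. a *\<^sub>R v c + w c) = a * pullback A B u h p z v + pullback A B u h p z w"
    unfolding pullback_def differential_combination[OF assms(1,2,3) *(1,2)]
    using bilinear_tensorD[OF assms(4) d[OF *(1)] d[OF *(2)] d[OF *(3)]] by blast
qed

lemma pullback_symmetric:
  assumes "smooth_atlas A" "smooth_atlas B" "mdiff A B u" "symmetric_tensor B h"
  shows "symmetric_tensor A (pullback A B u h)"
  using assms(4) differential_in_tangent_space[OF assms(1,2,3)] 
  unfolding symmetric_tensor_def pullback_def by blast

lemma pullback_compose:
  assumes "smooth_atlas A" "smooth_atlas B" "smooth_atlas C" "mdiff A B u" "mdiff B C w" 
    "v \<in> tangent_space A p" "z \<in> tangent_space A p"
  shows "pullback A C (w \<circ> u) h p v z = pullback A B u (pullback B C w h) p v z"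
  by (simp add: pullback_def differential_compose[OF assms(1-6)] differential_compose[OF assms(1-5) assms(7)])

lemma bilinear_tensor_congruence:
  fixes S :: "real^'n^'n" and J :: "real^'m^'n"
  shows "(J *v v) \<bullet> (S *v (J *v w)) = v \<bullet> ((transpose J ** S ** J) *v w)"
  by (simp add: dot_lmul_matrix vector_transpose_matrix flip: matrix_vector_mul_assoc)
     (metis dot_lmul_matrix transpose_transpose vector_transpose_matrix matrix_vector_mul_assoc)

text \<open>The expression of a pullback in charts: congruence of the coefficient matrix by the Jacobian.\<close>

lemma pullback_coords:
  fixes A :: "('a::topological_space, real^'m) atlas" and B :: "('b::topological_space, real^'n) atlas"
  assumes "smooth_atlas A" "smooth_atlas B" "mdiff A B u" "bilinear_tensor B h"
    and c: "c \<in> charts_at A p" and d: "d \<in> charts_at B (u p)"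
    and v: "v \<in> tangent_space A p" and w: "w \<in> tangent_space A p"
  defines "J \<equiv> matrix (frechet_derivative (snd d \<circ> u \<circ> chart_inv c) (at (snd c p)))"
  shows "pullback A B u h p v w 
    = v c \<bullet> ((transpose J ** gram_matrix B h d (snd d (u p)) ** J) *v w c)"
proof -
  have J: "differential A B u p z d = J *v z c" if "z \<in> tangent_space A p" for z
  proof -
    have "linear (frechet_derivative (snd d \<circ> u \<circ> chart_inv c) (at (snd c p)))"
      by (rule linear_frechet_derivative) (use assms(3) c d in \<open>simp add: mdiff_def\<close>)
    then show ?thesis
      by (simp add: differential_apply[OF assms(1,2,3) that c d] J_def matrix_works)
  qed
  show ?thesis
    unfolding pullback_def bilinear_tensor_gram[OF assms(2,4) d 
        differential_in_tangent_space[OF assms(1,2,3) v] differential_in_tangent_space[OF assms(1,2,3) w]]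
      J[OF v] J[OF w]
    by (rule bilinear_tensor_congruence)
qed

lemma matrix_eq_bilinear:
  fixes S R :: "real^'m^'m"
  assumes "\<And>x y. x \<bullet> (S *v y) = x \<bullet> (R *v y)" shows "S = R"
proof -
  have "S *v y = R *v y" for y using assms vector_eq_ldot by blast
  then show ?thesis by (simp add: matrix_eq)
qed

lemma gram_matrix_unique:
  assumes A: "smooth_atlas A" and T: "bilinear_tensor A T" and c: "c \<in> charts_at A p"
    and "\<And>v w. v \<in> tangent_space A p \<Longrightarrow> w \<in> tangent_space A p \<Longrightarrow> T p v w = v c \<bullet> (S *v w c)"
  shows "gram_matrix A T c (snd c p) = S"
proof (rule matrix_eq_bilinear)
  fix x y
  have k: "coord_vec A c p x \<in> tangent_space A p" for x by (rule coord_vec_in_tangent_space[OF A c])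
  show "x \<bullet> (gram_matrix A T c (snd c p) *v y) = x \<bullet> (S *v y)"
    using bilinear_tensor_gram[OF A T c k k, of x y] assms(4)[OF k k, of x y]
    by (simp add: coord_vec_self[OF A c])
qed

lemma gram_matrix_pullback:
  fixes A :: "('a::topological_space, real^'m) atlas" and B :: "('b::topological_space, real^'n) atlas"
  assumes "smooth_atlas A" "smooth_atlas B" "mdiff A B u" "bilinear_tensor B h"
    and c: "c \<in> charts_at A p" and d: "d \<in> charts_at B (u p)"
  defines "J \<equiv> matrix (frechet_derivative (snd d \<circ> u \<circ> chart_inv c) (at (snd c p)))"
  shows "gram_matrix A (pullback A B u h) c (snd c p) 
    = transpose J ** gram_matrix B h d (snd d (u p)) ** J"
  unfolding J_def
  by (rule gram_matrix_unique[OF assms(1) pullback_bilinear[OF assms(1-4)] c])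
     (rule pullback_coords[OF assms(1-6)])

lemma C1_on_gram_matrix_metric:
  assumes "riemannian_metric A g" "c \<in> A"
  shows "C1_on (chart_image c) (gram_matrix A g c)"
proof (intro C1_on_vec)
  show "C1_on (chart_image c) (\<lambda>x. gram_matrix A g c x $ i $ j)" for i j
    unfolding gram_matrix_def vec_lambda_beta using assms
    by (intro smooth_on_imp_C1_on) (simp add: riemannian_metric_def)
qed

text \<open>The Jacobian of \<open>u\<close> is differentiable once more because \<open>u\<close> is smooth.\<close>

lemma C1_on_gram_matrix_pullback:
  fixes A :: "('a::topological_space, real^'m) atlas" and B :: "('b::topological_space, real^'n) atlas"
  assumes A: "smooth_atlas A" and B: "smooth_atlas B" and u: "smooth_map A B u" 
    and h: "riemannian_metric B h" and c: "c \<in> A"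
  shows "C1_on (chart_image c) (gram_matrix A (pullback A B u h) c)"
proof (rule C1_on_local)
  fix x assume x: "x \<in> chart_image c"
  obtain d where d: "d \<in> charts_at B (u (chart_inv c x))" using atlas_ex_chart[OF B] by blast
  let ?U = "chart_image c \<inter> chart_inv c -` (u -` fst d)" and ?u = "snd d \<circ> u \<circ> chart_inv c"
  let ?J = "\<lambda>x. matrix (frechet_derivative ?u (at x))"
  have dB: "d \<in> B" and xd: "u (chart_inv c x) \<in> fst d" using d by (auto simp: charts_at_def)
  have "open (u -` fst d)"
    using u open_chart_domain[OF B dB] by (auto simp: smooth_map_def intro: open_vimage)
  then have U: "open ?U" by (rule open_chart_image_restrict(1)[OF A c])
  have sm: "smooth_on ?U ?u"
    unfolding chart_image_restrict[OF A c, of "u -` fst d", symmetric]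
    using u c dB unfolding smooth_map_def by blast
  have CJ: "C1_on ?U ?J"
    by (intro C1_on_vec) (auto simp: matrix_def intro!: C1_on_nth smooth_on_imp_C1_on_derivative[OF sm])
  have "?u ` ?U \<subseteq> chart_image d" using chart_in(2)[OF B dB] by auto
  then have CH: "C1_on ?U (\<lambda>x. gram_matrix B h d (?u x))"
    by (rule C1_on_compose[OF C1_on_gram_matrix_metric[OF h dB] smooth_on_imp_C1_on[OF sm]])
  have "C1_on ?U (\<lambda>x. transpose (?J x) ** gram_matrix B h d (?u x) ** ?J x)"
    by (intro C1_on_matrix_mult C1_on_bounded_linear[OF bounded_linear_transpose] CJ CH)
  moreover have "gram_matrix A (pullback A B u h) c y = transpose (?J y) ** gram_matrix B h d (?u y) ** ?J y"
    if y: "y \<in> ?U" for y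
  proof -
    have yc: "y \<in> chart_image c" "d \<in> charts_at B (u (chart_inv c y))" using y dB by (auto simp: charts_at_def)
    show ?thesis
      using gram_matrix_pullback[OF A B smooth_map_imp_mdiff[OF u] riemannian_metric_bilinear[OF B h]
        chart_inv_charts_at[OF A c yc(1)] yc(2)] chart_inv_in(2)[OF A c yc(1)]
      by simp
  qed
  ultimately show "\<exists>U g. open U \<and> x \<in> U \<and> C1_on U g \<and> (\<forall>y\<in>U. gram_matrix A (pullback A B u h) c y = g y)"
    using U x xd by blast
qed


section \<open>The energy density and the stress-energy tensor in an orthonormal frame\<close>

text \<open>Both depend on \<open>u\<close> only through the pulled back metric. In an orthonormal frame the double sum in
  \<open>d3\<close> is a product of three copies of the matrix \<open>N\<close> of that metric.\<close>

lemma h_d3: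
  fixes A :: "('a::topological_space, real^'m) atlas" and B :: "('b::topological_space, real^'n) atlas"
  assumes A: "smooth_atlas A" and g: "riemannian_metric A g" and B: "smooth_atlas B" 
    and h: "riemannian_metric B h" and u: "mdiff A B u"
  defines "N \<equiv> tensor_matrix A g (pullback A B u h)"
  shows "h (u p) (d3 A g B h u p (frame A g p i)) (differential A B u p (frame A g p l)) 
    = (N p ** N p ** N p) $ i $ l"
proof -
  let ?e = "frame A g p" and ?du = "differential A B u p"
  have du: "?du (?e i) \<in> tangent_space B (u p)" for i
    by (rule differential_in_tangent_space[OF A B u frame_orthonormal(1)[OF A g]])
  have N: "h (u p) (?du (?e i)) (?du (?e j)) = N p $ i $ j" for i j
    by (simp add: N_def tensor_matrix_def pullback_def)
  have "d3 A g B h u p (?e i) = (\<lambda>c. \<Sum>k\<in>UNIV. (\<Sum>j\<in>UNIV. N p $ i $ j * N p $ j $ k) *\<^sub>R ?du (?e k) c)"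
    unfolding d3_def Let_def N by (subst sum.swap) (simp add: scaleR_left.sum)
  then have "h (u p) (d3 A g B h u p (?e i)) (?du (?e l)) 
      = (\<Sum>k\<in>UNIV. (\<Sum>j\<in>UNIV. N p $ i $ j * N p $ j $ k) * h (u p) (?du (?e k)) (?du (?e l)))"
    by (simp add: bilinear_tensor_sum_left[OF B riemannian_metric_bilinear[OF B h] du finite du])
  then show ?thesis by (simp add: N matrix_matrix_mult_def)
qed

lemma d3_norm2_eq:
  fixes A :: "('a::topological_space, real^'m) atlas" and B :: "('b::topological_space, real^'n) atlas"
  assumes "smooth_atlas A" "riemannian_metric A g" "smooth_atlas B" "riemannian_metric B h" "mdiff A B u"
  defines "N \<equiv> tensor_matrix A g (pullback A B u h)"
  shows "d3_norm2 A g B h u p = trace (N p ** N p ** N p)"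
  unfolding d3_norm2_def Let_def N_def h_d3[OF assms(1-5)] trace_def ..

lemma tensor_inner_stress_energy:
  fixes A :: "('a::topological_space, real^'m) atlas" and B :: "('b::topological_space, real^'n) atlas"
  assumes "smooth_atlas A" "riemannian_metric A g" "smooth_atlas B" "riemannian_metric B h" "mdiff A B u"
  fixes p
  defines "N \<equiv> tensor_matrix A g (pullback A B u h) p"
  shows "tensor_inner A g (stress_energy A g B h u) L p 
    = trace (N ** N ** N) / 6 * trace (tensor_matrix A g L p) 
      - trace (N ** N ** N ** transpose (tensor_matrix A g L p))"
proof -
  let ?e = "frame A g p"
  have S: "stress_energy A g B h u p (?e i) (?e j) 
      = trace (N ** N ** N) / 6 * (if i = j then 1 else 0) - (N ** N ** N) $ i $ j" for i j
    unfolding stress_energy_def h_d3[OF assms(1-5)] d3_norm2_eq[OF assms(1-5)] N_def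
      frame_orthonormal(2)[OF assms(1,2)] ..
  have "tensor_inner A g (stress_energy A g B h u) L p =
    (\<Sum>i\<in>UNIV. \<Sum>j\<in>UNIV. (if i = j then trace (N ** N ** N) / 6 * L p (?e i) (?e j) else 0)
       - (N ** N ** N) $ i $ j * L p (?e i) (?e j))"
    unfolding tensor_inner_def Let_def S by (intro sum.cong refl) (simp add: left_diff_distrib)
  also have "\<dots> = trace (N ** N ** N) / 6 * (\<Sum>i\<in>UNIV. L p (?e i) (?e i))
      - (\<Sum>i\<in>UNIV. \<Sum>j\<in>UNIV. (N ** N ** N) $ i $ j * L p (?e i) (?e j))"
    by (simp add: sum_subtractf sum_distrib_left)
  finally show ?thesis
    by (simp add: trace_def tensor_matrix_def transpose_def matrix_matrix_mult_def[of "N ** N ** N"])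
qed


section \<open>Change of variables over an arbitrary finite index type\<close>

text \<open>The theorem on change of variables is stated for well-ordered index types. Every finite type has a copy
  that carries a well-order, and renaming coordinates preserves volumes and determinants.\<close>

typedef 'a wo = "UNIV :: 'a set" morphisms of_wo to_wo ..

lemma bij_of_wo: "bij of_wo"
  by (metis UNIV_I bijI' of_wo_inject to_wo_inverse)

instance wo :: (finite) finite
proof
  show "finite (UNIV :: 'a wo set)" 
    by (rule finite_imageD[of of_wo]) (use bij_of_wo in \<open>auto simp: bij_def\<close>)
qed

definition wo_index :: "'a::finite \<Rightarrow> nat" where "wo_index = (SOME f. inj f)"

lemma inj_wo_index: "inj (wo_index :: 'a::finite \<Rightarrow> nat)"
  unfolding wo_index_def using finite_imp_inj_to_nat_seg[OF finite[of "UNIV :: 'a set"]]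
  by (metis someI)

instantiation wo :: (finite) wellorder
begin

definition "x \<le> y \<longleftrightarrow> wo_index (of_wo x) \<le> wo_index (of_wo y)"
definition "x < y \<longleftrightarrow> wo_index (of_wo x) < wo_index (of_wo y)"

instance
proof
  fix x y z :: "'a wo" and P :: "'a wo \<Rightarrow> bool"
  show "x = y" if "x \<le> y" "y \<le> x"
  proof -
    have "of_wo x = of_wo y"
      by (rule injD[OF inj_wo_index]) (use that in \<open>simp add: less_eq_wo_def\<close>)
    then show ?thesis by (simp only: of_wo_inject)
  qed
  show "P x" if step: "\<And>x. (\<And>y. y < x \<Longrightarrow> P y) \<Longrightarrow> P x"
  proof (induction "wo_index (of_wo x)" arbitrary: x rule: less_induct)
    case less
    show ?case by (rule step, rule less) (simp add: less_wo_def)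
  qed
  show "(x < y) = (x \<le> y \<and> \<not> y \<le> x)" "x \<le> x" "x \<le> y \<or> y \<le> x"
    unfolding less_eq_wo_def less_wo_def by linarith+
  show "x \<le> y \<Longrightarrow> y \<le> z \<Longrightarrow> x \<le> z"
    unfolding less_eq_wo_def by linarith
qed

end

definition to_wo_vec :: "real^'m \<Rightarrow> real^('m wo)" where "to_wo_vec v = (\<chi> i. v $ of_wo i)"
definition of_wo_vec :: "real^('m wo) \<Rightarrow> real^'m" where "of_wo_vec v = (\<chi> i. v $ to_wo i)"

lemma wo_vec_inverse [simp]: "of_wo_vec (to_wo_vec v) = v" "to_wo_vec (of_wo_vec w) = w"
  by (simp_all add: to_wo_vec_def of_wo_vec_def vec_eq_iff of_wo_inverse to_wo_inverse)

lemma linear_to_wo_vec: "linear to_wo_vec" and linear_of_wo_vec: "linear of_wo_vec"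
  by (auto intro!: linearI simp: to_wo_vec_def of_wo_vec_def vec_eq_iff)

lemma bounded_linear_to_wo_vec: "bounded_linear to_wo_vec" 
  and bounded_linear_of_wo_vec: "bounded_linear of_wo_vec"
  using linear_to_wo_vec linear_of_wo_vec by (simp_all add: linear_conv_bounded_linear)

lemma measurable_wo_vec [measurable]: 
  "to_wo_vec \<in> borel_measurable borel" "of_wo_vec \<in> borel_measurable borel"
  by (auto intro!: borel_measurable_continuous_onI linear_continuous_on
      bounded_linear_to_wo_vec bounded_linear_of_wo_vec)

lemma distr_to_wo_vec: "distr lborel borel to_wo_vec = (lborel :: (real^('m::finite wo)) measure)"
proof (rule sym, rule lborel_eqI)
  fix l u :: "real^('m wo)" assume lu: "\<And>b. b \<in> Basis \<Longrightarrow> l \<bullet> b \<le> u \<bullet> b"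
  have *: "l $ i \<le> u $ i" for i using lu[of "axis i 1"] by (simp add: inner_axis)
  have 1: "of_wo_vec l \<bullet> b \<le> of_wo_vec u \<bullet> b" if "b \<in> Basis" for b
    using that * by (auto simp: Basis_vec_def inner_axis of_wo_vec_def)
  have "to_wo_vec -` box l u = box (of_wo_vec l) (of_wo_vec u)"
    by (auto simp: mem_box_cart to_wo_vec_def of_wo_vec_def)
       (metis of_wo_inverse to_wo_inverse UNIV_I)+
  then have "emeasure (distr lborel borel to_wo_vec) (box l u) = emeasure lborel (box (of_wo_vec l) (of_wo_vec u))"
    by (simp add: emeasure_distr)
  also have "\<dots> = ennreal (\<Prod>b\<in>Basis. (of_wo_vec u - of_wo_vec l) \<bullet> b)"
    using emeasure_lborel_box[OF 1] by blast
  also have "(\<Prod>b\<in>Basis. (of_wo_vec u - of_wo_vec l) \<bullet> b) = (\<Prod>i\<in>UNIV. u $ to_wo i - l $ to_wo i)"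
    by (simp add: Basis_vec_def UNION_singleton_eq_range prod.reindex inj_on_def axis_eq_axis inner_axis of_wo_vec_def)
  also have "\<dots> = (\<Prod>i\<in>UNIV. u $ i - l $ i)"
    by (rule prod.reindex_bij_betw[of to_wo UNIV UNIV "\<lambda>i. u $ i - l $ i"])
       (metis UNIV_I bijI' of_wo_inverse to_wo_inject)
  also have "\<dots> = (\<Prod>b\<in>Basis. (u - l) \<bullet> b)"
    by (simp add: Basis_vec_def UNION_singleton_eq_range prod.reindex inj_on_def axis_eq_axis inner_axis)
  finally show "emeasure (distr lborel borel to_wo_vec) (box l u) = ennreal (\<Prod>b\<in>Basis. (u - l) \<bullet> b)" .
qed simp

text \<open>Renaming the indices conjugates the permutations in the Leibniz formula and keeps their signs.\<close>

lemma det_reindex: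
  fixes M :: "real^'m^'m" and r :: "'k::finite \<Rightarrow> 'm::finite"
  assumes r: "bij r"
  shows "det (\<chi> i j. M $ r i $ r j) = det M"
proof -
  let ?m = "map_permutation UNIV r"
  have inj: "inj r" and surj: "range r = UNIV" using r by (auto simp: bij_def)
  have app: "?m p (r i) = r (p i)" for p i by (rule map_permutation_apply) (use inj in auto)
  have perm: "?m p permutes UNIV" if "p permutes UNIV" for p
    using map_permutation_permutes[of r UNIV UNIV p] that r by simp
  have bij: "bij_betw ?m {p. p permutes (UNIV :: 'k set)} {p. p permutes (UNIV :: 'm set)}"
  proof (rule bij_betw_imageI)
    show "inj_on ?m {p. p permutes UNIV}"
    proof (rule inj_onI)
      fix p q :: "'k \<Rightarrow> 'k" assume "?m p = ?m q"
      then have "r (p i) = r (q i)" for i by (metis app)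
      then show "p = q" using inj by (auto simp: fun_eq_iff inj_eq)
    qed
    show "?m ` {p. p permutes UNIV} = {p. p permutes UNIV}"
    proof (intro equalityI subsetI)
      fix q :: "'m \<Rightarrow> 'm" assume "q \<in> {p. p permutes UNIV}"
      then have q: "bij q" by (simp add: permutes_bij)
      have "bij (inv r \<circ> q \<circ> r)" using r q bij_imp_bij_inv by (auto intro!: bij_comp)
      then have "inv r \<circ> q \<circ> r permutes UNIV" by (intro bij_imp_permutes) auto
      moreover have "?m (inv r \<circ> q \<circ> r) = q"
      proof
        fix y obtain i where "y = r i" using surj by blast
        then show "?m (inv r \<circ> q \<circ> r) y = q y" by (simp add: app surj_f_inv_f[OF surj])
      qed
      ultimately show "q \<in> ?m ` {p. p permutes UNIV}" by (metis imageI mem_Collect_eq)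
    qed (use perm in auto)
  qed
  have "det M = (\<Sum>p\<in>{p. p permutes (UNIV :: 'k set)}. of_int (sign (?m p)) * (\<Prod>i\<in>UNIV. M $ i $ ?m p i))"
    unfolding det_def by (rule sum.reindex_bij_betw[OF bij, symmetric])
  also have "\<dots> = (\<Sum>p\<in>{p. p permutes (UNIV :: 'k set)}. of_int (sign p) * (\<Prod>i\<in>UNIV. M $ r i $ r (p i)))"
  proof (rule sum.cong, rule refl)
    fix p :: "'k \<Rightarrow> 'k" assume "p \<in> {p. p permutes UNIV}"
    then have "sign (?m p) = sign p" using inj by (intro sign_map_permutation) auto
    moreover have "(\<Prod>i\<in>UNIV. M $ i $ ?m p i) = (\<Prod>i\<in>UNIV. M $ r i $ ?m p (r i))"
      by (rule prod.reindex_bij_betw[OF r, symmetric])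
    ultimately show "of_int (sign (?m p)) * (\<Prod>i\<in>UNIV. M $ i $ ?m p i) 
        = of_int (sign p) * (\<Prod>i\<in>UNIV. M $ r i $ r (p i))" by (simp add: app)
  qed
  finally show ?thesis by (simp add: det_def)
qed

text \<open>The image has finite volume exactly when the Jacobian is integrable, so the infinite values agree as well.\<close>

lemma emeasure_differentiable_image_wellorder:
  fixes g :: "real^'n::{finite,wellorder} \<Rightarrow> real^'n::_"
  assumes S: "S \<in> sets borel" and gS: "g ` S \<in> sets borel"
    and der: "\<And>x. x \<in> S \<Longrightarrow> (g has_derivative g' x) (at x)" and inj: "inj_on g S"
    and meas: "(\<lambda>x. indicator S x * \<bar>det (matrix (g' x))\<bar>) \<in> borel_measurable borel"
  shows "emeasure lborel (g ` S) = (\<integral>\<^sup>+x. ennreal (indicator S x * \<bar>det (matrix (g' x))\<bar>) \<partial>lborel)"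
proof -
  let ?f = "\<lambda>x. indicator S x * \<bar>det (matrix (g' x))\<bar>"
  have key: "(g ` S \<in> lmeasurable \<and> measure lebesgue (g ` S) = m) 
      \<longleftrightarrow> ((\<lambda>x. \<bar>det (matrix (g' x))\<bar>) has_integral m) S" for m
    by (rule has_measure_differentiable_image) 
      (use S inj in \<open>auto intro: has_derivative_at_withinI[OF der] sets_completionI_sets\<close>)
  have hi: "((\<lambda>x. \<bar>det (matrix (g' x))\<bar>) has_integral m) S \<longleftrightarrow> (?f has_integral m) UNIV" for m
    by (subst has_integral_restrict_UNIV[symmetric]) (rule has_integral_cong, auto simp: indicator_def)
  have lm: "g ` S \<in> lmeasurable \<and> measure lebesgue (g ` S) = m \<longleftrightarrow> emeasure lborel (g ` S) = ennreal m"
    if "m \<ge> 0" for m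
  proof -
    have e: "emeasure lebesgue (g ` S) = emeasure lborel (g ` S)" using gS by simp
    have s: "g ` S \<in> sets lebesgue" using gS by (simp add: sets_completionI_sets)
    show ?thesis
    proof
      assume a: "g ` S \<in> lmeasurable \<and> measure lebesgue (g ` S) = m"
      then have "emeasure lebesgue (g ` S) = ennreal (measure lebesgue (g ` S))"
        by (intro emeasure_eq_ennreal_measure) (auto simp: fmeasurable_def top.not_eq_extremum)
      then show "emeasure lborel (g ` S) = ennreal m" using a e by simp
    next
      assume a: "emeasure lborel (g ` S) = ennreal m"
      then have a': "emeasure lebesgue (g ` S) = ennreal m" using e by simp
      have "measure lebesgue (g ` S) = m" by (rule measure_eq_emeasure_eq_ennreal[OF that a'])
      moreover have "g ` S \<in> lmeasurable"
        by (rule fmeasurableI[OF s]) (simp add: a')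
      ultimately show "g ` S \<in> lmeasurable \<and> measure lebesgue (g ` S) = m" by blast
    qed
  qed
  show ?thesis
  proof (cases "(\<integral>\<^sup>+x. ennreal (?f x) \<partial>lborel) = \<infinity>")
    case False
    then obtain m where m: "(\<integral>\<^sup>+x. ennreal (?f x) \<partial>lborel) = ennreal m" "m \<ge> 0"
      by (cases "\<integral>\<^sup>+x. ennreal (?f x) \<partial>lborel") auto
    have "(?f has_integral m) UNIV"
      by (rule nn_integral_has_integral) (use meas m in auto)
    then have "emeasure lborel (g ` S) = ennreal m" using key hi lm[OF m(2)] by blast
    then show ?thesis using m by simp
  next
    case True
    have "emeasure lborel (g ` S) = \<infinity>"
    proof (rule ccontr)
      assume "emeasure lborel (g ` S) \<noteq> \<infinity>"
      then obtain m where m: "emeasure lborel (g ` S) = ennreal m" "m \<ge> 0"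
        by (cases "emeasure lborel (g ` S)") auto
      then have "(?f has_integral m) UNIV" using key hi lm[OF m(2)] by blast
      then have "(\<integral>\<^sup>+x. ennreal (?f x) \<partial>lborel) = ennreal m"
        by (intro nn_integral_has_integral_lborel) (use meas in auto)
      then show False using True by simp
    qed
    then show ?thesis using True by simp
  qed
qed

lemma emeasure_differentiable_image:
  fixes g :: "real^'m \<Rightarrow> real^'m"
  assumes S: "S \<in> sets borel" and gS: "g ` S \<in> sets borel"
    and der: "\<And>x. x \<in> S \<Longrightarrow> (g has_derivative g' x) (at x)" and inj: "inj_on g S"
    and meas: "(\<lambda>x. indicator S x * \<bar>det (matrix (g' x))\<bar>) \<in> borel_measurable borel"
  shows "emeasure lborel (g ` S) = (\<integral>\<^sup>+x. ennreal (indicator S x * \<bar>det (matrix (g' x))\<bar>) \<partial>lborel)"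
proof -
  let ?L = "to_wo_vec :: real^'m \<Rightarrow> _" and ?M = "of_wo_vec :: _ \<Rightarrow> real^'m"
  let ?g = "\<lambda>y. ?L (g (?M y))" and ?g' = "\<lambda>y v. ?L (g' (?M y) (?M v))"
  have im: "?L ` T = ?M -` T" for T by (auto simp: image_iff) (metis wo_vec_inverse(2))
  have Mb: "?M -` T \<in> sets borel" if "T \<in> sets borel" for T
    using measurable_sets[OF measurable_wo_vec(2) that] by simp
  have "emeasure lborel (?L ` T) = emeasure lborel T" if T: "T \<in> sets borel" for T
  proof -
    have "emeasure lborel (?L ` T) = emeasure (distr lborel borel ?L) (?L ` T)" by (simp only: distr_to_wo_vec)
    also have "\<dots> = emeasure lborel (?L -` ?L ` T)"
      using Mb[OF T] by (subst emeasure_distr) (auto simp: im)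
    also have "?L -` ?L ` T = T" by (auto simp: im)
    finally show ?thesis .
  qed
  note eL = this
  have det: "det (matrix (?g' y)) = det (matrix (g' (?M y)))" if "?M y \<in> S" for y
  proof -
    have ax: "?M (axis j 1) = axis (of_wo j) 1" for j
      by (auto simp: of_wo_vec_def axis_def vec_eq_iff to_wo_inverse of_wo_inverse)
    have "matrix (?g' y) = (\<chi> i j. matrix (g' (?M y)) $ of_wo i $ of_wo j)"
      by (simp add: matrix_def to_wo_vec_def vec_eq_iff ax)
    then show ?thesis using det_reindex[OF bij_of_wo] by metis
  qed
  have ind: "indicator (?M -` S) y * \<bar>det (matrix (?g' y))\<bar> 
      = (\<lambda>x. indicator S x * \<bar>det (matrix (g' x))\<bar>) (?M y)" for y
    using det[of y] by (auto simp: indicator_def)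
  have imm: "?g ` (?M -` S) = ?L ` g ` S"
  proof -
    have "?M ` (?M -` S) = S" unfolding im[symmetric] by (simp add: image_image)
    moreover have "?g ` (?M -` S) = ?L ` g ` (?M ` (?M -` S))" by (simp only: image_image)
    ultimately show ?thesis by simp
  qed
  have "emeasure lborel (?g ` (?M -` S)) 
      = (\<integral>\<^sup>+y. ennreal (indicator (?M -` S) y * \<bar>det (matrix (?g' y))\<bar>) \<partial>lborel)"
  proof (rule emeasure_differentiable_image_wellorder)
    show "?M -` S \<in> sets borel" by (rule Mb[OF S])
    show "?g ` (?M -` S) \<in> sets borel" unfolding imm im by (rule Mb[OF gS])
    show "(?g has_derivative ?g' y) (at y)" if "y \<in> ?M -` S" for y
      by (rule bounded_linear.has_derivative[OF bounded_linear_to_wo_vec 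
          has_derivative_compose[OF bounded_linear_imp_has_derivative[OF bounded_linear_of_wo_vec] der]])
        (use that in auto)
    show "inj_on ?g (?M -` S)"
      using inj by (auto simp: inj_on_def) (metis wo_vec_inverse)
    show "(\<lambda>y. indicator (?M -` S) y * \<bar>det (matrix (?g' y))\<bar>) \<in> borel_measurable borel"
      unfolding ind using meas by measurable
  qed
  also have "\<dots> = (\<integral>\<^sup>+y. ennreal ((\<lambda>x. indicator S x * \<bar>det (matrix (g' x))\<bar>) (?M y)) \<partial>(distr lborel borel ?L))"
    unfolding ind by (simp only: distr_to_wo_vec)
  also have "\<dots> = (\<integral>\<^sup>+x. ennreal (indicator S x * \<bar>det (matrix (g' x))\<bar>) \<partial>lborel)"
    using meas by (subst nn_integral_distr) auto
  finally show ?thesis unfolding imm using eL[OF gS] by simp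
qed

text \<open>Equality of measures upgrades the formula for volumes of images to one for integrals.\<close>

lemma nn_integral_change_of_variables:
  fixes g :: "real^'m \<Rightarrow> real^'m" and f :: "real^'m \<Rightarrow> ennreal"
  assumes S: "S \<in> sets borel" and gS: "g ` S \<in> sets borel"
    and der: "\<And>x. x \<in> S \<Longrightarrow> (g has_derivative g' x) (at x)" and inj: "inj_on g S"
    and meas: "(\<lambda>x. indicator S x * \<bar>det (matrix (g' x))\<bar>) \<in> borel_measurable borel"
    and f: "f \<in> borel_measurable borel"
  shows "(\<integral>\<^sup>+x\<in>g ` S. f x \<partial>lborel) 
    = (\<integral>\<^sup>+x. ennreal (indicator S x * \<bar>det (matrix (g' x))\<bar>) * f (g x) \<partial>lborel)"
proof -
  let ?w = "\<lambda>x. indicator S x * \<bar>det (matrix (g' x))\<bar>"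
  let ?g = "\<lambda>x. if x \<in> S then g x else 0"
  have "continuous_on S g"
    by (meson continuous_at_imp_continuous_on der has_derivative_continuous)
  then have "?g \<in> borel_measurable borel"
    using S by (intro borel_measurable_continuous_on_if) (auto intro!: continuous_intros)
  then have g: "?g \<in> measurable lborel borel" by simp
  have w: "(\<lambda>x. ennreal (?w x)) \<in> borel_measurable lborel" using meas by simp
  have "distr (density lborel (\<lambda>x. ennreal (?w x))) borel ?g = density lborel (indicator (g ` S))"
  proof (rule measure_eqI)
    fix W assume "W \<in> sets (distr (density lborel (\<lambda>x. ennreal (?w x))) borel ?g)"
    then have W: "W \<in> sets borel" by simp
    have gW: "?g -` W \<in> sets borel" using measurable_sets[OF g W] by simp
    have T: "S \<inter> ?g -` W \<in> sets borel" using S gW by auto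
    have im: "g ` (S \<inter> ?g -` W) = g ` S \<inter> W" by auto
    have "emeasure (distr (density lborel (\<lambda>x. ennreal (?w x))) borel ?g) W 
      = emeasure (density lborel (\<lambda>x. ennreal (?w x))) (?g -` W)"
      using g W by (subst emeasure_distr) auto
    also have "\<dots> = (\<integral>\<^sup>+x. ennreal (?w x) * indicator (?g -` W) x \<partial>lborel)"
      using w gW by (simp add: emeasure_density)
    also have "\<dots> = (\<integral>\<^sup>+x. ennreal (indicator (S \<inter> ?g -` W) x * \<bar>det (matrix (g' x))\<bar>) \<partial>lborel)"
      by (intro nn_integral_cong) (auto simp: indicator_def)
    also have "\<dots> = emeasure lborel (g ` (S \<inter> ?g -` W))"
    proof (rule emeasure_differentiable_image[OF T, symmetric])
      show "g ` (S \<inter> ?g -` W) \<in> sets borel" unfolding im using gS W by auto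
      have "(\<lambda>x. indicator (?g -` W) x * ?w x) \<in> borel_measurable borel"
        using meas gW by simp
      moreover have "(\<lambda>x. indicator (?g -` W) x * ?w x) 
          = (\<lambda>x. indicator (S \<inter> ?g -` W) x * \<bar>det (matrix (g' x))\<bar>)"
        by (auto simp: indicator_def)
      ultimately show "(\<lambda>x. indicator (S \<inter> ?g -` W) x * \<bar>det (matrix (g' x))\<bar>) \<in> borel_measurable borel"
        by simp
    qed (use inj der in \<open>auto intro: inj_on_subset\<close>)
    also have "\<dots> = emeasure (density lborel (indicator (g ` S))) W"
      unfolding im using gS W by (simp add: emeasure_density nn_integral_indicator flip: indicator_inter_arith)
    finally show "emeasure (distr (density lborel (\<lambda>x. ennreal (?w x))) borel ?g) W = 
      emeasure (density lborel (indicator (g ` S))) W" .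
  qed simp
  note eq = this
  have "(\<integral>\<^sup>+x\<in>g ` S. f x \<partial>lborel) = (\<integral>\<^sup>+x. f x \<partial>(density lborel (indicator (g ` S))))"
    using gS f by (subst nn_integral_density) (auto simp: mult.commute)
  also have "\<dots> = (\<integral>\<^sup>+x. f (?g x) \<partial>(density lborel (\<lambda>x. ennreal (?w x))))"
    unfolding eq[symmetric] using f g by (subst nn_integral_distr) auto
  also have "\<dots> = (\<integral>\<^sup>+x. ennreal (?w x) * f (?g x) \<partial>lborel)"
    using w f g by (subst nn_integral_density) auto
  also have "\<dots> = (\<integral>\<^sup>+x. ennreal (?w x) * f (g x) \<partial>lborel)"
    by (intro nn_integral_cong) (auto simp: indicator_def)
  finally show ?thesis .
qed


section \<open>The Riemannian volume measure\<close>

definition vol_density ::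
  "('a, real^'m) atlas \<Rightarrow> ('a, real^'m::finite) tensor2 \<Rightarrow> ('a, real^'m) chart \<Rightarrow> real^'m \<Rightarrow> real" where
  "vol_density A g c x = sqrt (det (gram_matrix A g c x))"

text \<open>Lebesgue measure weighted by the density of the volume in the coordinates of one chart.\<close>

definition chart_measure ::
  "('a, real^'m) atlas \<Rightarrow> ('a, real^'m::finite) tensor2 \<Rightarrow> ('a, real^'m) chart \<Rightarrow> (real^'m) measure" where
  "chart_measure A g c = density lborel (\<lambda>x. ennreal (indicator (chart_image c) x * vol_density A g c x))"

definition chart_volume ::
  "('a, real^'m) atlas \<Rightarrow> ('a, real^'m::finite) tensor2 \<Rightarrow> ('a, real^'m) chart \<Rightarrow> 'a set \<Rightarrow> ennreal" where
  "chart_volume A g c S = (\<integral>\<^sup>+x\<in>snd c ` S. ennreal (vol_density A g c x) \<partial>lborel)"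

lemma gram_matrix_at:
  fixes A :: "('a::topological_space, real^'m) atlas"
  assumes A: "smooth_atlas A" and g: "riemannian_metric A g" and c: "c \<in> A" and x: "x \<in> chart_image c"
  shows invertible_gram_matrix: "invertible (gram_matrix A g c x)"
    and det_gram_matrix_pos: "det (gram_matrix A g c x) > 0" 
    and vol_density_pos: "vol_density A g c x > 0"
  using frame_matrix_gram(3,4)[OF A g chart_inv_charts_at[OF A c x]] chart_inv_in(2)[OF A c x]
  by (auto simp: vol_density_def)

lemma C1_on_vol_density:
  fixes A :: "('a::topological_space, real^'m) atlas"
  assumes A: "smooth_atlas A" and g: "riemannian_metric A g" and c: "c \<in> A"
  shows "C1_on (chart_image c) (vol_density A g c)"
  unfolding vol_density_def
  by (intro C1_on_sqrt C1_on_det C1_on_gram_matrix_metric[OF g c] det_gram_matrix_pos[OF A g c])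

lemma borel_measurable_indicator_mult_continuous:
  fixes f :: "'a::topological_space \<Rightarrow> real"
  assumes "S \<in> sets borel" "continuous_on S f"
  shows "(\<lambda>x. indicator S x * f x) \<in> borel_measurable borel"
  using borel_measurable_continuous_on_indicator[OF assms] by simp

lemma borel_measurable_vol_density:
  fixes A :: "('a::topological_space, real^'m) atlas"
  assumes A: "smooth_atlas A" and g: "riemannian_metric A g" and c: "c \<in> A"
  shows "(\<lambda>x. indicator (chart_image c) x * vol_density A g c x) \<in> borel_measurable borel"
  using open_chart_image[OF A c] C1_on_imp_continuous_on[OF C1_on_vol_density[OF A g c]]
  by (intro borel_measurable_indicator_mult_continuous) auto

lemma chart_image_borel:
  assumes A: "smooth_atlas A" and c: "c \<in> A" and S: "S \<in> sets borel" "S \<subseteq> fst c"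
  shows "snd c ` S \<in> sets borel"
proof -
  let ?f = "\<lambda>x. if x \<in> chart_image c then chart_inv c x else undefined"
  have "continuous_on (chart_image c) (chart_inv c)" 
    using chart_homeomorphism[OF A c] by (simp add: homeomorphism_def)
  then have f: "?f \<in> borel_measurable borel"
    using open_chart_image[OF A c] by (intro borel_measurable_continuous_on_if) auto
  have "snd c ` S = chart_image c \<inter> ?f -` S"
    using chart_image_restrict[OF A c, of S] S(2) by (auto simp: Int_absorb1)
  then show ?thesis
    using measurable_sets[OF f S(1)] open_chart_image[OF A c] by auto
qed

lemma chart_volume_eq:
  fixes A :: "('a::topological_space, real^'m) atlas"
  assumes A: "smooth_atlas A" and g: "riemannian_metric A g" and c: "c \<in> A" 
    and S: "S \<in> sets borel" "S \<subseteq> fst c"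
  shows "chart_volume A g c S = emeasure (chart_measure A g c) (snd c ` S)"
proof -
  have sub: "snd c ` S \<subseteq> chart_image c" using S by (auto simp: chart_image_def)
  have "emeasure (chart_measure A g c) (snd c ` S) 
    = (\<integral>\<^sup>+x. ennreal (indicator (chart_image c) x * vol_density A g c x) * indicator (snd c ` S) x \<partial>lborel)"
    unfolding chart_measure_def
    using borel_measurable_vol_density[OF A g c] chart_image_borel[OF A c S]
    by (subst emeasure_density) auto
  also have "\<dots> = chart_volume A g c S"
    unfolding chart_volume_def
    by (intro nn_integral_cong) (use sub in \<open>auto simp: indicator_def\<close>)
  finally show ?thesis by simp
qed

lemma chart_volume_UN:
  fixes A :: "('a::topological_space, real^'m) atlas"
  assumes A: "smooth_atlas A" and g: "riemannian_metric A g" and c: "c \<in> A" 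
    and S: "\<And>n::nat. S n \<in> sets borel" "\<And>n. S n \<subseteq> fst c" "disjoint_family S"
  shows "chart_volume A g c (\<Union>n. S n) = (\<Sum>n. chart_volume A g c (S n))"
proof -
  have inj: "inj_on (snd c) (fst c)" 
    using chart_in(1)[OF A c] by (metis inj_on_def)
  have "disjoint_family (\<lambda>n. snd c ` S n)"
    unfolding disjoint_family_on_def
  proof (intro ballI impI)
    fix m n :: nat assume "m \<noteq> n"
    then show "snd c ` S m \<inter> snd c ` S n = {}"
      using S(3) by (subst inj_on_image_Int[OF inj S(2,2), symmetric]) (simp add: disjoint_family_on_def)
  qed
  then have "(\<Sum>n. emeasure (chart_measure A g c) (snd c ` S n)) 
      = emeasure (chart_measure A g c) (\<Union>n. snd c ` S n)"
    by (intro suminf_emeasure) (auto simp: chart_measure_def chart_image_borel[OF A c S(1,2)])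
  then show ?thesis
    using S by (simp add: chart_volume_eq[OF A g c] image_UN UN_least)
qed

text \<open>The transformation rule of the Gram matrix is exactly what makes the densities of two charts
  correspond under change of variables.\<close>

lemma chart_volume_chart_change:
  fixes A :: "('a::topological_space, real^'m) atlas"
  assumes A: "smooth_atlas A" and g: "riemannian_metric A g" and c: "c \<in> A" and d: "d \<in> A"
    and S: "S \<in> sets borel" "S \<subseteq> fst c" "S \<subseteq> fst d"
  shows "chart_volume A g c S = chart_volume A g d S"
proof -
  let ?t = "transition c d" and ?S = "snd c ` S"
  let ?J = "\<lambda>x. matrix (frechet_derivative ?t (at x))"
  have charts: "c \<in> charts_at A p" "d \<in> charts_at A p" if "p \<in> S" for p
    using c d S that by (auto simp: charts_at_def)
  have t: "?t (snd c p) = snd d p" if "p \<in> S" for p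
    using chart_in(1)[OF A c] S that by (auto simp: transition_def)
  have tS: "?t ` ?S = snd d ` S" using t by (force simp: image_image)
  have der: "(?t has_derivative frechet_derivative ?t (at x)) (at x)" if "x \<in> ?S" for x
    using transition_differentiable[OF A charts] that by (auto simp: frechet_derivative_works)
  have inj: "inj_on ?t ?S"
  proof (rule inj_onI)
    fix x y assume xy: "x \<in> ?S" "y \<in> ?S" "?t x = ?t y"
    then obtain p q where pq: "p \<in> S" "q \<in> S" "x = snd c p" "y = snd c q" by blast
    then have "snd d p = snd d q" using t xy by auto
    then have "p = q" using chart_in(1)[OF A d] pq S by (metis subsetD)
    then show "x = y" using pq by simp
  qed
  let ?U = "snd c ` (fst c \<inter> fst d)"
  have U: "open ?U" by (rule open_chart_image_restrict(2)[OF A c open_chart_domain[OF A d]])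
  have SU: "?S \<subseteq> ?U" using S by auto
  have contt: "C1_on ?U ?t"
    using A c d by (auto simp: smooth_atlas_def intro: smooth_on_imp_C1_on)
  have contdet: "continuous_on ?S (\<lambda>x. \<bar>det (?J x)\<bar>)"
  proof -
    have "continuous_on ?S (\<lambda>x. frechet_derivative ?t (at x) v)" for v
      using continuous_on_subset[OF _ SU] contt by (auto simp: C1_on_iff)
    then show ?thesis
      unfolding det_def by (intro continuous_intros) (auto simp: matrix_def intro!: continuous_intros)
  qed
  have Sb: "?S \<in> sets borel" "snd d ` S \<in> sets borel" 
    using chart_image_borel[OF A c S(1,2)] chart_image_borel[OF A d S(1,3)] by auto
  have meas: "(\<lambda>x. indicator ?S x * \<bar>det (?J x)\<bar>) \<in> borel_measurable borel"
    by (rule borel_measurable_indicator_mult_continuous[OF Sb(1) contdet])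
  have dens: "vol_density A g c x = \<bar>det (?J x)\<bar> * vol_density A g d (?t x)" if "x \<in> ?S" for x
  proof -
    obtain p where p: "p \<in> S" "x = snd c p" using \<open>x \<in> ?S\<close> by blast
    note ch = charts[OF p(1)]
    have "linear (frechet_derivative ?t (at x))"
      using transition_differentiable[OF A ch] p by (auto intro: linear_frechet_derivative)
    then have J: "v d = ?J x *v v c" if "v \<in> tangent_space A p" for v
      using tangent_spaceD(2)[OF that ch] p by (simp add: matrix_works)
    have "gram_matrix A g c x = transpose (?J x) ** gram_matrix A g d (?t x) ** ?J x"
      unfolding p(2)
    proof (rule gram_matrix_unique[OF A riemannian_metric_bilinear[OF A g] ch(1)])
      fix v w assume vw: "v \<in> tangent_space A p" "w \<in> tangent_space A p"
      show "g p v w = v c \<bullet> ((transpose (?J (snd c p)) ** gram_matrix A g d (?t (snd c p)) ** ?J (snd c p)) *v w c)"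
        using bilinear_tensor_gram[OF A riemannian_metric_bilinear[OF A g] ch(2) vw]
        by (simp add: J vw p t flip: bilinear_tensor_congruence)
    qed
    then have "det (gram_matrix A g c x) = (det (?J x))^2 * det (gram_matrix A g d (?t x))"
      by (simp add: det_mul det_transpose power2_eq_square ac_simps)
    then show ?thesis by (simp add: vol_density_def real_sqrt_mult)
  qed
  have "chart_volume A g d S = (\<integral>\<^sup>+x\<in>?t ` ?S. ennreal (indicator (chart_image d) x * vol_density A g d x) \<partial>lborel)"
    unfolding chart_volume_def tS 
    by (intro nn_integral_cong) (use S in \<open>auto simp: indicator_def chart_image_def\<close>)
  also have "\<dots> = (\<integral>\<^sup>+x. ennreal (indicator ?S x * \<bar>det (?J x)\<bar>) 
      * ennreal (indicator (chart_image d) (?t x) * vol_density A g d (?t x)) \<partial>lborel)"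
    by (rule nn_integral_change_of_variables[OF Sb(1) _ der inj meas])
       (use Sb tS borel_measurable_vol_density[OF A g d] in auto)
  also have "\<dots> = chart_volume A g c S"
    unfolding chart_volume_def
  proof (rule nn_integral_cong)
    fix x 
    have "?t x \<in> chart_image d" if "x \<in> ?S" using that t S by (auto simp: chart_image_def)
    then show "ennreal (indicator ?S x * \<bar>det (?J x)\<bar>) * ennreal (indicator (chart_image d) (?t x) * vol_density A g d (?t x))
      = ennreal (vol_density A g c x) * indicator ?S x"
      by (cases "x \<in> ?S") (simp_all add: dens flip: ennreal_mult')
  qed
  finally show ?thesis by simp
qed

lemma countable_chart_cover:
  fixes A :: "('a::second_countable_topology, real^'m) atlas"
  assumes A: "smooth_atlas A"
  obtains c :: "nat \<Rightarrow> ('a, real^'m) chart" where "\<And>n. c n \<in> A" "(\<Union>n. fst (c n)) = UNIV"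
proof -
  obtain F where F: "F \<subseteq> fst ` A" "countable F" "\<Union>F = \<Union>(fst ` A)"
  proof (rule Lindelof[of "fst ` A"])
    show "open S" if "S \<in> fst ` A" for S using that open_chart_domain[OF A] by auto
  qed
  have U: "\<Union>F = UNIV" using F(3) A by (simp add: smooth_atlas_def)
  then have "F \<noteq> {}" by auto
  have "\<exists>c. c \<in> A \<and> fst c = from_nat_into F n" for n
    using F(1) from_nat_into[OF \<open>F \<noteq> {}\<close>, of n] by (metis imageE subsetD)
  then obtain c where c: "\<And>n. c n \<in> A" "\<And>n. fst (c n) = from_nat_into F n" by metis
  have "(\<Union>n. fst (c n)) = UNIV"
    using U range_from_nat_into[OF \<open>F \<noteq> {}\<close> F(2)] by (simp add: c(2))
  then show ?thesis using that c(1) by blast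
qed


text \<open>Existence and uniqueness both come from cutting a set along a countable cover by charts.\<close>

theorem riemannian_volume_properties:
  fixes A :: "('a::second_countable_topology, real^'m) atlas"
  assumes A: "smooth_atlas A" and g: "riemannian_metric A g"
  shows sets_riemannian_volume: "sets (riemannian_volume A g) = sets borel"
    and emeasure_riemannian_volume: 
      "\<And>c S. c \<in> A \<Longrightarrow> S \<in> sets borel \<Longrightarrow> S \<subseteq> fst c \<Longrightarrow> 
        emeasure (riemannian_volume A g) S = chart_volume A g c S"
proof -
  obtain c :: "nat \<Rightarrow> ('a, real^'m) chart" where c: "\<And>n. c n \<in> A" "(\<Union>n. fst (c n)) = UNIV"
    using countable_chart_cover[OF A] by blast
  define D where "D = disjointed (\<lambda>n. fst (c n))"
  have Dsub: "D n \<subseteq> fst (c n)" for n unfolding D_def by (rule disjointed_subset)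
  have Ddisj: "disjoint_family D" unfolding D_def by (rule disjoint_family_disjointed)
  have DU: "(\<Union>n. D n) = UNIV" unfolding D_def UN_disjointed_eq by (rule c(2))
  have "range (\<lambda>n. fst (c n)) \<subseteq> sets borel" using open_chart_domain[OF A c(1)] by auto
  then have "range D \<subseteq> sets borel" unfolding D_def by (rule sets.range_disjointed_sets)
  then have Dborel: "D n \<in> sets borel" for n by auto
  define \<mu> where "\<mu> = (\<lambda>S. \<Sum>n. chart_volume A g (c n) (S \<inter> D n))"
  have SD: "S \<inter> D n \<in> sets borel" "S \<inter> D n \<subseteq> fst (c n)" if "S \<in> sets borel" for S n
    using Dborel Dsub that by auto
  have cut: "(\<Union>n. S \<inter> D n) = S" for S using DU by blast
  have disj: "disjoint_family (\<lambda>n. S \<inter> D n)" for S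
    using Ddisj unfolding disjoint_family_on_def by blast
  have split: "(\<Sum>n. chart_volume A g d (S \<inter> D n)) = chart_volume A g d S"
    if "d \<in> A" "S \<in> sets borel" "S \<subseteq> fst d" for d S
  proof -
    have "chart_volume A g d (\<Union>n. S \<inter> D n) = (\<Sum>n. chart_volume A g d (S \<inter> D n))"
      by (rule chart_volume_UN[OF A g that(1) SD(1)[OF that(2)] _ disj]) (use that(3) in auto)
    then show ?thesis by (simp only: cut)
  qed
  have \<mu>_chart: "\<mu> S = chart_volume A g d S" if "d \<in> A" "S \<in> sets borel" "S \<subseteq> fst d" for d S
    unfolding \<mu>_def split[OF that, symmetric]
    by (intro suminf_cong chart_volume_chart_change[OF A g c(1) that(1)] SD that(2)) (use that in auto)
  define M where "M = measure_of UNIV (sets borel) \<mu>"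
  have setsM: "sets M = sets borel"
    unfolding M_def by (simp add: sigma_algebra.sets_measure_of_eq[OF sets.sigma_algebra_axioms[of borel, simplified]])
  have emM: "emeasure M S = \<mu> S" if "S \<in> sets borel" for S
    unfolding M_def
  proof (rule emeasure_measure_of_sigma)
    show "sigma_algebra UNIV (sets borel :: 'a set set)" using sets.sigma_algebra_axioms[of "borel :: 'a measure"] by simp
    show "positive (sets borel) \<mu>" by (simp add: positive_def \<mu>_def chart_volume_def)
    show "countably_additive (sets borel) \<mu>"
    proof (rule countably_additiveI)
      fix S :: "nat \<Rightarrow> 'a set" assume S: "range S \<subseteq> sets borel" "disjoint_family S" "\<Union>(range S) \<in> sets borel"
      have Sb: "S i \<in> sets borel" for i using S(1) by auto
      have "\<mu> (\<Union>(range S)) = (\<Sum>n. chart_volume A g (c n) (\<Union>i. S i \<inter> D n))"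
        by (simp add: \<mu>_def)
      also have "\<dots> = (\<Sum>n. \<Sum>i. chart_volume A g (c n) (S i \<inter> D n))"
      proof (intro suminf_cong chart_volume_UN[OF A g c(1)] SD Sb)
        show "disjoint_family (\<lambda>i. S i \<inter> D n)" for n
          using S(2) unfolding disjoint_family_on_def by blast
      qed
      also have "\<dots> = (\<Sum>i. \<Sum>n. chart_volume A g (c n) (S i \<inter> D n))"
        by (subst (1 2) nn_integral_count_space_nat[symmetric]) (rule nn_integral_suminf, simp)
      finally show "(\<Sum>i. \<mu> (S i)) = \<mu> (\<Union>(range S))" by (simp add: \<mu>_def)
    qed
  qed (rule that)
  let ?P = "\<lambda>\<mu>. sets \<mu> = sets borel \<and>
     (\<forall>c\<in>A. \<forall>S\<in>sets borel. S \<subseteq> fst c \<longrightarrow>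
        emeasure \<mu> S = (\<integral>\<^sup>+x\<in>snd c ` S. ennreal (sqrt (det (gram_matrix A g c x))) \<partial>lborel))"
  have P: "?P N \<longleftrightarrow> sets N = sets borel \<and> 
     (\<forall>c\<in>A. \<forall>S\<in>sets borel. S \<subseteq> fst c \<longrightarrow> emeasure N S = chart_volume A g c S)" for N
    by (simp add: chart_volume_def vol_density_def)
  have "?P M" unfolding P using setsM emM \<mu>_chart by simp
  moreover have "N = M" if "?P N" for N
  proof (rule measure_eqI)
    show "sets N = sets M" using that setsM by simp
    fix S assume "S \<in> sets N"
    then have S: "S \<in> sets borel" using that by simp
    have "emeasure N S = emeasure N (\<Union>n. S \<inter> D n)" by (simp only: cut)
    also have "\<dots> = (\<Sum>n. emeasure N (S \<inter> D n))"
      by (intro suminf_emeasure[symmetric] disj) (use that SD(1)[OF S] in auto)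
    also have "\<dots> = \<mu> S"
      unfolding \<mu>_def using that[unfolded P] SD[OF S] c(1) by (intro suminf_cong) blast
    finally show "emeasure N S = emeasure M S" using emM[OF S] by simp
  qed
  ultimately have "?P (riemannian_volume A g)"
    unfolding riemannian_volume_def by (rule theI)
  then show "sets (riemannian_volume A g) = sets borel" 
     "\<And>c S. c \<in> A \<Longrightarrow> S \<in> sets borel \<Longrightarrow> S \<subseteq> fst c \<Longrightarrow> 
        emeasure (riemannian_volume A g) S = chart_volume A g c S"
    unfolding P by blast+
qed

text \<open>The volume restricted to a chart domain is the image of the weighted Lebesgue measure.\<close>

lemma integral_riemannian_volume_chart:
  fixes A :: "('a::second_countable_topology, real^'m) atlas" and F :: "'a \<Rightarrow> real"
  assumes A: "smooth_atlas A" and g: "riemannian_metric A g" and c: "c \<in> A"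
    and F: "F \<in> borel_measurable borel" "\<And>p. p \<notin> fst c \<Longrightarrow> F p = 0"
  shows "(\<integral>p. F p \<partial>riemannian_volume A g) 
    = (\<integral>x. indicator (chart_image c) x * vol_density A g c x * F (chart_inv c x) \<partial>lborel)"
proof -
  let ?V = "riemannian_volume A g"
  let ?f = "\<lambda>x. if x \<in> chart_image c then chart_inv c x else undefined"
  let ?w = "\<lambda>x. indicator (chart_image c) x * vol_density A g c x"
  have domb: "fst c \<in> sets borel" using open_chart_domain[OF A c] by auto
  have "continuous_on (chart_image c) (chart_inv c)" 
    using chart_homeomorphism[OF A c] by (simp add: homeomorphism_def)
  then have f: "?f \<in> borel_measurable borel"
    using open_chart_image[OF A c] by (intro borel_measurable_continuous_on_if) auto
  then have f': "?f \<in> measurable (chart_measure A g c) borel" 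
    by (simp add: chart_measure_def cong: measurable_cong_sets)
  have Fm: "F \<in> borel_measurable ?V" 
    using F(1) by (simp cong: measurable_cong_sets add: sets_riemannian_volume[OF A g])
  have w: "?w \<in> borel_measurable lborel" using borel_measurable_vol_density[OF A g c] by simp
  have w0: "?w x \<ge> 0" for x using vol_density_pos[OF A g c, of x] by (auto simp: indicator_def)
  have eq: "distr (chart_measure A g c) borel ?f = density ?V (\<lambda>p. ennreal (indicator (fst c) p))"
  proof (rule measure_eqI)
    show "sets (distr (chart_measure A g c) borel ?f) = sets (density ?V (\<lambda>p. ennreal (indicator (fst c) p)))"
      by (simp add: sets_riemannian_volume[OF A g])
    fix W assume "W \<in> sets (distr (chart_measure A g c) borel ?f)"
    then have W: "W \<in> sets borel" by simp
    then have WV: "W \<in> sets ?V" by (simp add: sets_riemannian_volume[OF A g])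
    have Wc: "W \<inter> fst c \<in> sets borel" "W \<inter> fst c \<subseteq> fst c" using W domb by auto
    have fW: "?f -` W \<in> sets borel" using measurable_sets[OF f W] by simp
    have "emeasure (distr (chart_measure A g c) borel ?f) W = emeasure (chart_measure A g c) (?f -` W)"
      using f' W by (subst emeasure_distr) (auto simp: chart_measure_def)
    also have "\<dots> = (\<integral>\<^sup>+x. ennreal (?w x) * indicator (?f -` W) x \<partial>lborel)"
      unfolding chart_measure_def using fW w by (subst emeasure_density) auto
    also have "\<dots> = (\<integral>\<^sup>+x. ennreal (?w x) * indicator (snd c ` (W \<inter> fst c)) x \<partial>lborel)"
    proof (rule nn_integral_cong)
      fix x
      have "x \<in> ?f -` W \<longleftrightarrow> x \<in> snd c ` (W \<inter> fst c)" if "x \<in> chart_image c"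
        using chart_image_restrict[OF A c, of W] that by (auto simp: Int_commute)
      then show "ennreal (?w x) * indicator (?f -` W) x = ennreal (?w x) * indicator (snd c ` (W \<inter> fst c)) x"
        by (auto simp: indicator_def)
    qed
    also have "\<dots> = emeasure (chart_measure A g c) (snd c ` (W \<inter> fst c))"
      unfolding chart_measure_def using chart_image_borel[OF A c Wc] w by (subst emeasure_density) auto
    also have "\<dots> = emeasure ?V (W \<inter> fst c)"
      by (simp only: emeasure_riemannian_volume[OF A g c Wc] chart_volume_eq[OF A g c Wc])
    also have "\<dots> = emeasure (density ?V (\<lambda>p. ennreal (indicator (fst c) p))) W"
      using WV domb sets_riemannian_volume[OF A g]
      by (subst emeasure_density) (auto simp: ennreal_indicator Int_commute simp flip: indicator_inter_arith)
    finally show "emeasure (distr (chart_measure A g c) borel ?f) W 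
      = emeasure (density ?V (\<lambda>p. ennreal (indicator (fst c) p))) W" .
  qed
  have "(\<integral>p. F p \<partial>?V) = (\<integral>p. indicator (fst c) p *\<^sub>R F p \<partial>?V)"
    by (intro Bochner_Integration.integral_cong) (auto simp: indicator_def F(2))
  also have "\<dots> = (\<integral>p. F p \<partial>(density ?V (\<lambda>p. ennreal (indicator (fst c) p))))"
    using Fm domb sets_riemannian_volume[OF A g] by (subst integral_density) auto
  also have "\<dots> = (\<integral>x. F (?f x) \<partial>(chart_measure A g c))"
    unfolding eq[symmetric] using f' F(1) by (subst integral_distr) auto
  also have "\<dots> = (\<integral>x. ?w x *\<^sub>R F (?f x) \<partial>lborel)"
    unfolding chart_measure_def using f F(1) w w0 by (subst integral_density) auto
  also have "\<dots> = (\<integral>x. ?w x * F (chart_inv c x) \<partial>lborel)"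
    by (intro Bochner_Integration.integral_cong) (auto simp: indicator_def)
  finally show ?thesis .
qed

text \<open>The density is bounded on a small ball in each chart, and finitely many such balls cover a compact set.\<close>

lemma emeasure_riemannian_volume_compact:
  fixes A :: "('a::second_countable_topology, real^'m) atlas"
  assumes A: "smooth_atlas A" and g: "riemannian_metric A g" and K: "compact K"
  shows "emeasure (riemannian_volume A g) K < \<infinity>"
proof -
  let ?V = "riemannian_volume A g"
  have loc: "\<exists>W. open W \<and> p \<in> W \<and> emeasure ?V W < \<infinity>" for p
  proof -
    obtain c where c: "c \<in> charts_at A p" using atlas_ex_chart[OF A] by blast
    then have cA: "c \<in> A" by (simp add: charts_at_def)
    obtain r where r: "r > 0" "cball (snd c p) r \<subseteq> chart_image c"
      using open_contains_cball open_chart_image[OF A cA] chart_at_in(2)[OF A c] by blast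
    let ?B = "ball (snd c p) r"
    have B: "?B \<subseteq> chart_image c" using r by (meson ball_subset_cball order_trans)
    let ?W = "fst c \<inter> snd c -` ?B"
    have cont: "continuous_on (fst c) (snd c)" 
      using chart_homeomorphism[OF A cA] by (simp add: homeomorphism_def)
    have "open ?W" 
      using cont continuous_on_open_vimage[OF open_chart_domain[OF A cA]] by (metis Int_commute open_ball)
    moreover have "p \<in> ?W" using c r by (simp add: charts_at_def)
    moreover have "emeasure ?V ?W < \<infinity>"
    proof -
      have im: "snd c ` ?W = ?B" using B by (auto simp: chart_image_def)
      have "bounded (vol_density A g c ` cball (snd c p) r)"
        by (intro compact_imp_bounded compact_continuous_image 
            continuous_on_subset[OF C1_on_imp_continuous_on[OF C1_on_vol_density[OF A g cA]] r(2)]) auto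
      then obtain C where C0: "\<forall>y\<in>vol_density A g c ` cball (snd c p) r. norm y \<le> C"
        unfolding bounded_iff by blast
      have C: "vol_density A g c x \<le> C" if "x \<in> ?B" for x
        using C0[rule_format, OF imageI, of x] that by simp
      have "emeasure ?V ?W = (\<integral>\<^sup>+x\<in>?B. ennreal (vol_density A g c x) \<partial>lborel)"
        using emeasure_riemannian_volume[OF A g cA, of ?W] \<open>open ?W\<close> by (simp add: chart_volume_def im)
      also have "\<dots> \<le> (\<integral>\<^sup>+x. ennreal C * indicator ?B x \<partial>lborel)"
        by (intro nn_integral_mono) (auto simp: indicator_def intro!: ennreal_leI C)
      also have "\<dots> = ennreal C * emeasure lborel ?B" by (rule nn_integral_cmult_indicator) auto
      also have "\<dots> < \<infinity>" 
        using emeasure_lborel_ball_finite[of "snd c p" r] by (simp add: ennreal_mult_less_top)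
      finally show ?thesis .
    qed
    ultimately show ?thesis by blast
  qed
  obtain W where W: "\<And>p. open (W p)" "\<And>p. p \<in> W p" "\<And>p. emeasure ?V (W p) < \<infinity>"
    using loc by metis
  obtain T where T: "finite T" "K \<subseteq> (\<Union>p\<in>T. W p)"
    using compactE_image[OF K, of UNIV W] W by (metis UNIV_I UN_iff subsetI)
  have Wsets: "W p \<in> sets ?V" for p using W(1) by (simp add: sets_riemannian_volume[OF A g])
  have "emeasure ?V K \<le> emeasure ?V (\<Union>p\<in>T. W p)"
    by (rule emeasure_mono[OF T(2)]) (use T(1) Wsets in auto)
  also have "\<dots> \<le> (\<Sum>p\<in>T. emeasure ?V (W p))"
    by (rule emeasure_subadditive_finite) (use T(1) Wsets in auto)
  also have "\<dots> < \<infinity>" 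
    using T(1) W(3) by (induction T rule: finite_induct) (auto simp: ennreal_add_eq_top less_top[symmetric])
  finally show ?thesis .
qed


section \<open>Flows in charts\<close>

definition flow_chart :: "(real \<Rightarrow> 'a \<Rightarrow> 'a) \<Rightarrow> ('a, 'e) chart \<Rightarrow> ('a, 'e) chart \<Rightarrow> real \<Rightarrow> 'e \<Rightarrow> 'e" where
  "flow_chart \<phi> c d t x = snd d (\<phi> t (chart_inv c x))"

definition flow_domain :: "(real \<Rightarrow> 'a \<Rightarrow> 'a) \<Rightarrow> ('a, 'e) chart \<Rightarrow> ('a, 'e) chart \<Rightarrow> (real \<times> 'e) set" where
  "flow_domain \<phi> c d = {(t, x). x \<in> chart_image c \<and> \<phi> t (chart_inv c x) \<in> fst d}"

definition vf_chart :: "('a \<Rightarrow> ('a, 'e) tvec) \<Rightarrow> ('a, 'e) chart \<Rightarrow> 'e \<Rightarrow> 'e" where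
  "vf_chart X c y = X (chart_inv c y) c"

lemma flow_chart_comp: "snd d \<circ> \<phi> t \<circ> chart_inv c = flow_chart \<phi> c d t"
  by (auto simp: flow_chart_def)

lemma flow_continuous:
  assumes "is_flow A X \<phi>" 
  shows "continuous_on UNIV (\<lambda>(t, p). \<phi> t p)"
  using assms by (simp add: is_flow_def smooth_map_def)

lemma open_flow_domain:
  assumes A: "smooth_atlas A" and \<phi>: "is_flow A X \<phi>" and c: "c \<in> A" and d: "d \<in> A"
  shows "open (flow_domain \<phi> c d)"
proof -
  let ?f = "\<lambda>y::real \<times> _. (\<lambda>(t, p). \<phi> t p) (fst y, chart_inv c (snd y))"
  let ?S = "UNIV \<times> chart_image c :: (real \<times> _) set"
  have "continuous_on (chart_image c) (chart_inv c)" 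
    using chart_homeomorphism[OF A c] by (simp add: homeomorphism_def)
  then have "continuous_on ?S (\<lambda>y. chart_inv c (snd y))"
    by (rule continuous_on_compose2) (auto intro: continuous_intros)
  then have "continuous_on ?S ?f"
    by (intro continuous_on_compose2[OF flow_continuous[OF \<phi>]] continuous_on_Pair continuous_on_fst continuous_on_id) auto
  moreover have "open ?S" using open_chart_image[OF A c] by (auto intro: open_Times)
  ultimately have "open (?f -` fst d \<inter> ?S)"
    using open_chart_domain[OF A d] by (simp add: continuous_on_open_vimage)
  moreover have "?f -` fst d \<inter> ?S = flow_domain \<phi> c d"
    by (auto simp: flow_domain_def)
  ultimately show ?thesis by simp
qed

text \<open>The flow is smooth as a map on the product of the line with the manifold; the work is to identify the
  chart expressions of that map with the curves considered here.\<close>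

lemma C1_on_flow_chart:
  fixes A :: "('a::topological_space, 'e::euclidean_space) atlas"
  assumes A: "smooth_atlas A" and \<phi>: "is_flow A X \<phi>" and c: "c \<in> A" and d: "d \<in> A"
  shows "C1_on (flow_domain \<phi> c d) (\<lambda>(t, x). flow_chart \<phi> c d t x)"
proof -
  define L :: "(real \<times> 'a, real \<times> 'e) chart" where "L = (UNIV \<times> fst c, \<lambda>(t, p). (t, snd c p))"
  have L: "L \<in> line_times A" using c by (auto simp: line_times_def L_def)
  have inj: "inj_on (snd L) (fst L)"
    using chart_in(1)[OF A c] by (auto simp: inj_on_def L_def) metis
  have inv: "chart_inv L (t, x) = (t, chart_inv c x)" if "x \<in> chart_image c" for t x
    unfolding chart_inv_def[of L]
    by (rule inv_into_f_eq[OF inj]) (use chart_inv_in[OF A c that] in \<open>auto simp: L_def\<close>)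
  have im: "snd L ` (fst L \<inter> (\<lambda>(t, p). \<phi> t p) -` fst d) = flow_domain \<phi> c d"
  proof (intro equalityI subsetI)
    fix y assume "y \<in> snd L ` (fst L \<inter> (\<lambda>(t, p). \<phi> t p) -` fst d)"
    then show "y \<in> flow_domain \<phi> c d"
      using chart_in[OF A c] by (auto simp: L_def flow_domain_def)
  next
    fix y assume y: "y \<in> flow_domain \<phi> c d"
    then have "y = snd L (fst y, chart_inv c (snd y))" 
      "(fst y, chart_inv c (snd y)) \<in> fst L \<inter> (\<lambda>(t, p). \<phi> t p) -` fst d"
      using chart_inv_in[OF A c] by (auto simp: L_def flow_domain_def)
    then show "y \<in> snd L ` (fst L \<inter> (\<lambda>(t, p). \<phi> t p) -` fst d)" by blast
  qed
  have "smooth_on (flow_domain \<phi> c d) (snd d \<circ> (\<lambda>(t, p). \<phi> t p) \<circ> chart_inv L)"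
    using \<phi> L d unfolding is_flow_def smooth_map_def im[symmetric] by blast
  from smooth_on_imp_C1_on[OF this] show ?thesis
    by (rule C1_on_cong[OF open_flow_domain[OF A \<phi> c d]])
       (auto simp: flow_domain_def flow_chart_def inv)
qed

lemma flow_chart_has_derivative:
  fixes A :: "('a::topological_space, 'e::euclidean_space) atlas"
  assumes A: "smooth_atlas A" and \<phi>: "is_flow A X \<phi>" and c: "c \<in> A" and d: "d \<in> A"
    and tx: "(t, x) \<in> flow_domain \<phi> c d"
  shows "(flow_chart \<phi> c d t has_derivative 
    (\<lambda>v. frechet_derivative (\<lambda>(t, x). flow_chart \<phi> c d t x) (at (t, x)) (0, v))) (at x)"
proof -
  have "((\<lambda>y. (t, y)) has_derivative (\<lambda>v. (0, v))) (at x)"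
    by (auto intro!: derivative_eq_intros)
  from has_derivative_compose[OF this C1_on_has_derivative[OF C1_on_flow_chart[OF A \<phi> c d] tx]]
  show ?thesis by simp
qed

lemma mdiff_flow:
  assumes A: "smooth_atlas A" and \<phi>: "is_flow A X \<phi>"
  shows "mdiff A A (\<phi> t)"
  unfolding mdiff_def
proof (intro conjI allI ballI)
  have "continuous_on UNIV (\<lambda>p. (\<lambda>(t, p). \<phi> t p) (t, p))"
    by (rule continuous_on_compose2[OF flow_continuous[OF \<phi>]]) (auto intro!: continuous_intros)
  then show "continuous_on UNIV (\<phi> t)" by simp
  fix p c d assume c: "c \<in> charts_at A p" and d: "d \<in> charts_at A (\<phi> t p)"
  have "(t, snd c p) \<in> flow_domain \<phi> c d"
    using c d chart_at_in[OF A c] by (simp add: flow_domain_def charts_at_def)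
  from flow_chart_has_derivative[OF A \<phi> charts_atD(1)[OF c] charts_atD(1)[OF d] this]
  show "snd d \<circ> \<phi> t \<circ> chart_inv c differentiable at (snd c p)"
    unfolding flow_chart_comp differentiable_def by blast
qed

text \<open>From here on both charts agree, so that the flow is only followed for a short time.\<close>

lemma flow_chart_in:
  assumes A: "smooth_atlas A" and c: "c \<in> A" and tx: "(t, x) \<in> flow_domain \<phi> c c"
  shows "x \<in> chart_image c" "c \<in> charts_at A (chart_inv c x)" "snd c (chart_inv c x) = x"
    and "flow_chart \<phi> c c t x \<in> chart_image c" 
    and "c \<in> charts_at A (\<phi> t (chart_inv c x))"
    and "chart_inv c (flow_chart \<phi> c c t x) = \<phi> t (chart_inv c x)"
proof -
  show x: "x \<in> chart_image c" and 1: "c \<in> charts_at A (\<phi> t (chart_inv c x))"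
    using tx c by (auto simp: flow_domain_def charts_at_def)
  show "c \<in> charts_at A (chart_inv c x)" "snd c (chart_inv c x) = x"
    using chart_inv_charts_at[OF A c x] chart_inv_in[OF A c x] by auto
  show "flow_chart \<phi> c c t x \<in> chart_image c" "chart_inv c (flow_chart \<phi> c c t x) = \<phi> t (chart_inv c x)"
    using chart_at_in[OF A 1] by (auto simp: flow_chart_def)
qed

lemma flow_domain_zero:
  assumes A: "smooth_atlas A" and \<phi>: "is_flow A X \<phi>" and c: "c \<in> A" and x: "x \<in> chart_image c"
  shows "(0, x) \<in> flow_domain \<phi> c c" "flow_chart \<phi> c c 0 x = x"
  using \<phi> chart_inv_in[OF A c x] x by (auto simp: flow_domain_def flow_chart_def is_flow_def)

lemma flow_chart_time_derivative:
  assumes A: "smooth_atlas A" and \<phi>: "is_flow A X \<phi>" and c: "c \<in> A" and tx: "(t, x) \<in> flow_domain \<phi> c c"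
  shows "((\<lambda>t. flow_chart \<phi> c c t x) has_vector_derivative vf_chart X c (flow_chart \<phi> c c t x)) (at t)"
  using \<phi> flow_chart_in(5,6)[OF A c tx] unfolding is_flow_def vf_chart_def flow_chart_def by auto

lemma C1_on_vf_chart: "smooth_vector_field A X \<Longrightarrow> c \<in> A \<Longrightarrow> C1_on (chart_image c) (vf_chart X c)"
  unfolding smooth_vector_field_def vf_chart_def by (auto intro: smooth_on_imp_C1_on)

text \<open>The linearised flow equation: the exchange of partial derivatives, applied along the lines through \<open>x\<close>.\<close>

lemma flow_chart_derivative_time_derivative:
  fixes A :: "('a::topological_space, 'e::euclidean_space) atlas"
  assumes A: "smooth_atlas A" and X: "smooth_vector_field A X" and \<phi>: "is_flow A X \<phi>" and c: "c \<in> A" 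
    and tx: "(t, x) \<in> flow_domain \<phi> c c"
  shows "((\<lambda>t. frechet_derivative (flow_chart \<phi> c c t) (at x) v) has_vector_derivative 
    frechet_derivative (vf_chart X c) (at (flow_chart \<phi> c c t x)) 
      (frechet_derivative (flow_chart \<phi> c c t) (at x) v)) (at t)"
proof -
  let ?F = "\<lambda>(t, x). flow_chart \<phi> c c t x" and ?X = "vf_chart X c" and ?D = "flow_domain \<phi> c c"
  note C1F = C1_on_flow_chart[OF A \<phi> c c] and C1X = C1_on_vf_chart[OF X c]
  have fd: "frechet_derivative (flow_chart \<phi> c c t) (at x) w = frechet_derivative ?F (at (t, x)) (0, w)"
    if "(t, x) \<in> ?D" for t x w
    using frechet_derivative_at[OF flow_chart_has_derivative[OF A \<phi> c c that]] by metis
  have sd: "((\<lambda>s. flow_chart \<phi> c c t (x + s *\<^sub>R v)) has_vector_derivative 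
      frechet_derivative ?F (at (t, x + s *\<^sub>R v)) (0, v)) (at s)"
    if "(t, x + s *\<^sub>R v) \<in> ?D" for t s
  proof -
    have 1: "((\<lambda>s. x + s *\<^sub>R v) has_derivative (\<lambda>h. h *\<^sub>R v)) (at s)"
      by (auto intro!: derivative_eq_intros)
    have "linear (frechet_derivative ?F (at (t, x + s *\<^sub>R v)))"
      using C1F that by (intro linear_frechet_derivative) (auto simp: C1_on_iff)
    from linear_scale[OF this, of _ "(0, v)"] 
    show ?thesis
      using has_derivative_compose[OF 1 flow_chart_has_derivative[OF A \<phi> c c that]]
      by (simp add: has_vector_derivative_def)
  qed
  \<comment> \<open>A rectangle around \<open>(t, 0)\<close> that the line in direction \<open>v\<close> maps into the domain of the flow.\<close>
  let ?q = "\<lambda>(t, s). (t, x + s *\<^sub>R v)"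
  have q: "continuous_on S ?q" for S by (auto intro!: continuous_intros simp: split_beta)
  have "open (?q -` ?D)"
    by (rule open_vimage[OF open_flow_domain[OF A \<phi> c c] q])
  moreover have "(t, 0) \<in> ?q -` ?D" using tx by simp
  ultimately obtain T S where TS: "open T" "open S" "(t, 0) \<in> T \<times> S" "T \<times> S \<subseteq> ?q -` ?D"
    by (rule open_prod_elim)
  obtain e where e: "e > 0" "cball t e \<subseteq> T" using TS(1,3) open_contains_cball[of T] by blast
  obtain r where r: "r > 0" "ball 0 r \<subseteq> S" using TS(2,3) open_contains_ball[of S] by blast
  have sub: "(\<tau>, x + s *\<^sub>R v) \<in> ?D" if "\<tau> \<in> {t - e..t + e}" "s \<in> {-r<..<r}" for \<tau> s
  proof -
    have "\<tau> \<in> T" using that(1) e(2) by (auto simp: cball_eq_atLeastAtMost)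
    moreover have "s \<in> S" using that(2) r(2) by (auto simp: ball_eq_greaterThanLessThan)
    ultimately show ?thesis using TS(4) by auto
  qed
  have sub0: "(\<tau>, x) \<in> ?D" if "\<tau> \<in> {t - e..t + e}" for \<tau> using sub[OF that, of 0] r by simp
  have contD: "continuous_on (?q -` ?D) (\<lambda>y. frechet_derivative ?F (at (?q y)) (0, v))"
    using C1F by (intro continuous_on_compose2[OF _ q, of ?D "\<lambda>y. frechet_derivative ?F (at y) (0, v)"])
      (auto simp: C1_on_iff)
  have contF: "continuous_on (?q -` ?D) (\<lambda>y. ?F (?q y))"
    by (intro continuous_on_compose2[OF C1_on_imp_continuous_on[OF C1F] q]) auto
  have inF: "?F (?q y) \<in> chart_image c" if "y \<in> ?q -` ?D" for y
    using flow_chart_in(4)[OF A c] that by (cases y) auto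
  have contX: "continuous_on (?q -` ?D) (\<lambda>y. ?X (?F (?q y)))"
    by (intro continuous_on_compose2[OF C1_on_imp_continuous_on[OF C1X] contF]) (use inF in auto)
  have contH: "continuous_on (?q -` ?D) 
      (\<lambda>y. frechet_derivative ?X (at (?F (?q y))) (frechet_derivative ?F (at (?q y)) (0, v)))"
    by (intro continuous_on_frechet_derivative[OF C1X contF _ contD]) (use inF in auto)
  have main: "((\<lambda>\<tau>. frechet_derivative ?F (at (\<tau>, x)) (0, v)) has_vector_derivative 
      (\<lambda>\<tau> s. frechet_derivative ?X (at (?F (?q (\<tau>, s)))) (frechet_derivative ?F (at (?q (\<tau>, s))) (0, v))) t 0) (at t)"
  proof (rule has_vector_derivative_parameter_derivative[where 
        f = "\<lambda>\<tau> s. flow_chart \<phi> c c \<tau> (x + s *\<^sub>R v)" and 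
        g = "\<lambda>\<tau> s. ?X (?F (?q (\<tau>, s)))" and 
        h = "\<lambda>\<tau> s. frechet_derivative ?X (at (?F (?q (\<tau>, s)))) (frechet_derivative ?F (at (?q (\<tau>, s))) (0, v))" and
        a = "t - e" and b = "t + e" and r = r])
    fix \<tau> s assume \<tau>: "\<tau> \<in> {t - e..t + e}" and s: "s \<in> {-r<..<r}"
    show "((\<lambda>\<tau>. flow_chart \<phi> c c \<tau> (x + s *\<^sub>R v)) has_vector_derivative ?X (?F (?q (\<tau>, s)))) (at \<tau>)"
      using flow_chart_time_derivative[OF A \<phi> c sub[OF \<tau> s]] by simp
    have "(?X has_derivative frechet_derivative ?X (at (?F (?q (\<tau>, s))))) (at (?F (?q (\<tau>, s))))"
      by (rule C1_on_has_derivative[OF C1X]) (use inF sub[OF \<tau> s] in auto)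
    from has_derivative_compose[OF sd[OF sub[OF \<tau> s], unfolded has_vector_derivative_def], 
        of ?X "frechet_derivative ?X (at (?F (?q (\<tau>, s))))"] this
    have "((\<lambda>s. ?X (flow_chart \<phi> c c \<tau> (x + s *\<^sub>R v))) has_derivative 
       (\<lambda>h. frechet_derivative ?X (at (?F (?q (\<tau>, s)))) (h *\<^sub>R frechet_derivative ?F (at (\<tau>, x + s *\<^sub>R v)) (0, v)))) (at s)"
      by simp
    moreover have "linear (frechet_derivative ?X (at (?F (?q (\<tau>, s)))))"
      using C1X inF[of "(\<tau>, s)"] sub[OF \<tau> s] by (intro linear_frechet_derivative) (auto simp: C1_on_iff)
    ultimately show "((\<lambda>s. ?X (?F (?q (\<tau>, s)))) has_vector_derivative 
       frechet_derivative ?X (at (?F (?q (\<tau>, s)))) (frechet_derivative ?F (at (?q (\<tau>, s))) (0, v))) (at s)"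
      by (simp add: has_vector_derivative_def linear_scale)
  next
    fix \<tau> assume "\<tau> \<in> {t - e..t + e}"
    from sd[of \<tau> 0] sub0[OF this]
    show "((\<lambda>s. flow_chart \<phi> c c \<tau> (x + s *\<^sub>R v)) has_vector_derivative 
       frechet_derivative ?F (at (\<tau>, x)) (0, v)) (at 0)" by simp
  next
    fix s assume s: "s \<in> {-r<..<r}"
    show "continuous_on {t - e..t + e} (\<lambda>\<tau>. ?X (?F (?q (\<tau>, s))))"
      by (rule continuous_on_compose2[OF contX, of _ "\<lambda>\<tau>. (\<tau>, s)"])
        (use sub s in \<open>auto intro!: continuous_intros\<close>)
  next
    have "continuous_on ({-r<..<r} \<times> {t - e..t + e}) 
      (\<lambda>y. frechet_derivative ?X (at (?F (?q (snd y, fst y)))) (frechet_derivative ?F (at (?q (snd y, fst y))) (0, v)))"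
      by (rule continuous_on_compose2[OF contH, of _ "\<lambda>y. (snd y, fst y)"])
        (use sub in \<open>auto intro!: continuous_intros\<close>)
    then show "continuous_on ({-r<..<r} \<times> {t - e..t + e}) 
      (\<lambda>(s, \<tau>). frechet_derivative ?X (at (?F (?q (\<tau>, s)))) (frechet_derivative ?F (at (?q (\<tau>, s))) (0, v)))"
      by (simp add: split_beta)
  qed (use e r in auto)
  have "((\<lambda>\<tau>. frechet_derivative (flow_chart \<phi> c c \<tau>) (at x) v) has_vector_derivative 
      frechet_derivative ?X (at (flow_chart \<phi> c c t x)) (frechet_derivative ?F (at (t, x)) (0, v))) (at t)"
    by (rule has_vector_derivative_transform_within_open[where S = "{t - e<..<t + e}" 
         and f = "\<lambda>\<tau>. frechet_derivative ?F (at (\<tau>, x)) (0, v)"])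
       (use main e fd[OF sub0] in auto)
  then show ?thesis by (simp add: fd[OF tx])
qed


section \<open>Lie derivatives in charts\<close>

definition flow_jac :: "(real \<Rightarrow> 'a \<Rightarrow> 'a) \<Rightarrow> ('a, real^'m) chart \<Rightarrow> real \<Rightarrow> real^'m \<Rightarrow> real^'m^'m::finite" where
  "flow_jac \<phi> c t x = matrix (frechet_derivative (flow_chart \<phi> c c t) (at x))"

definition vf_jac :: "('a \<Rightarrow> ('a, real^'m) tvec) \<Rightarrow> ('a, real^'m) chart \<Rightarrow> real^'m \<Rightarrow> real^'m^'m::finite" where
  "vf_jac X c y = matrix (frechet_derivative (vf_chart X c) (at y))"

definition flow_gram :: 
  "(real \<Rightarrow> 'a \<Rightarrow> 'a) \<Rightarrow> ('a, real^'m) chart \<Rightarrow> (real^'m \<Rightarrow> real^'m^'m) \<Rightarrow> real \<Rightarrow> real^'m \<Rightarrow> real^'m^'m::finite" where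
  "flow_gram \<phi> c S t x = transpose (flow_jac \<phi> c t x) ** S (flow_chart \<phi> c c t x) ** flow_jac \<phi> c t x"

text \<open>The coordinate formula \<open>(L_X S)(v, w) = (X S)(v, w) + S(DX v, w) + S(v, DX w)\<close> in matrix form.\<close>

definition lie_matrix :: 
  "('a \<Rightarrow> ('a, real^'m) tvec) \<Rightarrow> ('a, real^'m) chart \<Rightarrow> (real^'m \<Rightarrow> real^'m^'m) \<Rightarrow> real^'m \<Rightarrow> real^'m^'m::finite" where
  "lie_matrix X c S y = transpose (vf_jac X c y) ** S y 
     + frechet_derivative S (at y) (vf_chart X c y) + S y ** vf_jac X c y"

lemma has_vector_derivative_matrixI:
  fixes M :: "real \<Rightarrow> real^'m^'n"
  assumes "\<And>i j. ((\<lambda>t. M t $ i $ j) has_vector_derivative M' $ i $ j) F"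
  shows "(M has_vector_derivative M') F"
proof -
  have "((\<lambda>t. \<chi> i j. M t $ i $ j) has_vector_derivative (\<chi> i j. M' $ i $ j)) F"
    unfolding has_vector_derivative_def 
  proof -
    have 1: "((\<lambda>t. \<Sum>i\<in>UNIV. \<Sum>j\<in>UNIV. M t $ i $ j *\<^sub>R (axis i (axis j 1) :: real^'m^'n)) has_derivative 
       (\<lambda>h. \<Sum>i\<in>UNIV. \<Sum>j\<in>UNIV. (h *\<^sub>R (M' $ i $ j)) *\<^sub>R axis i (axis j 1))) F"
      by (intro has_derivative_sum has_derivative_scaleR_left assms[unfolded has_vector_derivative_def])
    have s: "(\<Sum>j\<in>UNIV. if P then f j else 0) = (if P then \<Sum>j\<in>UNIV. f j else (0::real))" 
      for P and f :: "'m \<Rightarrow> real" by simp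
    have 2: "(\<Sum>i\<in>UNIV. \<Sum>j\<in>UNIV. a i j *\<^sub>R (axis i (axis j 1) :: real^'m^'n)) = (\<chi> i j. a i j)" for a
      by (simp add: vec_eq_iff axis_def if_distrib[where f = "\<lambda>v. v $ _"] if_distrib[where f = "\<lambda>v. _ * v"]
        s cong: if_cong)
    show "((\<lambda>t. \<chi> i j. M t $ i $ j) has_derivative (\<lambda>h. h *\<^sub>R (\<chi> i j. M' $ i $ j))) F"
      using 1 unfolding 2 by (rule has_derivative_eq_rhs) (simp add: fun_eq_iff vec_eq_iff)
  qed
  then show ?thesis by (simp add: vec_lambda_unique)
qed

lemma vf_jac_apply:
  assumes "smooth_vector_field A X" "c \<in> A" "y \<in> chart_image c"
  shows "frechet_derivative (vf_chart X c) (at y) v = vf_jac X c y *v v"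
proof -
  have "linear (frechet_derivative (vf_chart X c) (at y))"
    using C1_on_vf_chart[OF assms(1,2)] assms(3) by (intro linear_frechet_derivative) (auto simp: C1_on_iff)
  then show ?thesis by (simp add: vf_jac_def matrix_works)
qed

lemma flow_jac_time_derivative:
  fixes A :: "('a::topological_space, real^'m) atlas"
  assumes A: "smooth_atlas A" and X: "smooth_vector_field A X" and \<phi>: "is_flow A X \<phi>" and c: "c \<in> A" 
    and tx: "(t, x) \<in> flow_domain \<phi> c c"
  shows "((\<lambda>t. flow_jac \<phi> c t x) has_vector_derivative 
     vf_jac X c (flow_chart \<phi> c c t x) ** flow_jac \<phi> c t x) (at t)"
proof (rule has_vector_derivative_matrixI)
  fix i j :: 'm
  let ?P = "\<lambda>t. frechet_derivative (flow_chart \<phi> c c t) (at x) (axis j 1)"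
  note flow_chart_derivative_time_derivative[OF A X \<phi> c tx, of "axis j 1"]
  from bounded_linear.has_vector_derivative[OF bounded_linear_vec_nth this, of i]
  have "((\<lambda>t. ?P t $ i) has_vector_derivative (vf_jac X c (flow_chart \<phi> c c t x) *v ?P t) $ i) (at t)"
    by (simp add: vf_jac_apply[OF X c flow_chart_in(4)[OF A c tx]])
  then show "((\<lambda>t. flow_jac \<phi> c t x $ i $ j) has_vector_derivative 
     (vf_jac X c (flow_chart \<phi> c c t x) ** flow_jac \<phi> c t x) $ i $ j) (at t)"
    by (simp add: flow_jac_def matrix_def matrix_matrix_mult_def matrix_vector_mult_def)
qed

lemma has_vector_derivative_compose_C1:
  fixes S :: "'e::euclidean_space \<Rightarrow> 'b::real_normed_vector"
  assumes "C1_on U S" "f t \<in> U" "(f has_vector_derivative f') (at t)"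
  shows "((\<lambda>t. S (f t)) has_vector_derivative frechet_derivative S (at (f t)) f') (at t)"
proof -
  have "linear (frechet_derivative S (at (f t)))"
    using assms(1,2) by (intro linear_frechet_derivative) (auto simp: C1_on_iff)
  then show ?thesis
    using has_derivative_compose[OF assms(3)[unfolded has_vector_derivative_def] 
        C1_on_has_derivative[OF assms(1,2)]]
    by (simp add: has_vector_derivative_def linear_scale)
qed

text \<open>Differentiating the pullback gives the pullback of the Lie derivative at every time. Times other than zero
  matter for the uniform bounds in the differentiation under the integral.\<close>

lemma flow_gram_time_derivative:
  fixes A :: "('a::topological_space, real^'m) atlas"
  assumes A: "smooth_atlas A" and X: "smooth_vector_field A X" and \<phi>: "is_flow A X \<phi>" and c: "c \<in> A" 
    and tx: "(t, x) \<in> flow_domain \<phi> c c" and S: "C1_on (chart_image c) S"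
  shows "((\<lambda>t. flow_gram \<phi> c S t x) has_vector_derivative 
     transpose (flow_jac \<phi> c t x) ** lie_matrix X c S (flow_chart \<phi> c c t x) ** flow_jac \<phi> c t x) (at t)"
proof -
  note mm = bounded_bilinear.has_vector_derivative[OF bounded_bilinear_matrix_matrix_mult]
  note J = flow_jac_time_derivative[OF A X \<phi> c tx]
  note JT = bounded_linear.has_vector_derivative[OF bounded_linear_transpose J]
  note dS = has_vector_derivative_compose_C1[OF S flow_chart_in(4)[OF A c tx] 
      flow_chart_time_derivative[OF A \<phi> c tx]]
  show ?thesis
    unfolding flow_gram_def
    by (rule has_vector_derivative_eq_rhs[OF mm[OF mm[OF JT dS] J]])
      (simp add: lie_matrix_def matrix_transpose_mul matrix_mul_assoc 
        matrix_add_ldistrib bounded_bilinear.add_left[OF bounded_bilinear_matrix_matrix_mult])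
qed

lemma continuous_on_vf_jac:
  fixes A :: "('a::topological_space, real^'m) atlas"
  assumes X: "smooth_vector_field A X" and c: "c \<in> A" 
  shows "continuous_on (chart_image c) (vf_jac X c)"
  using C1_on_vf_chart[OF X c] unfolding vf_jac_def matrix_def
  by (intro continuous_on_vec_lambda continuous_on_component) (auto simp: C1_on_iff)

lemma continuous_on_lie_matrix:
  fixes A :: "('a::topological_space, real^'m) atlas"
  assumes X: "smooth_vector_field A X" and c: "c \<in> A" and S: "C1_on (chart_image c) S"
  shows "continuous_on (chart_image c) (lie_matrix X c S)"
  unfolding lie_matrix_def
  by (intro continuous_on_add continuous_on_matrix_mult continuous_on_transpose 
      continuous_on_vf_jac[OF X c] C1_on_imp_continuous_on[OF S] continuous_on_frechet_derivative[OF S]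
      C1_on_imp_continuous_on[OF C1_on_vf_chart[OF X c]] continuous_on_id) auto

lemma continuous_on_flow_chart:
  assumes A: "smooth_atlas A" and \<phi>: "is_flow A X \<phi>" and c: "c \<in> A"
  shows "continuous_on (flow_domain \<phi> c c) (\<lambda>y. flow_chart \<phi> c c (fst y) (snd y))"
  using C1_on_imp_continuous_on[OF C1_on_flow_chart[OF A \<phi> c c]] by (simp add: split_beta)

lemma continuous_on_along_flow:
  assumes A: "smooth_atlas A" and \<phi>: "is_flow A X \<phi>" and c: "c \<in> A" and S: "continuous_on (chart_image c) S"
  shows "continuous_on (flow_domain \<phi> c c) (\<lambda>y. S (flow_chart \<phi> c c (fst y) (snd y)))"
  by (rule continuous_on_compose2[OF S continuous_on_flow_chart[OF A \<phi> c]])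
     (use flow_chart_in(4)[OF A c] in auto)

lemma continuous_on_flow_jac:
  fixes A :: "('a::topological_space, real^'m) atlas"
  assumes A: "smooth_atlas A" and \<phi>: "is_flow A X \<phi>" and c: "c \<in> A"
  shows "continuous_on (flow_domain \<phi> c c) (\<lambda>y. flow_jac \<phi> c (fst y) (snd y))"
proof -
  let ?F = "\<lambda>(t, x). flow_chart \<phi> c c t x"
  have eq: "flow_jac \<phi> c (fst y) (snd y) = (\<chi> i j. frechet_derivative ?F (at y) (0, axis j 1) $ i)"
    if "y \<in> flow_domain \<phi> c c" for y
    using frechet_derivative_at[OF flow_chart_has_derivative[OF A \<phi> c c], of "fst y" "snd y", symmetric] that
    by (simp add: flow_jac_def matrix_def)
  have "continuous_on (flow_domain \<phi> c c) (\<lambda>y. \<chi> i j. frechet_derivative ?F (at y) (0, axis j 1) $ i)"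
    using C1_on_flow_chart[OF A \<phi> c c] 
    by (intro continuous_on_vec_lambda continuous_on_component) (auto simp: C1_on_iff)
  then show ?thesis by (rule continuous_on_eq) (simp add: eq)
qed

lemma continuous_on_flow_gram:
  fixes A :: "('a::topological_space, real^'m) atlas"
  assumes A: "smooth_atlas A" and \<phi>: "is_flow A X \<phi>" and c: "c \<in> A" and S: "continuous_on (chart_image c) S"
  shows "continuous_on (flow_domain \<phi> c c) (\<lambda>y. flow_gram \<phi> c S (fst y) (snd y))"
  unfolding flow_gram_def
  by (intro continuous_on_matrix_mult continuous_on_transpose continuous_on_flow_jac[OF A \<phi> c]
      continuous_on_along_flow[OF A \<phi> c S])

lemma flow_zero_chart:
  fixes A :: "('a::topological_space, real^'m) atlas"
  assumes A: "smooth_atlas A" and \<phi>: "is_flow A X \<phi>" and c: "c \<in> A" and x: "x \<in> chart_image c"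
  shows "flow_jac \<phi> c 0 x = mat 1" and "flow_gram \<phi> c S 0 x = S x"
proof -
  have "frechet_derivative (flow_chart \<phi> c c 0) (at x) = frechet_derivative (\<lambda>x. x) (at x)"
    by (rule frechet_derivative_cong_open[OF open_chart_image[OF A c] x flow_domain_zero(2)[OF A \<phi> c]])
  then show "flow_jac \<phi> c 0 x = mat 1" by (simp add: flow_jac_def matrix_id_mat_1[unfolded id_def])
  then show "flow_gram \<phi> c S 0 x = S x"
    by (simp add: flow_gram_def flow_domain_zero(2)[OF A \<phi> c x])
qed

lemma pullback_flow_coords:
  fixes A :: "('a::topological_space, real^'m) atlas"
  assumes A: "smooth_atlas A" and \<phi>: "is_flow A X \<phi>" and c: "c \<in> A" 
    and tx: "(t, x) \<in> flow_domain \<phi> c c" and T: "bilinear_tensor A T"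
    and v: "v \<in> tangent_space A (chart_inv c x)" and w: "w \<in> tangent_space A (chart_inv c x)"
  shows "pullback A A (\<phi> t) T (chart_inv c x) v w = v c \<bullet> (flow_gram \<phi> c (gram_matrix A T c) t x *v w c)"
  using pullback_coords[OF A A mdiff_flow[OF A \<phi>] T flow_chart_in(2,5)[OF A c tx] v w]
  by (simp add: flow_gram_def flow_jac_def flow_chart_comp flow_chart_in(3)[OF A c tx])
     (simp add: flow_chart_def)

lemma eventually_flow_domain:
  assumes A: "smooth_atlas A" and \<phi>: "is_flow A X \<phi>" and c: "c \<in> A" and x: "x \<in> chart_image c"
  shows "\<exists>T. open T \<and> 0 \<in> T \<and> (\<forall>t\<in>T. (t, x) \<in> flow_domain \<phi> c c)"
proof -
  have "open ((\<lambda>t. (t, x)) -` flow_domain \<phi> c c)"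
    by (rule open_vimage[OF open_flow_domain[OF A \<phi> c c]]) (intro continuous_intros)
  then show ?thesis using flow_domain_zero(1)[OF A \<phi> c x] by blast
qed

text \<open>The right-hand side contains the field but not the flow, so every flow of the field gives the same derivative.\<close>

lemma lie_derivative_coords:
  fixes A :: "('a::topological_space, real^'m) atlas"
  assumes A: "smooth_atlas A" and X: "smooth_vector_field A X" and \<phi>: "is_flow A X \<phi>" 
    and c: "c \<in> A" and x: "x \<in> chart_image c"
    and T: "bilinear_tensor A T" "C1_on (chart_image c) (gram_matrix A T c)"
    and v: "v \<in> tangent_space A (chart_inv c x)" and w: "w \<in> tangent_space A (chart_inv c x)"
  shows "lie_derivative A X T (chart_inv c x) v w = v c \<bullet> (lie_matrix X c (gram_matrix A T c) x *v w c)"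
proof -
  define \<psi> where "\<psi> = (SOME \<phi>. is_flow A X \<phi>)"
  have \<psi>: "is_flow A X \<psi>" unfolding \<psi>_def by (rule someI[of "is_flow A X", OF \<phi>])
  let ?p = "chart_inv c x" and ?S = "gram_matrix A T c"
  obtain U where U: "open U" "0 \<in> U" "\<And>t. t \<in> U \<Longrightarrow> (t, x) \<in> flow_domain \<psi> c c"
    using eventually_flow_domain[OF A \<psi> c x] by blast
  have bl: "bounded_linear (\<lambda>M::real^'m^'m. v c \<bullet> (M *v w c))"
    unfolding linear_conv_bounded_linear[symmetric]
    by (rule linearI) (auto simp: matrix_vector_mult_add_rdistrib inner_add_right scaleR_matrix_vector_assoc[symmetric])
  have "((\<lambda>t. v c \<bullet> (flow_gram \<psi> c ?S t x *v w c)) has_vector_derivative 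
      v c \<bullet> (lie_matrix X c ?S x *v w c)) (at 0)"
    using bounded_linear.has_vector_derivative[OF bl 
        flow_gram_time_derivative[OF A X \<psi> c flow_domain_zero(1)[OF A \<psi> c x] T(2)]]
    by (simp add: flow_zero_chart[OF A \<psi> c x] flow_domain_zero[OF A \<psi> c x] transpose_mat)
  then have "((\<lambda>t. pullback A A (\<psi> t) T ?p v w) has_vector_derivative 
      v c \<bullet> (lie_matrix X c ?S x *v w c)) (at 0)"
    by (rule has_vector_derivative_transform_within_open[OF _ U(1,2)])
       (simp add: pullback_flow_coords[OF A \<psi> c U(3) T(1) v w])
  then have "deriv (\<lambda>t. pullback A A (\<psi> t) T ?p v w) 0 = v c \<bullet> (lie_matrix X c ?S x *v w c)"
    by (intro DERIV_imp_deriv) (simp add: has_real_derivative_iff_has_vector_derivative)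
  then show ?thesis by (simp add: lie_derivative_def pullback_def \<psi>_def)
qed

lemma lie_matrix_symmetric:
  assumes U: "open U" "y \<in> U" and S: "C1_on U S" and sym: "\<And>z. z \<in> U \<Longrightarrow> transpose (S z) = S z"
  shows "transpose (lie_matrix X c S y) = lie_matrix X c S y"
proof -
  have "((\<lambda>z. transpose (S z)) has_derivative (\<lambda>v. transpose (frechet_derivative S (at y) v))) (at y)"
    by (rule bounded_linear.has_derivative[OF bounded_linear_transpose C1_on_has_derivative[OF S U(2)]])
  then have "(S has_derivative (\<lambda>v. transpose (frechet_derivative S (at y) v))) (at y)"
    by (rule has_derivative_transform_within_open[OF _ U]) (simp add: sym)
  from frechet_derivative_at[OF this]
  have 1: "transpose (frechet_derivative S (at y) v) = frechet_derivative S (at y) v" for v by metis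
  have add: "transpose (M + N) = transpose M + transpose N" for M N :: "real^'m^'m"
    by (simp add: transpose_def vec_eq_iff)
  show ?thesis
    by (simp add: lie_matrix_def add matrix_transpose_mul 1 sym[OF U(2)])
qed

lemma lie_matrix_outside_support:
  fixes A :: "('a::topological_space, real^'m) atlas"
  assumes A: "smooth_atlas A" and X: "smooth_vector_field A X" and c: "c \<in> A" and x: "x \<in> chart_image c"
    and p: "chart_inv c x \<notin> vf_support X" and S: "C1_on (chart_image c) S"
  shows "vf_chart X c x = 0" "lie_matrix X c S x = 0"
proof -
  let ?U = "chart_image c \<inter> chart_inv c -` (- vf_support X)"
  have U: "open ?U" 
    by (rule open_chart_image_restrict(1)[OF A c]) (simp add: vf_support_def open_Compl)
  have X0: "vf_chart X c y = 0" if "y \<in> ?U" for y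
  proof -
    have "chart_inv c y \<notin> {p. X p \<noteq> (\<lambda>_. 0)}" 
      using that closure_subset[of "{p. X p \<noteq> (\<lambda>_. 0)}"] by (auto simp: vf_support_def)
    then show ?thesis by (simp add: vf_chart_def)
  qed
  have xU: "x \<in> ?U" using x p by simp
  show 1: "vf_chart X c x = 0" by (rule X0[OF xU])
  have "frechet_derivative (vf_chart X c) (at x) = frechet_derivative (\<lambda>_. 0) (at x)"
    by (rule frechet_derivative_cong_open[OF U xU X0])
  then have "vf_jac X c x = 0" by (simp add: vf_jac_def matrix_def vec_eq_iff)
  moreover have "linear (frechet_derivative S (at x))"
    using S x by (intro linear_frechet_derivative) (auto simp: C1_on_iff)
  moreover have "transpose (0 :: real^'m^'m) = 0" by (simp add: transpose_def vec_eq_iff)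
  ultimately show "lie_matrix X c S x = 0"
    by (simp add: lie_matrix_def 1 linear_0 bounded_bilinear.zero_left[OF bounded_bilinear_matrix_matrix_mult]
        bounded_bilinear.zero_right[OF bounded_bilinear_matrix_matrix_mult])
qed


section \<open>The first variation of the energy density\<close>

text \<open>For \<open>Q\<close> the inverse of a metric, this is the metric trace of the third power of the symmetric form \<open>M\<close>.\<close>

definition cube_trace :: "real^'m^'m \<Rightarrow> real^'m^'m::finite \<Rightarrow> real" where
  "cube_trace Q M = trace ((Q ** M) ** (Q ** M) ** (Q ** M))"

lemma trace_cube_congruence:
  fixes E M :: "real^'m^'m"
  assumes "E ** transpose E = Q" and N: "N = transpose E ** M ** E"
  shows "trace (N ** N ** N) = cube_trace Q M"
  unfolding N congruence_mult assms(1) trace_congruence cube_trace_def by (simp only: matrix_mul_assoc)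

text \<open>The three terms of the product rule agree by cyclicity of the trace.\<close>

lemma trace_cube_product_rule:
  fixes R R' :: "real^'m^'m"
  shows "trace (R ** R ** R' + (R ** R' + R' ** R) ** R) = 3 * trace (R ** R ** R')"
proof -
  have "trace (R ** R' ** R) = trace (R ** (R ** R'))" by (rule trace_mul_sym)
  moreover have "trace (R' ** R ** R) = trace (R ** (R' ** R))" by (rule trace_mul_sym)
  ultimately show ?thesis 
    by (simp add: trace_add matrix_mul_assoc bounded_bilinear.add_left[OF bounded_bilinear_matrix_matrix_mult])
qed

lemma cube_trace_vector_derivative:
  fixes M :: "real \<Rightarrow> real^'m^'m"
  assumes M: "(M has_vector_derivative M') (at t)" and Q: "(Q has_vector_derivative Q') (at t)"
  shows "((\<lambda>t. cube_trace (Q t) (M t)) has_real_derivative 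
     3 * trace ((Q t ** M t) ** (Q t ** M t) ** (Q' ** M t + Q t ** M'))) (at t)"
proof -
  note mm = bounded_bilinear.has_vector_derivative[OF bounded_bilinear_matrix_matrix_mult]
  let ?R = "Q t ** M t" and ?R' = "Q' ** M t + Q t ** M'"
  have R: "((\<lambda>t. Q t ** M t) has_vector_derivative ?R') (at t)"
    by (rule has_vector_derivative_eq_rhs[OF mm[OF Q M]]) (simp add: add.commute)
  have "((\<lambda>t. (Q t ** M t) ** (Q t ** M t) ** (Q t ** M t)) has_vector_derivative 
      (?R ** ?R ** ?R' + (?R ** ?R' + ?R' ** ?R) ** ?R)) (at t)"
    by (rule mm[OF mm[OF R R] R])
  from bounded_linear.has_vector_derivative[OF bounded_linear_trace this]
  have "((\<lambda>t. cube_trace (Q t) (M t)) has_vector_derivative 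
      trace (?R ** ?R ** ?R' + (?R ** ?R' + ?R' ** ?R) ** ?R)) (at t)"
    by (simp only: cube_trace_def)
  then show ?thesis by (simp only: trace_cube_product_rule has_real_derivative_iff_has_vector_derivative)
qed

lemma trace_transpose: "trace (transpose M) = trace (M :: real^'m^'m)"
  by (simp add: trace_def transpose_def)

text \<open>The derivative \<open>D\<close> of the vector field enters the Lie derivatives of the metric \<open>G\<close> and of the pulled back
  metric \<open>T\<close>. In the first variation the two contributions cancel: by invariance of the trace under transposition
  and cyclic permutation each of them is twice the trace of \<open>R\<^sup>3 D\<close>.\<close>

lemma transport_terms_cancel:
  fixes G T D :: "real^'m^'m"
  assumes G: "invertible G" "transpose G = G" and T: "transpose T = T"
  defines "Q \<equiv> matrix_inv G" 
  defines "R \<equiv> Q ** T"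
  shows "trace (R ** R ** Q ** (transpose D ** T + T ** D)) 
    = trace (R ** R ** R ** Q ** (transpose D ** G + G ** D))"
proof -
  have QG: "Q ** G = mat 1" and GQ: "G ** Q = mat 1"
    using matrix_inv_left[OF G(1)] matrix_inv_right[OF G(1)] by (simp_all add: Q_def)
  have "transpose Q ** G = transpose (G ** Q)" using G(2) by (simp add: matrix_transpose_mul)
  also have "\<dots> = mat 1" by (simp add: GQ transpose_mat)
  finally have "G ** transpose Q = mat 1" by (simp add: matrix_left_right_inverse)
  then have QT: "transpose Q = Q" using matrix_inv_unique Q_def by metis
  have RT: "transpose R = T ** Q" by (simp add: R_def matrix_transpose_mul QT T)
  have a: "R ** R ** Q ** (T ** D) = R ** R ** R ** D" by (simp add: R_def matrix_mul_assoc)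
  have "trace (R ** R ** Q ** (transpose D ** T)) = trace (transpose (R ** R ** Q ** (transpose D ** T)))"
    by (rule trace_transpose[symmetric])
  also have "transpose (R ** R ** Q ** (transpose D ** T)) = T ** (D ** (Q ** T ** Q ** T ** Q))"
    by (simp add: matrix_transpose_mul RT QT T matrix_mul_assoc)
  also have "trace \<dots> = trace (D ** (Q ** T ** Q ** T ** Q) ** T)" by (rule trace_mul_sym)
  also have "D ** (Q ** T ** Q ** T ** Q) ** T = D ** (R ** R ** R)" by (simp add: R_def matrix_mul_assoc)
  also have "trace \<dots> = trace (R ** R ** R ** D)" by (rule trace_mul_sym)
  finally have b: "trace (R ** R ** Q ** (transpose D ** T)) = trace (R ** R ** R ** D)" .
  have "R ** R ** R ** Q ** (G ** D) = R ** R ** R ** (Q ** G) ** D" by (simp only: matrix_mul_assoc)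
  then have c: "R ** R ** R ** Q ** (G ** D) = R ** R ** R ** D" by (simp add: QG)
  have "trace (R ** R ** R ** Q ** (transpose D ** G)) = trace (transpose (R ** R ** R ** Q ** (transpose D ** G)))"
    by (rule trace_transpose[symmetric])
  also have "transpose (R ** R ** R ** Q ** (transpose D ** G)) = G ** (D ** (Q ** T ** Q ** T ** Q ** T ** Q))"
    by (simp add: matrix_transpose_mul RT QT T G(2) matrix_mul_assoc)
  also have "trace \<dots> = trace (D ** (Q ** T ** Q ** T ** Q ** T ** Q) ** G)" by (rule trace_mul_sym)
  also have "D ** (Q ** T ** Q ** T ** Q ** T ** Q) ** G = D ** (Q ** T ** Q ** T ** Q ** T) ** (Q ** G)" 
    by (simp only: matrix_mul_assoc)
  also have "\<dots> = D ** (R ** R ** R)" by (simp add: QG R_def matrix_mul_assoc)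
  also have "trace \<dots> = trace (R ** R ** R ** D)" by (rule trace_mul_sym)
  finally have d: "trace (R ** R ** R ** Q ** (transpose D ** G)) = trace (R ** R ** R ** D)" .
  show ?thesis
    by (simp only: matrix_add_ldistrib trace_add a b c d)
qed

definition energy_density ::
  "('a, real^'m) atlas \<Rightarrow> ('a, real^'m::finite) tensor2 \<Rightarrow>
   ('b, real^'n) atlas \<Rightarrow> ('b, real^'n::finite) tensor2 \<Rightarrow> ('a \<Rightarrow> 'b) \<Rightarrow> 'a \<Rightarrow> real" where
  "energy_density A g B h u p = d3_norm2 A g B h u p / 6"

text \<open>The divergence with respect to the Riemannian volume, in a form that does not refer to a chart.\<close>

definition metric_divergence ::
  "('a::topological_space, real^'m) atlas \<Rightarrow> ('a, real^'m::finite) tensor2 \<Rightarrow> ('a \<Rightarrow> ('a, real^'m) tvec) \<Rightarrow> 'a \<Rightarrow> real" where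
  "metric_divergence A g X p = trace (tensor_matrix A g (lie_derivative A X g) p) / 2"

definition flow_derivative :: "(real \<Rightarrow> 'a \<Rightarrow> 'a) \<Rightarrow> ('a \<Rightarrow> real) \<Rightarrow> 'a \<Rightarrow> real" where
  "flow_derivative \<phi> f p = deriv (\<lambda>t. f (\<phi> t p)) 0"

text \<open>The setting of the first variation formula. In a chart \<open>c\<close> the matrices \<open>G c\<close> and \<open>H c\<close> belong to the
  metric and to the pulled back metric, and \<open>R c\<close> is the latter as an endomorphism.\<close>

locale variation =
  fixes A :: "('a::{second_countable_topology, t2_space}, real^'m::finite) atlas"
    and g :: "('a, real^'m) tensor2"
    and B :: "('b::{second_countable_topology, t2_space}, real^'n::finite) atlas"
    and h :: "('b, real^'n) tensor2"
    and u :: "'a \<Rightarrow> 'b"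
    and X :: "'a \<Rightarrow> ('a, real^'m) tvec"
    and \<phi> :: "real \<Rightarrow> 'a \<Rightarrow> 'a"
  assumes A: "smooth_atlas A" and g: "riemannian_metric A g"
    and B: "smooth_atlas B" and h: "riemannian_metric B h"
    and u: "smooth_map A B u"
    and X: "smooth_vector_field A X" and supp: "compact (vf_support X)"
    and \<phi>: "is_flow A X \<phi>"
begin

abbreviation "T \<equiv> pullback A B u h"
abbreviation "G c \<equiv> gram_matrix A g c"
abbreviation "H c \<equiv> gram_matrix A T c"
abbreviation "Q c x \<equiv> matrix_inv (G c x)"
abbreviation "R c x \<equiv> Q c x ** H c x"

lemma md_u: "mdiff A B u" by (rule smooth_map_imp_mdiff[OF u])
lemma bil_g: "bilinear_tensor A g" by (rule riemannian_metric_bilinear[OF A g])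
lemma bil_T: "bilinear_tensor A T" by (rule pullback_bilinear[OF A B md_u riemannian_metric_bilinear[OF B h]])
lemma C1_G: "c \<in> A \<Longrightarrow> C1_on (chart_image c) (G c)" by (rule C1_on_gram_matrix_metric[OF g])
lemma C1_H: "c \<in> A \<Longrightarrow> C1_on (chart_image c) (H c)" by (rule C1_on_gram_matrix_pullback[OF A B u h])
lemma G_sym: "c \<in> A \<Longrightarrow> x \<in> chart_image c \<Longrightarrow> transpose (G c x) = G c x"
  by (rule gram_matrix_symmetric[OF A riemannian_metric_symmetric[OF g]])
lemma H_sym: "c \<in> A \<Longrightarrow> x \<in> chart_image c \<Longrightarrow> transpose (H c x) = H c x"
  by (rule gram_matrix_symmetric[OF A pullback_symmetric[OF A B md_u riemannian_metric_symmetric[OF h]]])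
lemma C1_Q: "c \<in> A \<Longrightarrow> C1_on (chart_image c) (Q c)"
  by (rule C1_on_matrix_inv[OF C1_G invertible_gram_matrix[OF A g]])

lemma frame_matrix_Q:
  assumes "c \<in> A" "x \<in> chart_image c"
  shows "frame_matrix A g c (chart_inv c x) ** transpose (frame_matrix A g c (chart_inv c x)) = Q c x"
  using frame_matrix_gram(2)[OF A g chart_inv_charts_at[OF A assms]] chart_inv_in(2)[OF A assms] by simp

text \<open>The energy density of \<open>u \<circ> \<phi> t\<close> at a point is that of the flow pullback of the tensor \<open>T\<close>, with the metric at
  the fixed point: only the second argument of the cubic trace moves.\<close>

lemma energy_density_flow_chart:
  assumes c: "c \<in> A" and tx: "(t, x) \<in> flow_domain \<phi> c c"
  shows "energy_density A g B h (u \<circ> \<phi> t) (chart_inv c x) = cube_trace (Q c x) (flow_gram \<phi> c (H c) t x) / 6"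
proof -
  let ?p = "chart_inv c x"
  note in1 = flow_chart_in[OF A c tx]
  have "tensor_matrix A g (pullback A B (u \<circ> \<phi> t) h) ?p 
    = transpose (frame_matrix A g c ?p) ** flow_gram \<phi> c (H c) t x ** frame_matrix A g c ?p"
    by (rule tensor_matrix_coords)
       (simp add: pullback_compose[OF A A B mdiff_flow[OF A \<phi>] md_u frame_orthonormal(1)[OF A g] frame_orthonormal(1)[OF A g]]
         pullback_flow_coords[OF A \<phi> c tx bil_T frame_orthonormal(1)[OF A g] frame_orthonormal(1)[OF A g]])
  from trace_cube_congruence[OF frame_matrix_Q[OF c in1(1)] this]
  show ?thesis
    by (simp add: energy_density_def d3_norm2_eq[OF A g B h mdiff_compose[OF A A mdiff_flow[OF A \<phi>] md_u]])
qed

lemma energy_density_chart: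
  assumes c: "c \<in> A" and x: "x \<in> chart_image c"
  shows "energy_density A g B h u (chart_inv c x) = cube_trace (Q c x) (H c x) / 6"
proof -
  have "u \<circ> \<phi> 0 = u" using \<phi> by (auto simp: is_flow_def fun_eq_iff)
  then show ?thesis
    using energy_density_flow_chart[OF c flow_domain_zero(1)[OF A \<phi> c x]] flow_zero_chart(2)[OF A \<phi> c x]
    by simp
qed

text \<open>The time derivative of the energy density along the flow; the factor three of the cubic power and the
  constant six of the energy leave one half.\<close>

definition density_rate :: "('a, real^'m) chart \<Rightarrow> real \<Rightarrow> real^'m \<Rightarrow> real" where
  "density_rate c t x = (let R = Q c x ** flow_gram \<phi> c (H c) t x in
     trace (R ** R ** (Q c x ** (transpose (flow_jac \<phi> c t x) ** lie_matrix X c (H c) (flow_chart \<phi> c c t x) 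
       ** flow_jac \<phi> c t x))) / 2)"

lemma energy_density_time_derivative:
  assumes c: "c \<in> A" and tx: "(t, x) \<in> flow_domain \<phi> c c"
  shows "((\<lambda>t. energy_density A g B h (u \<circ> \<phi> t) (chart_inv c x)) has_real_derivative density_rate c t x) (at t)"
proof -
  let ?U = "(\<lambda>t. (t, x)) -` flow_domain \<phi> c c"
  have U: "open ?U"
    by (rule open_vimage[OF open_flow_domain[OF A \<phi> c c]]) (intro continuous_intros)
  have "((\<lambda>t. cube_trace (Q c x) (flow_gram \<phi> c (H c) t x) / 6) has_real_derivative density_rate c t x) (at t)"
    using DERIV_cdivide[OF cube_trace_vector_derivative[OF flow_gram_time_derivative[OF A X \<phi> c tx C1_H[OF c]]
      has_vector_derivative_const], of "Q c x" 6]
    by (simp add: density_rate_def Let_def bounded_bilinear.zero_left[OF bounded_bilinear_matrix_matrix_mult])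
  then show ?thesis
    by (rule has_field_derivative_transform_within_open[OF _ U]) 
      (use tx in \<open>simp_all add: energy_density_flow_chart[OF c]\<close>)
qed

lemma density_rate_zero:
  assumes c: "c \<in> A" and x: "x \<in> chart_image c"
  shows "density_rate c 0 x = trace (R c x ** R c x ** Q c x ** lie_matrix X c (H c) x) / 2"
  by (simp add: density_rate_def Let_def flow_zero_chart[OF A \<phi> c x] flow_domain_zero[OF A \<phi> c x] 
      transpose_mat matrix_mul_assoc)

lemma metric_divergence_chart:
  assumes c: "c \<in> A" and x: "x \<in> chart_image c"
  shows "metric_divergence A g X (chart_inv c x) = trace (Q c x ** lie_matrix X c (G c) x) / 2"
proof -
  let ?p = "chart_inv c x"
  have "tensor_matrix A g (lie_derivative A X g) ?p 
    = transpose (frame_matrix A g c ?p) ** lie_matrix X c (G c) x ** frame_matrix A g c ?p"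
    by (intro tensor_matrix_coords lie_derivative_coords[OF A X \<phi> c x bil_g C1_G[OF c]] frame_orthonormal(1)[OF A g])
  then show ?thesis
    by (simp add: metric_divergence_def trace_congruence frame_matrix_Q[OF c x])
qed

definition stress_term :: "'a \<Rightarrow> real" where
  "stress_term p = tensor_inner A g (stress_energy A g B h u) (\<lambda>q v w. 1 / 2 * lie_derivative A X g q v w) p"

text \<open>Symmetry of the Lie derivative of the metric allows to drop the transposition in the inner product.\<close>

lemma stress_term_chart:
  assumes c: "c \<in> A" and x: "x \<in> chart_image c"
  shows "stress_term (chart_inv c x) = 
    cube_trace (Q c x) (H c x) / 6 * (trace (Q c x ** lie_matrix X c (G c) x) / 2) 
    - trace (R c x ** R c x ** R c x ** Q c x ** lie_matrix X c (G c) x) / 2"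
proof -
  let ?p = "chart_inv c x" and ?L = "lie_matrix X c (G c) x"
  let ?E = "frame_matrix A g c ?p" and ?M = "tensor_matrix A g (\<lambda>q v w. 1 / 2 * lie_derivative A X g q v w) ?p"
  let ?N = "tensor_matrix A g T ?p"
  note E = frame_matrix_Q[OF c x]
  have N: "?N = transpose ?E ** H c x ** ?E"
    using tensor_matrix_gram[OF A g bil_T chart_inv_charts_at[OF A c x]] chart_inv_in(2)[OF A c x] by simp
  have L: "tensor_matrix A g (lie_derivative A X g) ?p = transpose ?E ** ?L ** ?E"
    by (intro tensor_matrix_coords lie_derivative_coords[OF A X \<phi> c x bil_g C1_G[OF c]] frame_orthonormal(1)[OF A g])
  have half: "?M = (1/2) *\<^sub>R tensor_matrix A g (lie_derivative A X g) ?p"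
    by (simp add: tensor_matrix_def vec_eq_iff)
  have Lsym: "transpose ?L = ?L"
    by (rule lie_matrix_symmetric[OF open_chart_image[OF A c] x C1_G[OF c] G_sym[OF c]])
  have Msym: "transpose ?M = ?M"
    unfolding half L by (simp add: linear_scale[OF bounded_linear.linear[OF bounded_linear_transpose]] 
        matrix_transpose_mul Lsym matrix_mul_assoc)
  note tr = linear_scale[OF bounded_linear.linear[OF bounded_linear_trace]]
  have trM: "trace ?M = trace (Q c x ** ?L) / 2"
    unfolding half L by (simp add: tr trace_congruence E)
  have "trace (?N ** ?N ** ?N ** ?M) = trace (?N ** ?N ** ?N ** (transpose ?E ** ?L ** ?E)) / 2"
    unfolding half L by (simp add: bounded_bilinear.scaleR_right[OF bounded_bilinear_matrix_matrix_mult] tr)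
  also have "?N ** ?N ** ?N ** (transpose ?E ** ?L ** ?E) 
      = transpose ?E ** (H c x ** Q c x ** H c x ** Q c x ** H c x ** Q c x ** ?L) ** ?E"
    unfolding N congruence_mult E ..
  also have "trace \<dots> = trace (R c x ** R c x ** R c x ** Q c x ** ?L)"
    unfolding trace_congruence E by (simp only: matrix_mul_assoc)
  finally have "trace (?N ** ?N ** ?N ** ?M) = trace (R c x ** R c x ** R c x ** Q c x ** ?L) / 2" .
  then show ?thesis
    unfolding stress_term_def tensor_inner_stress_energy[OF A g B h md_u] Msym trM 
      trace_cube_congruence[OF E N] by simp
qed

lemma has_derivative_cube_trace_chart:
  assumes c: "c \<in> A" and x: "x \<in> chart_image c"
  shows "frechet_derivative (\<lambda>y. cube_trace (Q c y) (H c y)) (at x) v = 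
    3 * (trace (R c x ** R c x ** Q c x ** frechet_derivative (H c) (at x) v)
      - trace (R c x ** R c x ** R c x ** Q c x ** frechet_derivative (G c) (at x) v))"
proof -
  let ?l = "\<lambda>t. x + t *\<^sub>R v" and ?G' = "frechet_derivative (G c) (at x) v" and ?H' = "frechet_derivative (H c) (at x) v"
  have l: "(?l has_vector_derivative v) (at 0)" 
    by (auto intro!: derivative_eq_intros simp: has_vector_derivative_def)
  have l0: "?l 0 \<in> chart_image c" using x by simp
  have Q': "frechet_derivative (Q c) (at x) v = - (Q c x ** ?G' ** Q c x)"
    using frechet_derivative_at[OF has_derivative_compose[OF C1_on_has_derivative[OF C1_G[OF c] x] 
        has_derivative_matrix_inv[OF invertible_gram_matrix[OF A g c x]]]] by metis
  have d1: "((\<lambda>t. cube_trace (Q c (?l t)) (H c (?l t))) has_real_derivative 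
      3 * trace (R c x ** R c x ** (- (Q c x ** ?G' ** Q c x) ** H c x + Q c x ** ?H'))) (at 0)"
    using cube_trace_vector_derivative[OF has_vector_derivative_compose_C1[OF C1_H[OF c] l0 l]
        has_vector_derivative_compose_C1[OF C1_Q[OF c] l0 l]] by (simp add: Q')
  have C1: "C1_on (chart_image c) (\<lambda>y. cube_trace (Q c y) (H c y))"
    unfolding cube_trace_def by (intro C1_on_trace C1_on_matrix_mult C1_Q[OF c] C1_H[OF c])
  have d2: "((\<lambda>t. cube_trace (Q c (?l t)) (H c (?l t))) has_vector_derivative 
      frechet_derivative (\<lambda>y. cube_trace (Q c y) (H c y)) (at x) v) (at 0)"
    using has_vector_derivative_compose_C1[OF C1 l0 l] by simp
  have "frechet_derivative (\<lambda>y. cube_trace (Q c y) (H c y)) (at x) v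
    = 3 * trace (R c x ** R c x ** (- (Q c x ** ?G' ** Q c x) ** H c x + Q c x ** ?H'))"
    by (rule vector_derivative_unique_at[OF d2 d1[unfolded has_real_derivative_iff_has_vector_derivative]])
  also have "trace (R c x ** R c x ** (- (Q c x ** ?G' ** Q c x) ** H c x + Q c x ** ?H'))
    = trace (R c x ** R c x ** Q c x ** ?H') - trace ((R c x ** R c x ** Q c x ** ?G') ** R c x)"
    by (simp add: trace_sub matrix_mul_assoc 
      bounded_bilinear.diff_right[OF bounded_bilinear_matrix_matrix_mult]
      bounded_bilinear.minus_left[OF bounded_bilinear_matrix_matrix_mult]
      bounded_bilinear.minus_right[OF bounded_bilinear_matrix_matrix_mult]
      linear_neg[OF bounded_linear.linear[OF bounded_linear_trace]])
  also have "trace ((R c x ** R c x ** Q c x ** ?G') ** R c x) = trace (R c x ** (R c x ** R c x ** Q c x ** ?G'))"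
    by (rule trace_mul_sym)
  also have "R c x ** (R c x ** R c x ** Q c x ** ?G') = R c x ** R c x ** R c x ** Q c x ** ?G'"
    by (simp only: matrix_mul_assoc)
  finally show ?thesis .
qed

lemma C1_energy_density:
  assumes c: "c \<in> A"
  shows "C1_on (chart_image c) (\<lambda>x. energy_density A g B h u (chart_inv c x))"
proof (rule C1_on_cong[OF open_chart_image[OF A c]])
  show "C1_on (chart_image c) (\<lambda>x. inverse 6 * cube_trace (Q c x) (H c x))"
    unfolding cube_trace_def by (intro C1_on_mult C1_on_const C1_on_trace C1_on_matrix_mult C1_Q[OF c] C1_H[OF c])
qed (simp add: energy_density_chart[OF c])

text \<open>Along \<open>X\<close> the energy density \<open>f\<close> feels the change of \<open>T\<close> and of the metric, whereas the first variation only
  feels that of \<open>T\<close>. Once the transport terms have cancelled, the difference is a contraction with the Lie derivative of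
  the metric: one part of the stress term, whose other part is \<open>f\<close> times the divergence of \<open>X\<close>.\<close>

lemma density_rate_plus_stress_term:
  assumes c: "c \<in> A" and x: "x \<in> chart_image c"
  shows "density_rate c 0 x + stress_term (chart_inv c x) = 
    frechet_derivative (\<lambda>x. energy_density A g B h u (chart_inv c x)) (at x) (vf_chart X c x)
    + energy_density A g B h u (chart_inv c x) * metric_divergence A g X (chart_inv c x)"
proof -
  let ?D = "vf_jac X c x" and ?X = "vf_chart X c x"
  let ?G' = "frechet_derivative (G c) (at x) ?X" and ?H' = "frechet_derivative (H c) (at x) ?X"
  let ?cube = "\<lambda>x. cube_trace (Q c x) (H c x)"
  have "C1_on (chart_image c) ?cube"
    unfolding cube_trace_def by (intro C1_on_trace C1_on_matrix_mult C1_Q[OF c] C1_H[OF c])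
  from has_derivative_mult_right[OF C1_on_has_derivative[OF this x], of "inverse 6"]
  have "((\<lambda>x. energy_density A g B h u (chart_inv c x)) has_derivative 
      (\<lambda>v. inverse 6 * frechet_derivative ?cube (at x) v)) (at x)"
    by (rule has_derivative_transform_within_open[OF _ open_chart_image[OF A c] x]) 
      (simp add: energy_density_chart[OF c])
  from fun_cong[OF frechet_derivative_at[OF this], of ?X]
  have 1: "frechet_derivative (\<lambda>x. energy_density A g B h u (chart_inv c x)) (at x) ?X 
    = (trace (R c x ** R c x ** Q c x ** ?H') - trace (R c x ** R c x ** R c x ** Q c x ** ?G')) / 2"
    by (simp add: has_derivative_cube_trace_chart[OF c x])
  have L: "lie_matrix X c S x = (transpose ?D ** S x + S x ** ?D) + frechet_derivative S (at x) ?X" for S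
    by (simp add: lie_matrix_def)
  have "trace (R c x ** R c x ** Q c x ** lie_matrix X c (H c) x) 
      - trace (R c x ** R c x ** R c x ** Q c x ** lie_matrix X c (G c) x)
    = trace (R c x ** R c x ** Q c x ** ?H') - trace (R c x ** R c x ** R c x ** Q c x ** ?G')"
    unfolding L matrix_add_ldistrib[of _ "transpose ?D ** _ + _"] trace_add
      transport_terms_cancel[OF invertible_gram_matrix[OF A g c x] G_sym[OF c x] H_sym[OF c x]]
    by simp
  then show ?thesis
    unfolding 1 density_rate_zero[OF c x] stress_term_chart[OF c x] energy_density_chart[OF c x]
      metric_divergence_chart[OF c x] by simp
qed

end


section \<open>The divergence theorem on the manifold\<close>

definition C1_fun :: "('a, 'e::euclidean_space) atlas \<Rightarrow> ('a \<Rightarrow> real) \<Rightarrow> bool" where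
  "C1_fun A f \<longleftrightarrow> (\<forall>c\<in>A. C1_on (chart_image c) (\<lambda>x. f (chart_inv c x)))"

lemma continuous_from_charts:
  fixes A :: "('a::t2_space, 'e::euclidean_space) atlas" and f :: "'a \<Rightarrow> 'b::topological_space"
  assumes A: "smooth_atlas A" and f: "\<And>c. c \<in> A \<Longrightarrow> continuous_on (chart_image c) (\<lambda>x. f (chart_inv c x))"
  shows "continuous_on UNIV f"
proof (rule continuous_at_imp_continuous_on, rule ballI)
  fix p
  obtain c where c: "c \<in> charts_at A p" using atlas_ex_chart[OF A] by blast
  then have cA: "c \<in> A" and p: "p \<in> fst c" by (auto simp: charts_at_def)
  have "continuous_on (fst c) (snd c)" "snd c ` fst c \<subseteq> chart_image c"
    using chart_homeomorphism[OF A cA] by (auto simp: homeomorphism_def)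
  then have "continuous_on (fst c) (\<lambda>q. f (chart_inv c (snd c q)))"
    by (intro continuous_on_compose2[OF f[OF cA]])
  then have "continuous_on (fst c) f"
    by (rule continuous_on_eq) (simp add: chart_in[OF A cA])
  then show "isCont f p"
    using p open_chart_domain[OF A cA] continuous_on_eq_continuous_at by blast
qed

lemma C1_fun_continuous: 
  fixes A :: "('a::t2_space, 'e::euclidean_space) atlas"
  shows "smooth_atlas A \<Longrightarrow> C1_fun A f \<Longrightarrow> continuous_on UNIV f"
  unfolding C1_fun_def by (intro continuous_from_charts C1_on_imp_continuous_on) auto

lemma integrable_on_compact_riemannian_volume:
  fixes A :: "('a::{second_countable_topology, t2_space}, real^'m) atlas" and f :: "'a \<Rightarrow> real"
  assumes A: "smooth_atlas A" and g: "riemannian_metric A g" and K: "compact K" and f: "continuous_on K f"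
  shows "integrable (riemannian_volume A g) (\<lambda>p. indicator K p *\<^sub>R f p)"
proof -
  let ?V = "riemannian_volume A g"
  note sets = sets_riemannian_volume[OF A g]
  have Kb: "K \<in> sets borel" using compact_imp_closed[OF K] by simp
  obtain C where C: "\<And>p. p \<in> K \<Longrightarrow> norm (f p) \<le> C"
    using compact_imp_bounded[OF compact_continuous_image[OF f K]] unfolding bounded_iff by auto
  have "(\<lambda>p. indicator K p *\<^sub>R f p) \<in> borel_measurable borel"
    by (rule borel_measurable_continuous_on_indicator[OF Kb f])
  then have m: "(\<lambda>p. indicator K p *\<^sub>R f p) \<in> borel_measurable ?V"
    by (simp cong: measurable_cong_sets add: sets)
  show ?thesis
    by (rule integrableI_bounded_set[where A = K and B = C])
       (use Kb m C emeasure_riemannian_volume_compact[OF A g K] in \<open>auto simp: sets\<close>)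
qed

text \<open>A bump function is written down in one chart; it is continuously differentiable across the boundary of
  its chart because its support is compact, hence closed.\<close>

lemma exists_bump_function:
  fixes A :: "('a::t2_space, 'e::euclidean_space) atlas"
  assumes A: "smooth_atlas A"
  shows "\<exists>c K b. c \<in> A \<and> compact K \<and> K \<subseteq> chart_image c \<and> C1_fun A b \<and> (\<forall>q. b q \<ge> 0) \<and> b p > 0 \<and>
    (\<forall>q. q \<notin> chart_inv c ` K \<longrightarrow> b q = 0)"
proof -
  obtain c where c: "c \<in> charts_at A p" using atlas_ex_chart[OF A] by blast
  then have cA: "c \<in> A" and p: "p \<in> fst c" by (auto simp: charts_at_def)
  let ?a = "snd c p"
  obtain r where r: "r > 0" "cball ?a r \<subseteq> chart_image c"
    using open_contains_cball open_chart_image[OF A cA] chart_at_in(2)[OF A c] by blast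
  let ?s = "\<lambda>x. sqpos (r^2 - (x - ?a) \<bullet> (x - ?a))"
  define b where "b = (\<lambda>q. if q \<in> fst c then ?s (snd c q) else 0)"
  let ?Z = "chart_inv c ` cball ?a r"
  have "continuous_on (chart_image c) (chart_inv c)"
    using chart_homeomorphism[OF A cA] by (simp add: homeomorphism_def)
  then have "compact ?Z"
    by (intro compact_continuous_image compact_cball) (rule continuous_on_subset[OF _ r(2)])
  then have Z: "open (- ?Z)" using compact_imp_closed by blast
  have b0: "b q = 0" if q: "q \<notin> ?Z" for q
  proof (cases "q \<in> fst c")
    case True
    have "snd c q \<notin> cball ?a r" using q chart_in(1)[OF A cA True] by (metis imageI)
    then have "r < norm (snd c q - ?a)" by (simp add: dist_norm norm_minus_commute)
    then have "r^2 < (norm (snd c q - ?a))^2" using r(1) by (intro power_strict_mono) auto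
    then show ?thesis using True by (simp add: b_def sqpos_eq_0 power2_norm_eq_inner)
  qed (simp add: b_def)
  have "C1_on (chart_image d) (\<lambda>y. b (chart_inv d y))" if d: "d \<in> A" for d
  proof (rule C1_on_local)
    fix y assume y: "y \<in> chart_image d"
    show "\<exists>U f. open U \<and> y \<in> U \<and> C1_on U f \<and> (\<forall>z\<in>U. b (chart_inv d z) = f z)"
    proof (cases "chart_inv d y \<in> fst c")
      case True
      let ?U = "chart_image d \<inter> chart_inv d -` fst c"
      have U: "open ?U" by (rule open_chart_image_restrict(1)[OF A d open_chart_domain[OF A cA]])
      have "?U = snd d ` (fst d \<inter> fst c)" by (rule chart_image_restrict[OF A d, symmetric])
      then have "smooth_on ?U (transition d c)"
        using A d cA by (simp add: smooth_atlas_def)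
      from smooth_on_imp_C1_on[OF this]
      have "C1_on ?U (\<lambda>z. ?s (transition d c z))"
        by (intro C1_on_sqpos C1_on_diff C1_on_const C1_on_inner)
      then show ?thesis using U True y by (intro exI[of _ ?U] exI conjI) (auto simp: b_def transition_def)
    next
      case False
      let ?U = "chart_image d \<inter> chart_inv d -` (- ?Z)"
      have U: "open ?U" by (rule open_chart_image_restrict(1)[OF A d Z])
      have "?Z \<subseteq> fst c" using r(2) chart_inv_in(1)[OF A cA] by auto
      then have "y \<in> ?U" using False y by blast
      moreover have "\<forall>z\<in>?U. b (chart_inv d z) = 0" using b0 by blast
      ultimately show ?thesis using U C1_on_const[of ?U "0::real"] by blast
    qed
  qed
  then have "C1_fun A b" by (simp add: C1_fun_def)
  moreover have "b p > 0" using r(1) p by (simp add: b_def sqpos_pos_iff)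
  moreover have "b q \<ge> 0" for q by (simp add: b_def sqpos_nonneg)
  ultimately show ?thesis using cA r(2) b0 by (intro exI[of _ c] exI[of _ "cball ?a r"] exI[of _ b]) auto
qed

context variation
begin

lemma flow_derivative_chart:
  assumes c: "c \<in> A" and x: "x \<in> chart_image c" and f: "C1_fun A f"
  shows "flow_derivative \<phi> f (chart_inv c x) 
    = frechet_derivative (\<lambda>x. f (chart_inv c x)) (at x) (vf_chart X c x)"
proof -
  let ?f = "\<lambda>x. f (chart_inv c x)"
  obtain U where U: "open U" "0 \<in> U" "\<And>t. t \<in> U \<Longrightarrow> (t, x) \<in> flow_domain \<phi> c c"
    using eventually_flow_domain[OF A \<phi> c x] by blast
  have C1: "C1_on (chart_image c) ?f" using f c by (simp add: C1_fun_def)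
  note z = flow_domain_zero[OF A \<phi> c x]
  have "((\<lambda>t. ?f (flow_chart \<phi> c c t x)) has_vector_derivative frechet_derivative ?f (at x) (vf_chart X c x)) (at 0)"
    using has_vector_derivative_compose_C1[OF C1 flow_chart_in(4)[OF A c z(1)] flow_chart_time_derivative[OF A \<phi> c z(1)]]
    by (simp add: z(2))
  then have "((\<lambda>t. f (\<phi> t (chart_inv c x))) has_vector_derivative 
      frechet_derivative ?f (at x) (vf_chart X c x)) (at 0)"
    by (rule has_vector_derivative_transform_within_open[OF _ U(1,2)]) (simp add: flow_chart_in(6)[OF A c U(3)])
  then show ?thesis unfolding flow_derivative_def
    by (intro DERIV_imp_deriv) (simp add: has_real_derivative_iff_has_vector_derivative)
qed

text \<open>The divergence of the field \<open>f X\<close>.\<close>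

definition weighted_divergence :: "('a \<Rightarrow> real) \<Rightarrow> 'a \<Rightarrow> real" where
  "weighted_divergence f p = flow_derivative \<phi> f p + f p * metric_divergence A g X p"

lemma weighted_divergence_chart:
  assumes c: "c \<in> A" and x: "x \<in> chart_image c" and f: "C1_fun A f"
  shows "weighted_divergence f (chart_inv c x) = 
    frechet_derivative (\<lambda>x. f (chart_inv c x)) (at x) (vf_chart X c x)
      + f (chart_inv c x) * (trace (Q c x ** lie_matrix X c (G c) x) / 2)"
  by (simp add: weighted_divergence_def flow_derivative_chart[OF assms] metric_divergence_chart[OF c x])

lemma continuous_weighted_divergence:
  assumes f: "C1_fun A f" shows "continuous_on UNIV (weighted_divergence f)"
proof (rule continuous_from_charts[OF A])
  fix c assume c: "c \<in> A"
  have C1: "C1_on (chart_image c) (\<lambda>x. f (chart_inv c x))" using f c by (simp add: C1_fun_def)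
  have "continuous_on (chart_image c) (\<lambda>x. frechet_derivative (\<lambda>x. f (chart_inv c x)) (at x) (vf_chart X c x)
      + f (chart_inv c x) * (trace (Q c x ** lie_matrix X c (G c) x) * inverse 2))"
    by (intro continuous_on_add continuous_on_mult continuous_on_const continuous_on_trace continuous_on_matrix_mult
       continuous_on_frechet_derivative[OF C1] C1_on_imp_continuous_on[OF C1] C1_on_imp_continuous_on[OF C1_Q[OF c]]
       continuous_on_lie_matrix[OF X c C1_G[OF c]] C1_on_imp_continuous_on[OF C1_on_vf_chart[OF X c]]
       continuous_on_id) auto
  then show "continuous_on (chart_image c) (\<lambda>x. weighted_divergence f (chart_inv c x))"
    by (rule continuous_on_eq) (simp add: weighted_divergence_chart[OF c _ f])
qed

lemma ex_chart_point: "\<exists>c x. c \<in> A \<and> x \<in> chart_image c \<and> p = chart_inv c x"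
proof -
  obtain c where c: "c \<in> charts_at A p" using atlas_ex_chart[OF A] by blast
  then show ?thesis using chart_at_in[OF A c] charts_atD(1)[OF c] by metis
qed

lemma weighted_divergence_outside_support:
  assumes f: "C1_fun A f" and p: "p \<notin> vf_support X"
  shows "weighted_divergence f p = 0"
proof -
  obtain c x where c: "c \<in> A" and x: "x \<in> chart_image c" and px: "p = chart_inv c x"
    using ex_chart_point by blast
  have "linear (frechet_derivative (\<lambda>x. f (chart_inv c x)) (at x))"
    using f c x by (intro linear_frechet_derivative) (auto simp: C1_fun_def C1_on_iff)
  then show ?thesis
    using lie_matrix_outside_support[OF A X c x _ C1_G[OF c]] p px
    by (simp add: weighted_divergence_chart[OF c x f] linear_0 trace_def 
        bounded_bilinear.zero_right[OF bounded_bilinear_matrix_matrix_mult])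
qed

text \<open>By Jacobi's formula half the metric trace of \<open>L_X g\<close> is the divergence of \<open>X\<close> with respect to the volume
  density, so this is the divergence on Euclidean space of the density times \<open>s X\<close>.\<close>

lemma weighted_divergence_coords:
  assumes c: "c \<in> A" and x: "x \<in> chart_image c" and s: "C1_on (chart_image c) s"
  shows "vol_density A g c x * (frechet_derivative s (at x) (vf_chart X c x) 
      + s x * (trace (Q c x ** lie_matrix X c (G c) x) / 2))
    = (\<Sum>b\<in>Basis. frechet_derivative (\<lambda>y. (vol_density A g c y * s y) *\<^sub>R vf_chart X c y) (at x) b \<bullet> b)"
proof -
  let ?v = "vol_density A g c" and ?X = "vf_chart X c" and ?D = "vf_jac X c x"
  let ?G' = "frechet_derivative (G c) (at x)" and ?s' = "frechet_derivative s (at x)"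
  note Gx = invertible_gram_matrix[OF A g c x] and dpos = det_gram_matrix_pos[OF A g c x]
  have dG: "(G c has_derivative ?G') (at x)" by (rule C1_on_has_derivative[OF C1_G[OF c] x])
  have "((\<lambda>y. det (G c y)) has_derivative (\<lambda>w. det (G c x) * trace (Q c x ** ?G' w))) (at x)"
    by (rule has_derivative_compose[OF dG has_derivative_det[OF Gx]])
  moreover have "(sqrt has_derivative (\<lambda>r. inverse (sqrt (det (G c x))) / 2 * r)) (at (det (G c x)))"
    using DERIV_real_sqrt[OF dpos] by (simp only: has_field_derivative_def)
  ultimately have "(?v has_derivative (\<lambda>w. inverse (sqrt (det (G c x))) / 2 * (det (G c x) * trace (Q c x ** ?G' w)))) (at x)"
    unfolding vol_density_def by (rule has_derivative_compose)
  moreover have "inverse (sqrt (det (G c x))) / 2 * (det (G c x) * r) = ?v x / 2 * r" for r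
  proof -
    have "inverse (sqrt (det (G c x))) * det (G c x) = sqrt (det (G c x))"
      using dpos real_sqrt_mult_self[of "det (G c x)"] by (simp add: field_simps)
    then show ?thesis by (simp add: vol_density_def)
  qed
  ultimately have dv: "(?v has_derivative (\<lambda>w. ?v x / 2 * trace (Q c x ** ?G' w))) (at x)" 
    by (simp only:)
  have ds: "(s has_derivative ?s') (at x)" by (rule C1_on_has_derivative[OF s x])
  have dX: "(?X has_derivative (\<lambda>w. ?D *v w)) (at x)"
    by (rule has_derivative_eq_rhs[OF C1_on_has_derivative[OF C1_on_vf_chart[OF X c] x]])
      (rule ext, rule vf_jac_apply[OF X c x])
  let ?k = "\<lambda>w. ?v x * ?s' w + ?v x / 2 * trace (Q c x ** ?G' w) * s x"
  have dvs: "((\<lambda>y. ?v y * s y) has_derivative ?k) (at x)"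
    by (rule has_derivative_mult[OF dv ds])
  have "((\<lambda>y. (?v y * s y) *\<^sub>R ?X y) has_derivative (\<lambda>w. (?v x * s x) *\<^sub>R (?D *v w) + ?k w *\<^sub>R ?X x)) (at x)"
    by (rule has_derivative_scaleR[OF dvs dX])
  from frechet_derivative_at[OF this, symmetric]
  have "(\<Sum>b\<in>Basis. frechet_derivative (\<lambda>y. (?v y * s y) *\<^sub>R ?X y) (at x) b \<bullet> b)
    = (\<Sum>b\<in>Basis. ((?v x * s x) *\<^sub>R (?D *v b) + ?k b *\<^sub>R ?X x) \<bullet> b)" by simp
  also have "\<dots> = ?v x * s x * (\<Sum>b\<in>Basis. (?D *v b) \<bullet> b) + (\<Sum>b\<in>Basis. (?X x \<bullet> b) * ?k b)"
    by (simp add: inner_add_left sum.distrib sum_distrib_left mult.commute)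
  also have "(\<Sum>b\<in>Basis. (?X x \<bullet> b) * ?k b) = ?k (?X x)"
  proof -
    have l: "linear ?k" using has_derivative_linear[OF dvs] .
    have "?k (?X x) = ?k (\<Sum>b\<in>Basis. (?X x \<bullet> b) *\<^sub>R b)" by (simp only: euclidean_representation)
    also have "\<dots> = (\<Sum>b\<in>Basis. ?k ((?X x \<bullet> b) *\<^sub>R b))" by (rule linear_sum[OF l])
    also have "\<dots> = (\<Sum>b\<in>Basis. (?X x \<bullet> b) * ?k b)"
      by (rule sum.cong) (use linear_scale[OF l] in auto)
    finally show ?thesis by (rule sym)
  qed
  also have "(\<Sum>b\<in>Basis. (?D *v b) \<bullet> b) = trace ?D"
    by (simp add: Basis_vec_def UNION_singleton_eq_range sum.reindex inj_on_def axis_eq_axis inner_axis trace_def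
        matrix_vector_mul_component)
  finally have rhs: "(\<Sum>b\<in>Basis. frechet_derivative (\<lambda>y. (?v y * s y) *\<^sub>R ?X y) (at x) b \<bullet> b) 
    = ?v x * s x * trace ?D + ?k (?X x)" .
  have QG: "Q c x ** G c x = mat 1" "G c x ** Q c x = mat 1"
    using matrix_inv_left[OF Gx] matrix_inv_right[OF Gx] by auto
  have "trace (Q c x ** (transpose ?D ** G c x)) = trace ((transpose ?D ** G c x) ** Q c x)" by (rule trace_mul_sym)
  also have "\<dots> = trace ?D" by (simp add: QG trace_transpose flip: matrix_mul_assoc)
  finally have 1: "trace (Q c x ** (transpose ?D ** G c x)) = trace ?D" .
  have 2: "trace (Q c x ** (G c x ** ?D)) = trace ?D" by (simp add: matrix_mul_assoc QG)
  have "trace (Q c x ** lie_matrix X c (G c) x) = 2 * trace ?D + trace (Q c x ** ?G' (?X x))"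
    by (simp add: lie_matrix_def matrix_add_ldistrib trace_add 1 2)
  then show ?thesis unfolding rhs by (simp add: algebra_simps)
qed

text \<open>Extended by zero, the weighted field in the chart is continuously differentiable on the whole space.\<close>

lemma integral_weighted_divergence_chart:
  assumes f: "C1_fun A f" and c: "c \<in> A" and K: "compact K" "K \<subseteq> chart_image c"
    and f0: "\<And>p. p \<notin> chart_inv c ` K \<Longrightarrow> f p = 0"
  shows "(\<integral>p. weighted_divergence f p \<partial>riemannian_volume A g) = 0"
proof -
  let ?s = "\<lambda>x. f (chart_inv c x)"
  let ?W = "\<lambda>x. (vol_density A g c x * ?s x) *\<^sub>R vf_chart X c x"
  let ?V = "\<lambda>x. if x \<in> chart_image c then ?W x else 0"
  let ?Z = "chart_inv c ` K"
  have s: "C1_on (chart_image c) ?s" using f c by (simp add: C1_fun_def)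
  have "continuous_on (chart_image c) (chart_inv c)"
    using chart_homeomorphism[OF A c] by (simp add: homeomorphism_def)
  then have "compact ?Z"
    by (intro compact_continuous_image K(1)) (rule continuous_on_subset[OF _ K(2)])
  then have Z: "open (- ?Z)" using compact_imp_closed by blast
  have Kc: "open (- K)" using compact_imp_closed[OF K(1)] by blast
  have V0: "?V x = 0" if "x \<notin> K" for x
  proof (cases "x \<in> chart_image c")
    case True
    have "chart_inv c x \<notin> ?Z"
    proof
      assume "chart_inv c x \<in> ?Z"
      then obtain y where "y \<in> K" "chart_inv c x = chart_inv c y" by blast
      then have "x = y" using chart_inv_in(2)[OF A c] True K(2) by (metis subsetD)
      then show False using \<open>y \<in> K\<close> that by simp
    qed
    then show ?thesis using f0 by simp
  qed simp
  have W: "C1_on (chart_image c) ?W"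
    by (intro C1_on_scaleR C1_on_mult C1_on_vol_density[OF A g c] s C1_on_vf_chart[OF X c])
  have C1V: "C1_on UNIV ?V"
  proof (rule C1_on_local)
    fix x :: "real^'m"
    show "\<exists>U k. open U \<and> x \<in> U \<and> C1_on U k \<and> (\<forall>y\<in>U. ?V y = k y)"
    proof (cases "x \<in> chart_image c")
      case True
      then show ?thesis using W open_chart_image[OF A c] 
        by (intro exI[of _ "chart_image c"] exI[of _ ?W]) auto
    next
      case False
      then have "x \<in> - K" using K(2) by blast
      then show ?thesis using V0 Kc C1_on_const[of "- K" "0 :: real^'m"] 
        by (intro exI[of _ "- K"] exI[of _ "\<lambda>_. 0"]) blast
    qed
  qed
  have out: "weighted_divergence f p = 0" if p: "p \<notin> fst c" for p
  proof -
    obtain d y where d: "d \<in> A" and y: "y \<in> chart_image d" and py: "p = chart_inv d y"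
      using ex_chart_point by blast
    let ?U = "chart_image d \<inter> chart_inv d -` (- ?Z)"
    have "?Z \<subseteq> fst c" using K(2) chart_inv_in(1)[OF A c] by auto
    then have yU: "y \<in> ?U" using p y py by blast
    have U: "open ?U" by (rule open_chart_image_restrict(1)[OF A d Z])
    have "frechet_derivative (\<lambda>x. f (chart_inv d x)) (at y) = frechet_derivative (\<lambda>_. 0) (at y)"
      by (rule frechet_derivative_cong_open[OF U yU]) (use f0 in blast)
    moreover have "f (chart_inv d y) = 0" using f0 yU by blast
    ultimately show ?thesis by (simp add: py weighted_divergence_chart[OF d y f])
  qed
  have "(\<integral>p. weighted_divergence f p \<partial>riemannian_volume A g) 
     = (\<integral>x. indicator (chart_image c) x * vol_density A g c x * weighted_divergence f (chart_inv c x) \<partial>lborel)"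
    by (rule integral_riemannian_volume_chart[OF A g c borel_measurable_continuous_onI[OF continuous_weighted_divergence[OF f]] out])
  also have "\<dots> = (\<integral>x. (\<Sum>b\<in>Basis. frechet_derivative ?V (at x) b \<bullet> b) \<partial>lborel)"
  proof (rule Bochner_Integration.integral_cong[OF refl])
    fix x
    show "indicator (chart_image c) x * vol_density A g c x * weighted_divergence f (chart_inv c x)
      = (\<Sum>b\<in>Basis. frechet_derivative ?V (at x) b \<bullet> b)"
    proof (cases "x \<in> chart_image c")
      case True
      have "frechet_derivative ?V (at x) = frechet_derivative ?W (at x)"
        by (rule frechet_derivative_cong_open[OF open_chart_image[OF A c] True]) simp
      then show ?thesis
        using weighted_divergence_coords[OF c True s] True by (simp add: weighted_divergence_chart[OF c True f])
    next
      case False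
      then have "x \<in> - K" using K(2) by blast
      from frechet_derivative_cong_open[OF Kc this, of ?V "\<lambda>_. 0"] V0
      have "frechet_derivative ?V (at x) = (\<lambda>_. 0)" by auto
      then show ?thesis using False by simp
    qed
  qed
  also have "\<dots> = 0" by (rule integral_divergence_compact_support[OF C1V K(1) V0])
  finally show ?thesis .
qed

end


context variation
begin

text \<open>A partition of unity near the support of the field reduces the divergence theorem to a single chart. Only
  near the support do the weights have to add up to one, so the sum \<open>\<psi>\<close> of the bump functions may be
  altered to a positive function \<open>\<psi>'\<close> where it is small.\<close>

theorem integral_weighted_divergence:
  assumes f: "C1_fun A f"
  shows "integrable (riemannian_volume A g) (weighted_divergence f)"
    and "(\<integral>p. weighted_divergence f p \<partial>riemannian_volume A g) = 0"
proof -
  let ?V = "riemannian_volume A g" and ?S = "vf_support X"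
  have intgl: "integrable ?V (weighted_divergence k)" if k: "C1_fun A k" for k
  proof -
    have "integrable ?V (\<lambda>p. indicator ?S p *\<^sub>R weighted_divergence k p)"
      by (rule integrable_on_compact_riemannian_volume[OF A g supp 
          continuous_on_subset[OF continuous_weighted_divergence[OF k]]]) simp
    moreover have "(\<lambda>p. indicator ?S p *\<^sub>R weighted_divergence k p) = weighted_divergence k"
      using weighted_divergence_outside_support[OF k] by (auto simp: indicator_def fun_eq_iff)
    ultimately show ?thesis by simp
  qed
  show "integrable ?V (weighted_divergence f)" by (rule intgl[OF f])
  have "\<forall>p. \<exists>c K b. c \<in> A \<and> compact K \<and> K \<subseteq> chart_image c \<and> C1_fun A b \<and> (\<forall>q. b q \<ge> 0) \<and> b p > 0 \<and>
    (\<forall>q. q \<notin> chart_inv c ` K \<longrightarrow> b q = 0)"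
    using exists_bump_function[OF A] by blast
  then obtain c K b where b: "\<And>p. c p \<in> A" "\<And>p. compact (K p)" "\<And>p. K p \<subseteq> chart_image (c p)" 
    "\<And>p. C1_fun A (b p)" "\<And>p q. b p q \<ge> 0" "\<And>p. b p p > 0" 
    "\<And>p q. q \<notin> chart_inv (c p) ` K p \<Longrightarrow> b p q = 0"
    by metis
  have bcont: "continuous_on UNIV (b p)" for p by (rule C1_fun_continuous[OF A b(4)])
  have "open {q. 0 < b p q}" for p
    by (rule open_Collect_less[OF continuous_on_const bcont])
  then obtain P where P: "finite P" "?S \<subseteq> (\<Union>p\<in>P. {q. 0 < b p q})"
    using compactE_image[OF supp, of UNIV "\<lambda>p. {q. 0 < b p q}"] b(6) by (metis (no_types, lifting) UNIV_I UN_I mem_Collect_eq subsetI)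
  define \<psi> where "\<psi> = (\<lambda>q. \<Sum>p\<in>P. b p q)"
  have \<psi>cont: "continuous_on UNIV \<psi>" unfolding \<psi>_def by (intro continuous_on_sum bcont)
  have \<psi>0: "\<psi> q \<ge> 0" for q unfolding \<psi>_def by (rule sum_nonneg) (rule b(5))
  have \<psi>pos: "\<psi> q > 0" if "q \<in> ?S" for q
  proof -
    obtain p where "p \<in> P" "0 < b p q" using P(2) \<open>q \<in> ?S\<close> by blast
    then show ?thesis unfolding \<psi>_def by (rule sum_pos2[OF P(1)]) (rule b(5))
  qed
  obtain s where s: "s > 0" "\<And>q. q \<in> ?S \<Longrightarrow> s < \<psi> q"
  proof (cases "?S = {}")
    case False
    obtain q0 where q0: "q0 \<in> ?S" "\<And>q. q \<in> ?S \<Longrightarrow> \<psi> q0 \<le> \<psi> q"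
      using continuous_attains_inf[OF supp False continuous_on_subset[OF \<psi>cont]] by auto
    have "\<psi> q0 / 2 < \<psi> q" if "q \<in> ?S" for q using q0(2)[OF that] \<psi>pos[OF q0(1)] by simp
    then show ?thesis using that[of "\<psi> q0 / 2"] \<psi>pos[OF q0(1)] by simp
  qed (use that[of 1] in auto)
  define \<psi>' where "\<psi>' = (\<lambda>q. \<psi> q + sqpos (s - \<psi> q))"
  have \<psi>'pos: "\<psi>' q > 0" for q
  proof (cases "\<psi> q = 0")
    case True
    then show ?thesis using s(1) by (simp add: \<psi>'_def sqpos_pos_iff)
  next
    case False
    then show ?thesis using \<psi>0[of q] sqpos_nonneg[of "s - \<psi> q"] by (simp add: \<psi>'_def)
  qed
  have \<psi>'_eq: "\<psi>' q = \<psi> q" if "s < \<psi> q" for q using that by (simp add: \<psi>'_def sqpos_eq_0)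
  define k where "k = (\<lambda>p q. b p q * (f q * inverse (\<psi>' q)))"
  have C1\<psi>': "C1_on (chart_image d) (\<lambda>x. \<psi>' (chart_inv d x))" if "d \<in> A" for d
    unfolding \<psi>'_def \<psi>_def using b(4) that 
    by (intro C1_on_add C1_on_sqpos C1_on_diff C1_on_sum C1_on_const) (auto simp: C1_fun_def)
  have k: "C1_fun A (k p)" for p
    unfolding C1_fun_def k_def
  proof (intro ballI C1_on_mult C1_on_inverse C1\<psi>')
    fix d assume "d \<in> A"
    then show "C1_on (chart_image d) (\<lambda>x. b p (chart_inv d x))" "C1_on (chart_image d) (\<lambda>x. f (chart_inv d x))"
      using b(4) f by (auto simp: C1_fun_def)
    show "\<psi>' (chart_inv d x) \<noteq> 0" for x using \<psi>'pos by (simp add: less_imp_neq[symmetric])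
  qed
  have zero: "(\<integral>p. weighted_divergence (k p0) p \<partial>?V) = 0" for p0
    by (rule integral_weighted_divergence_chart[OF k b(1)[of p0] b(2)[of p0] b(3)]) (simp add: k_def b(7))
  have eq: "weighted_divergence f q = (\<Sum>p\<in>P. weighted_divergence (k p) q)" for q
  proof (cases "q \<in> ?S")
    case False
    then show ?thesis by (simp add: weighted_divergence_outside_support f k)
  next
    case True
    obtain d x where d: "d \<in> A" and x: "x \<in> chart_image d" and qx: "q = chart_inv d x"
      using ex_chart_point by blast
    have sumk: "(\<Sum>p\<in>P. k p q) = f q" if "s < \<psi> q" for q
    proof -
      have "(\<Sum>p\<in>P. k p q) = \<psi> q * (f q * inverse (\<psi>' q))"
        by (simp add: k_def \<psi>_def sum_distrib_right)
      then show ?thesis using \<psi>'_eq[OF that] \<psi>'pos[of q] by simp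
    qed
    let ?W = "{q. s < \<psi> q}" let ?U = "chart_image d \<inter> chart_inv d -` ?W"
    have "open ?W" by (rule open_Collect_less[OF continuous_on_const \<psi>cont])
    then have U: "open ?U" by (rule open_chart_image_restrict(1)[OF A d])
    have xU: "x \<in> ?U" using x s(2)[OF True] qx by simp
    have "frechet_derivative (\<lambda>x. f (chart_inv d x)) (at x) 
        = frechet_derivative (\<lambda>x. \<Sum>p\<in>P. k p (chart_inv d x)) (at x)"
      by (rule frechet_derivative_cong_open[OF U xU]) (simp add: sumk)
    also have "\<dots> = (\<lambda>v. \<Sum>p\<in>P. frechet_derivative (\<lambda>x. k p (chart_inv d x)) (at x) v)"
      by (rule frechet_derivative_at[symmetric], rule has_derivative_sum, rule C1_on_has_derivative[OF _ x])
        (use k d in \<open>simp add: C1_fun_def\<close>)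
    finally show ?thesis
      using sumk[of q] s(2)[OF True] unfolding qx weighted_divergence_chart[OF d x f] weighted_divergence_chart[OF d x k]
      by (simp add: sum.distrib flip: sum_distrib_right sum_divide_distrib)
  qed
  have "(\<integral>p. weighted_divergence f p \<partial>?V) = (\<Sum>p0\<in>P. (\<integral>p. weighted_divergence (k p0) p \<partial>?V))"
    unfolding eq by (rule Bochner_Integration.integral_sum) (rule intgl[OF k])
  then show "(\<integral>p. weighted_divergence f p \<partial>?V) = 0" by (simp add: zero)
qed


section \<open>Differentiation under the integral\<close>

lemma continuous_density_rate:
  assumes c: "c \<in> A"
  shows "continuous_on (flow_domain \<phi> c c) (\<lambda>y. density_rate c (fst y) (snd y))"
proof -
  have Qc: "continuous_on (flow_domain \<phi> c c) (\<lambda>y. Q c (snd y))"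
    by (rule continuous_on_compose2[OF C1_on_imp_continuous_on[OF C1_Q[OF c]]])
      (auto simp: flow_domain_def intro!: continuous_intros)
  have "continuous_on (flow_domain \<phi> c c) (\<lambda>y. density_rate c (fst y) (snd y) * 2)"
    unfolding density_rate_def Let_def divide_inverse mult.assoc
    by (intro continuous_on_mult continuous_on_const continuous_on_trace continuous_on_matrix_mult continuous_on_transpose Qc
        continuous_on_flow_gram[OF A \<phi> c C1_on_imp_continuous_on[OF C1_H[OF c]]] continuous_on_flow_jac[OF A \<phi> c]
        continuous_on_along_flow[OF A \<phi> c continuous_on_lie_matrix[OF X c C1_H[OF c]]])
  from continuous_on_mult[OF this continuous_on_const, of "inverse 2"] show ?thesis by simp
qed

lemma continuous_energy_density_flow:
  assumes c: "c \<in> A"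
  shows "continuous_on (flow_domain \<phi> c c) (\<lambda>y. energy_density A g B h (u \<circ> \<phi> (fst y)) (chart_inv c (snd y)))"
proof -
  have Qc: "continuous_on (flow_domain \<phi> c c) (\<lambda>y. Q c (snd y))"
    by (rule continuous_on_compose2[OF C1_on_imp_continuous_on[OF C1_Q[OF c]]])
      (auto simp: flow_domain_def intro!: continuous_intros)
  have "continuous_on (flow_domain \<phi> c c) (\<lambda>y. cube_trace (Q c (snd y)) (flow_gram \<phi> c (H c) (fst y) (snd y)) * inverse 6)"
    unfolding cube_trace_def
    by (intro continuous_on_mult continuous_on_const continuous_on_trace continuous_on_matrix_mult Qc
        continuous_on_flow_gram[OF A \<phi> c C1_on_imp_continuous_on[OF C1_H[OF c]]])
  then show ?thesis
    by (rule continuous_on_eq) (use energy_density_flow_chart[OF c] in auto)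
qed

text \<open>In a chart the rate is continuous in time and space, hence bounded on a compact product neighbourhood.
  This neighbourhood keeps the flow inside the chart.\<close>

lemma energy_density_flow_local:
  "\<exists>V \<epsilon> C. open V \<and> p0 \<in> V \<and> \<epsilon> > 0 \<and> C \<ge> 0 \<and>
    (\<forall>t p. \<bar>t\<bar> < \<epsilon> \<longrightarrow> p \<in> V \<longrightarrow> (\<exists>D. ((\<lambda>t. energy_density A g B h (u \<circ> \<phi> t) p) has_real_derivative D) (at t) \<and> \<bar>D\<bar> \<le> C)) \<and>
    (\<forall>t. \<bar>t\<bar> < \<epsilon> \<longrightarrow> continuous_on V (energy_density A g B h (u \<circ> \<phi> t)))"
proof -
  obtain c x where c: "c \<in> A" and x: "x \<in> chart_image c" and p0: "p0 = chart_inv c x"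
    using ex_chart_point by blast
  note D = open_flow_domain[OF A \<phi> c c]
  obtain S W where SW: "open S" "open W" "(0, x) \<in> S \<times> W" "S \<times> W \<subseteq> flow_domain \<phi> c c"
    using open_prod_elim[OF D flow_domain_zero(1)[OF A \<phi> c x]] by blast
  obtain \<epsilon> where \<epsilon>: "\<epsilon> > 0" "cball 0 \<epsilon> \<subseteq> S" using SW(1,3) open_contains_cball[of S] by blast
  obtain r where r: "r > 0" "cball x r \<subseteq> W" using SW(2,3) open_contains_cball[of W] by blast
  have sub: "cball 0 \<epsilon> \<times> cball x r \<subseteq> flow_domain \<phi> c c" using \<epsilon> r SW(4) by blast
  have "compact ((\<lambda>y. density_rate c (fst y) (snd y)) ` (cball 0 \<epsilon> \<times> cball x r))"
    by (intro compact_continuous_image continuous_on_subset[OF continuous_density_rate[OF c] sub] compact_Times compact_cball)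
  then have "bounded ((\<lambda>y. density_rate c (fst y) (snd y)) ` (cball 0 \<epsilon> \<times> cball x r))"
    by (rule compact_imp_bounded)
  then obtain C where C0: "\<forall>z\<in>(\<lambda>y. density_rate c (fst y) (snd y)) ` (cball 0 \<epsilon> \<times> cball x r). norm z \<le> C"
    unfolding bounded_iff by blast
  have C: "\<bar>density_rate c t y\<bar> \<le> C" if "t \<in> cball 0 \<epsilon>" "y \<in> cball x r" for t y 
    using C0[rule_format, OF imageI, of "(t, y)"] that by simp
  let ?V = "fst c \<inter> snd c -` ball x r"
  have cont: "continuous_on (fst c) (snd c)" using chart_homeomorphism[OF A c] by (simp add: homeomorphism_def)
  have V: "open ?V" 
    using cont continuous_on_open_vimage[OF open_chart_domain[OF A c]] by (metis Int_commute open_ball)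
  have p0V: "p0 \<in> ?V" using chart_inv_in[OF A c x] r(1) p0 by simp
  have dom: "(t, snd c p) \<in> flow_domain \<phi> c c" if "\<bar>t\<bar> < \<epsilon>" "p \<in> ?V" for t p
    using that sub by (auto simp: subset_iff dist_real_def)
  have "\<exists>D. ((\<lambda>t. energy_density A g B h (u \<circ> \<phi> t) p) has_real_derivative D) (at t) \<and> \<bar>D\<bar> \<le> max 0 C"
    if tp: "\<bar>t\<bar> < \<epsilon>" "p \<in> ?V" for t p
  proof (intro exI conjI)
    show "((\<lambda>t. energy_density A g B h (u \<circ> \<phi> t) p) has_real_derivative density_rate c t (snd c p)) (at t)"
      using energy_density_time_derivative[OF c dom[OF tp]] chart_in(1)[OF A c] tp(2) by simp
    show "\<bar>density_rate c t (snd c p)\<bar> \<le> max 0 C"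
      using C[of t "snd c p"] tp by (auto simp: dist_real_def)
  qed
  moreover have "continuous_on ?V (energy_density A g B h (u \<circ> \<phi> t))" if t: "\<bar>t\<bar> < \<epsilon>" for t
  proof -
    have "continuous_on ?V (\<lambda>p. (\<lambda>y. energy_density A g B h (u \<circ> \<phi> (fst y)) (chart_inv c (snd y))) (t, snd c p))"
      by (rule continuous_on_compose2[OF continuous_energy_density_flow[OF c]])
         (use dom[OF t] in \<open>auto intro!: continuous_on_Pair continuous_on_const continuous_on_subset[OF cont]\<close>)
    then show ?thesis by (rule continuous_on_eq) (simp add: chart_in(1)[OF A c])
  qed
  ultimately show ?thesis using V p0V \<epsilon>(1)
    by (intro exI[of _ ?V] exI[of _ \<epsilon>] exI[of _ "max 0 C"]) auto
qed

lemma energy_density_flow_compact: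
  assumes K: "compact K"
  shows "\<exists>\<epsilon> C. \<epsilon> > 0 \<and>
    (\<forall>t p. \<bar>t\<bar> < \<epsilon> \<longrightarrow> p \<in> K \<longrightarrow> (\<exists>D. ((\<lambda>t. energy_density A g B h (u \<circ> \<phi> t) p) has_real_derivative D) (at t) \<and> \<bar>D\<bar> \<le> C)) \<and>
    (\<forall>t. \<bar>t\<bar> < \<epsilon> \<longrightarrow> continuous_on K (energy_density A g B h (u \<circ> \<phi> t)))"
proof -
  let ?E = "\<lambda>t. energy_density A g B h (u \<circ> \<phi> t)"
  obtain V \<epsilon> C where V: "\<And>p. open (V p)" "\<And>p. p \<in> V p" "\<And>p. \<epsilon> p > 0" "\<And>p. C p \<ge> 0"
    and der: "\<And>p0 t p. \<bar>t\<bar> < \<epsilon> p0 \<Longrightarrow> p \<in> V p0 \<Longrightarrow> \<exists>D. ((\<lambda>t. ?E t p) has_real_derivative D) (at t) \<and> \<bar>D\<bar> \<le> C p0"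
    and cont: "\<And>p0 t. \<bar>t\<bar> < \<epsilon> p0 \<Longrightarrow> continuous_on (V p0) (?E t)"
    using energy_density_flow_local by metis
  obtain P where P: "finite P" "K \<subseteq> (\<Union>p\<in>P. V p)"
    using compactE_image[OF K, of UNIV V] V by (metis UNIV_I UN_iff subsetI)
  define e where "e = Min (insert 1 (\<epsilon> ` P))"
  have e: "e > 0" using P(1) V(3) by (simp add: e_def)
  have e_le: "e \<le> \<epsilon> p" if "p \<in> P" for p using P(1) that by (simp add: e_def)
  have C_le: "C p \<le> sum C P" if "p \<in> P" for p using member_le_sum[OF that, of C] V(4) P(1) by simp
  have "\<exists>D. ((\<lambda>t. ?E t p) has_real_derivative D) (at t) \<and> \<bar>D\<bar> \<le> sum C P" if "\<bar>t\<bar> < e" "p \<in> K" for t p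
  proof -
    obtain p0 where p0: "p0 \<in> P" "p \<in> V p0" using P(2) \<open>p \<in> K\<close> by blast
    then show ?thesis using der[of t p0 p] e_le[OF p0(1)] C_le[OF p0(1)] that(1) by force
  qed
  moreover have "continuous_on K (?E t)" if t: "\<bar>t\<bar> < e" for t
  proof -
    have "continuous_on (V p) (?E t)" if "p \<in> P" for p using cont e_le[OF that] t by simp
    then have "continuous_on (\<Union>p\<in>P. V p) (?E t)"
      by (intro continuous_on_open_UN) (auto simp: V(1))
    then show ?thesis by (rule continuous_on_subset[OF _ P(2)])
  qed
  ultimately show ?thesis using e by blast
qed

end

text \<open>Difference quotients are bounded by the mean value theorem, so dominated convergence applies.\<close>

lemma has_real_derivative_set_integral:
  fixes E :: "real \<Rightarrow> 'a \<Rightarrow> real"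
  assumes K: "K \<in> sets M" "emeasure M K < \<infinity>" and "\<epsilon> > 0"
    and int: "\<And>t. \<bar>t\<bar> < \<epsilon> \<Longrightarrow> integrable M (\<lambda>p. indicator K p *\<^sub>R E t p)"
    and der: "\<And>t p. \<bar>t\<bar> < \<epsilon> \<Longrightarrow> p \<in> K \<Longrightarrow> \<exists>D. ((\<lambda>t. E t p) has_real_derivative D) (at t) \<and> \<bar>D\<bar> \<le> C"
  shows "((\<lambda>t. LINT p:K|M. E t p) has_real_derivative (LINT p:K|M. deriv (\<lambda>t. E t p) 0)) (at 0)"
proof -
  let ?I = "{-\<epsilon><..<\<epsilon>}" and ?D = "\<lambda>p. deriv (\<lambda>t. E t p) 0"
  have d0: "((\<lambda>t. E t p) has_real_derivative ?D p) (at 0)" if "p \<in> K" for p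
    using der[of 0 p] that \<open>\<epsilon> > 0\<close> DERIV_imp_deriv by fastforce
  have lim: "((\<lambda>t. ((LINT p:K|M. E t p) - (LINT p:K|M. E 0 p)) / (t - 0)) \<longlongrightarrow> (LINT p:K|M. ?D p)) (at 0 within ?I)"
    unfolding tendsto_at_iff_sequentially comp_def
  proof (intro allI impI)
    fix \<tau> :: "nat \<Rightarrow> real" assume \<tau>: "\<forall>i. \<tau> i \<in> ?I - {0}" "\<tau> \<longlonglongrightarrow> 0"
    have \<tau>': "\<bar>\<tau> n\<bar> < \<epsilon>" "\<tau> n \<noteq> 0" for n using \<tau>(1) by (auto simp: abs_less_iff) (metis minus_less_iff)+
    define q where "q = (\<lambda>n p. (indicator K p *\<^sub>R E (\<tau> n) p - indicator K p *\<^sub>R E 0 p) / \<tau> n)"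
    have intq: "integrable M (q n)" for n
      unfolding q_def by (intro integrable_divide Bochner_Integration.integrable_diff int) (use \<tau>' \<open>\<epsilon> > 0\<close> in auto)
    have q_lim: "(\<lambda>n. q n p) \<longlonglongrightarrow> indicator K p *\<^sub>R ?D p" for p
    proof (cases "p \<in> K")
      case True
      have "((\<lambda>t. (E t p - E 0 p) / (t - 0)) \<longlongrightarrow> ?D p) (at 0)"
        using d0[OF True] by (simp add: has_field_derivative_iff)
      moreover have "filterlim \<tau> (at 0) sequentially"
        using \<tau>(2) \<tau>'(2) by (simp add: filterlim_at)
      ultimately have "(\<lambda>n. (E (\<tau> n) p - E 0 p) / (\<tau> n - 0)) \<longlonglongrightarrow> ?D p" by (rule filterlim_compose)
      then show ?thesis using True by (simp add: q_def)
    qed (simp add: q_def)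
    have "(\<lambda>n. \<integral>p. q n p \<partial>M) \<longlonglongrightarrow> (\<integral>p. indicator K p *\<^sub>R ?D p \<partial>M)"
    proof (rule integral_dominated_convergence[where w = "\<lambda>p. indicator K p *\<^sub>R C"])
      show "(\<lambda>p. indicator K p *\<^sub>R ?D p) \<in> borel_measurable M"
        by (rule borel_measurable_LIMSEQ_real[OF q_lim]) (use intq in auto)
      show "q n \<in> borel_measurable M" for n using intq by auto
      show "integrable M (\<lambda>p. indicator K p *\<^sub>R C)"
        using K by (intro integrable_scaleR_left integrable_real_indicator) auto
      show "AE p in M. (\<lambda>n. q n p) \<longlonglongrightarrow> indicator K p *\<^sub>R ?D p" using q_lim by simp
      show "AE p in M. norm (q n p) \<le> indicator K p *\<^sub>R C" for n
      proof (rule AE_I2)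
        fix p
        show "norm (q n p) \<le> indicator K p *\<^sub>R C"
        proof (cases "p \<in> K")
          case True
          define D where "D = deriv (\<lambda>t. E t p)"
          have D: "((\<lambda>t. E t p) has_real_derivative D t) (at t)" "\<bar>D t\<bar> \<le> C" if t: "\<bar>t\<bar> < \<epsilon>" for t
          proof -
            obtain d where d: "((\<lambda>t. E t p) has_real_derivative d) (at t)" "\<bar>d\<bar> \<le> C"
              using der[OF t True] by blast
            then show "((\<lambda>t. E t p) has_real_derivative D t) (at t)" "\<bar>D t\<bar> \<le> C"
              using DERIV_imp_deriv[OF d(1)] by (simp_all add: D_def)
          qed
          have "norm (E (\<tau> n) p - E 0 p) \<le> C * norm (\<tau> n - 0)"
            by (rule field_differentiable_bound[where S = ?I and f' = D])
               (use D(2) \<tau>'[of n] \<open>\<epsilon> > 0\<close> in \<open>auto intro!: DERIV_subset[OF D(1)] simp: abs_less_iff\<close>)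
          then show ?thesis using True \<tau>'(2)[of n] by (simp add: q_def divide_le_eq)
        qed (simp add: q_def)
      qed
    qed
    moreover have "(\<integral>p. q n p \<partial>M) = ((LINT p:K|M. E (\<tau> n) p) - (LINT p:K|M. E 0 p)) / (\<tau> n - 0)" for n
      unfolding q_def set_lebesgue_integral_def
      using int[OF \<tau>'(1)[of n]] int[of 0] \<open>\<epsilon> > 0\<close> by simp
    ultimately show "(\<lambda>n. ((LINT p:K|M. E (\<tau> n) p) - (LINT p:K|M. E 0 p)) / (\<tau> n - 0)) \<longlonglongrightarrow> (LINT p:K|M. ?D p)"
      by (simp add: set_lebesgue_integral_def)
  qed
  have "at (0::real) within ?I = at 0" using \<open>\<epsilon> > 0\<close> by (intro at_within_open) auto
  with lim show ?thesis by (simp add: has_field_derivative_iff)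
qed


section \<open>The first variation formula\<close>

theorem theorem2p8:
  fixes A :: "('a::{second_countable_topology, t2_space}, real^'m::finite) atlas"
    and g :: "('a, real^'m) tensor2"
    and B :: "('b::{second_countable_topology, t2_space}, real^'n::finite) atlas"
    and h :: "('b, real^'n) tensor2"
    and u :: "'a \<Rightarrow> 'b"
    and X :: "'a \<Rightarrow> ('a, real^'m) tvec"
    and \<phi> :: "real \<Rightarrow> 'a \<Rightarrow> 'a"
    and K :: "'a set"
  assumes "smooth_atlas A" and "riemannian_metric A g"
    and "smooth_atlas B" and "riemannian_metric B h"
    and "smooth_map A B u"
    and "smooth_vector_field A X" and "compact (vf_support X)"
    and "is_flow A X \<phi>"
    and "compact K" and "vf_support X \<subseteq> K"
  shows "((\<lambda>t. Phi3_energy_on A g B h K (u \<circ> \<phi> t)) has_real_derivative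
          - (LINT p|riemannian_volume A g.
               tensor_inner A g (stress_energy A g B h u)
                 (\<lambda>q v w. 1 / 2 * lie_derivative A X g q v w) p)) (at 0)"
proof -
  interpret variation A g B h u X \<phi> by unfold_locales (rule assms)+
  let ?V = "riemannian_volume A g" and ?E = "\<lambda>t. energy_density A g B h (u \<circ> \<phi> t)"
  let ?f = "energy_density A g B h u"
  have f: "C1_fun A ?f" using C1_energy_density by (simp add: C1_fun_def)
  obtain \<epsilon> C where \<epsilon>: "\<epsilon> > 0"
    and der: "\<And>t p. \<bar>t\<bar> < \<epsilon> \<Longrightarrow> p \<in> K \<Longrightarrow> \<exists>D. ((\<lambda>t. ?E t p) has_real_derivative D) (at t) \<and> \<bar>D\<bar> \<le> C"
    and cont: "\<And>t. \<bar>t\<bar> < \<epsilon> \<Longrightarrow> continuous_on K (?E t)"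
    using energy_density_flow_compact[OF \<open>compact K\<close>] by blast
  have "K \<in> sets ?V" using compact_imp_closed[OF \<open>compact K\<close>] by (simp add: sets_riemannian_volume[OF A g])
  from has_real_derivative_set_integral[OF this emeasure_riemannian_volume_compact[OF A g \<open>compact K\<close>] \<epsilon>
      integrable_on_compact_riemannian_volume[OF A g \<open>compact K\<close> cont] der]
  have deriv: "((\<lambda>t. Phi3_energy_on A g B h K (u \<circ> \<phi> t)) has_real_derivative 
      (LINT p:K|?V. deriv (\<lambda>t. ?E t p) 0)) (at 0)"
    by (simp add: Phi3_energy_on_def energy_density_def)
  \<comment> \<open>Up to the divergence of the density times the field, the rate is minus the stress term.\<close>
  have rate: "deriv (\<lambda>t. ?E t p) 0 = weighted_divergence ?f p - stress_term p" for p
  proof -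
    obtain c x where c: "c \<in> A" and x: "x \<in> chart_image c" and px: "p = chart_inv c x"
      using ex_chart_point by blast
    have "deriv (\<lambda>t. ?E t p) 0 = density_rate c 0 x"
      unfolding px by (rule DERIV_imp_deriv[OF energy_density_time_derivative[OF c flow_domain_zero(1)[OF A \<phi> c x]]])
    then show ?thesis
      using density_rate_plus_stress_term[OF c x] 
      by (simp add: weighted_divergence_def flow_derivative_chart[OF c x f] px)
  qed
  have stress0: "stress_term p = 0" if "p \<notin> vf_support X" for p
  proof -
    obtain c x where c: "c \<in> A" and x: "x \<in> chart_image c" and px: "p = chart_inv c x"
      using ex_chart_point by blast
    then show ?thesis
      using lie_matrix_outside_support(2)[OF A X c x _ C1_G[OF c]] that
      by (simp add: stress_term_chart[OF c x] trace_def bounded_bilinear.zero_right[OF bounded_bilinear_matrix_matrix_mult])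
  qed
  have "continuous_on UNIV stress_term"
  proof (rule continuous_from_charts[OF A])
    fix c assume c: "c \<in> A"
    have "continuous_on (chart_image c) (\<lambda>x. cube_trace (Q c x) (H c x) * inverse 6 * (trace (Q c x ** lie_matrix X c (G c) x) * inverse 2) 
      - trace (R c x ** R c x ** R c x ** Q c x ** lie_matrix X c (G c) x) * inverse 2)"
      unfolding cube_trace_def
      by (intro continuous_on_diff continuous_on_mult continuous_on_const continuous_on_trace continuous_on_matrix_mult
        C1_on_imp_continuous_on[OF C1_Q[OF c]] C1_on_imp_continuous_on[OF C1_H[OF c]] 
        continuous_on_lie_matrix[OF X c C1_G[OF c]])
    then show "continuous_on (chart_image c) (\<lambda>x. stress_term (chart_inv c x))"
      by (rule continuous_on_eq) (simp add: stress_term_chart[OF c])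
  qed
  then have "integrable ?V (\<lambda>p. indicator (vf_support X) p *\<^sub>R stress_term p)"
    by (intro integrable_on_compact_riemannian_volume[OF A g supp]) (rule continuous_on_subset, auto)
  moreover have "(\<lambda>p. indicator (vf_support X) p *\<^sub>R stress_term p) = stress_term"
    using stress0 by (auto simp: indicator_def fun_eq_iff)
  ultimately have stress_int: "integrable ?V stress_term" by simp
  have ind: "indicator K p *\<^sub>R (weighted_divergence ?f p - stress_term p) = weighted_divergence ?f p - stress_term p" for p
  proof (cases "p \<in> K")
    case False
    then have "p \<notin> vf_support X" using \<open>vf_support X \<subseteq> K\<close> by blast
    then show ?thesis by (simp add: weighted_divergence_outside_support[OF f] stress0)
  qed simp
  then have "(LINT p:K|?V. deriv (\<lambda>t. ?E t p) 0) = (\<integral>p. weighted_divergence ?f p - stress_term p \<partial>?V)"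
    by (simp only: set_lebesgue_integral_def rate ind)
  also have "\<dots> = - (\<integral>p. stress_term p \<partial>?V)"
    using integral_weighted_divergence[OF f] stress_int by simp
  finally show ?thesis using deriv by (simp add: stress_term_def)
qed

end
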